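(* Let $f\in\operatorname{Sym}\mathscr P\langle\mathbf q,\bar{\mathbf q}\rangle$, $g_1,\dots,g_m\in\operatorname{Sym}\mathbb R\langle\mathbf q,\bar{\mathbf q}\rangle$ and $h_1,\dots,h_\ell\in\mathbb R\langle\mathbf q,\bar{\mathbf q}\rangle$. Assume that $\mathcal Q^{\mathbb H}(\mathbf g,\mathbf h)$ is Archimedean. Then $f_d^*\nearrow f_{\min}$ and $f_d\nearrow f_{\min}$ as $d\to\infty$ (monotone nondecreasing convergence), where $f_{\min}$ is the optimal value of minimizing $f(\mathbf q,\bar{\mathbf q})$ over $K_{\mathbf g,\mathbf h}$ and $f_d$, $f_d^*$ are the optimal values of the order-$d$ moment and QSOS relaxations defined in the context.
   Context: $\mathbb H$ is the skew field of quaternions, $\mathcal R(a)$ the real part. Fix $n\ge1$ and letters $q_1,\dots,q_n,\bar q_1,\dots,\bar q_n$. $\mathcal W$ is the set of words (including the empty word $1$) in these letters, where words with the same normal form are identified: any consecutive factor $q_i\bar q_i$ or $\bar q_iq_i$ is written $|q_i|^2$ and moved to the front, so each word is uniquely $\prod_i|q_i|^{2\alpha_i}\tilde w$ with $\tilde w$ containing no such factor. $|w|$ is the length, $\mathcal W_t$ the words of length at most $t$; $w^*$ is obtained by reversing $w$ and exchanging $q_i\leftrightarrow\bar q_i$. $\mathbb R\langle\mathbf q,\bar{\mathbf q}\rangle$ is the real $*$-algebra of finite sums $\sum_wp_ww$, $p_w\in\mathbb R$, $p^*=\sum p_ww^*$. $\mathbb H\langle\mathbf q,\bar{\mathbf q}\rangle$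 is the real free product of $\mathbb H$ (involution: conjugation) and $\mathbb R\langle\mathbf q,\bar{\mathbf q}\rangle$; constants do not commute with letters. Inside it, $\mathcal L$ is the space of finite sums $\sum_wp_ww$, $p_w\in\mathbb H$, and $\mathscr P\langle\mathbf q,\bar{\mathbf q}\rangle$ is the space of finite sums $p=\sum_{a,b}a\,p_{a,b}\,b$, $p_{a,b}\in\mathbb H$, with $p^*=\sum b^*\bar p_{a,b}a^*$ and $\deg p=\max\{|a|+|b|:p_{a,b}\ne0\}$; $\mathscr P\langle\mathbf q,\bar{\mathbf q}\rangle_{2d}$ is the subspace of degree at most $2d$. $\operatorname{Sym}$ denotes elements with $p=p^*$; $[a,b]$ is the commutator. Words $u,v$ are cyclically equivalent, $u\stackrel{\mathrm{cyc}}{\sim}v$, if $u=w_1w_2$, $v=w_2w_1$ for some words. $K_{\mathbf g,\mathbf h}=\{\mathbf a\in\mathbb H^n:g_i(\mathbf a,\bar{\mathbf a})\ge0\ (1\le i\le m),\ h_j(\mathbf a,\bar{\mathbf a})=0\ (1\le j\le\ell)\}$ (evaluation $q_i\mapsto a_i$, $\bar q_i\mapsto\bar a_i$); $f_{\min}=\inf_{K_{\mathbf g,\mathbf h}}f$, with $f_{\min}=+\infty$ if $K_{\mathbf g,\mathbf h}=\varnothing$. $\mathcal I_n^{\mathbb H}$ is the ideal of all elements of $\mathbb H\langle\mathbf q,\bar{\mathbf q}\rangle$ vanishing under evaluation at every $\mathbf a\in\mathbb H^n$. $\Sigma^{\mathbb H}$ is the set of finite sums $\sum_sp_s^*p_s$,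 $p_s\in\mathcal L$; $\Sigma_d^{\mathbb H}=\Sigma^{\mathbb H}\cap\mathscr P\langle\mathbf q,\bar{\mathbf q}\rangle_{2d}$. $\mathcal Q^{\mathbb H}(\mathbf g,\mathbf h)$ is the set of all finite expressions $$\sigma_0+\tfrac12\sum_{i=1}^m(\sigma_ig_i+g_i\sigma_i)+\sum_{j=1}^\ell\sum_\alpha(\tau_{j\alpha}h_j\nu_{j\alpha}^*+\nu_{j\alpha}h_j^*\tau_{j\alpha}^* ),\quad\sigma_i\in\Sigma^{\mathbb H},\ \tau_{j\alpha},\nu_{j\alpha}\in\mathcal L;$$ it is Archimedean if $R-\sum_{i=1}^n|q_i|^2\in\mathcal Q^{\mathbb H}(\mathbf g,\mathbf h)$ for some $R>0$. $\mathcal Q^{\mathbb H}(\mathbf g,\mathbf h)_{2d}$ is the subset of such expressions with $\sigma_0\in\Sigma_d^{\mathbb H}$, $\sigma_i\in\Sigma^{\mathbb H}_{d-\lceil\deg(g_i)/2\rceil}$, $\deg\tau_{j\alpha}+\deg\nu_{j\alpha}\le2d-\deg h_j$. Here $d$ ranges over integers large enough that $2d$ is at least the degrees of $f$, all $g_i$ and all $h_j$. For $\mathbf y=(y_w)_{w\in\mathcal W_{2d}}$ in $\mathbb H$: $L_{\mathbf y}(\sum p_ww)=\sum p_wy_w\in\mathbb H$ for real coefficients $p_w$; $L_{\mathbf y}^{\mathcal R}(\sum a\,p_{a,b}\,b)=\mathcal R(\sum p_{a,b}y_{ba})$ on $\mathscr P\langle\mathbf q,\bar{\mathbf q}\rangle_{2d}$;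 $[\mathbf M_t(\mathbf y)]_{u,v}=L_{\mathbf y}(u^*v)$, $[\mathbf M_t(g\mathbf y)]_{u,v}=L_{\mathbf y}(u^*gv)$, $u,v\in\mathcal W_t$; $\succeq0$ means Hermitian with nonnegative quadratic form on quaternionic vectors. Moment relaxation: $f_d$ is the infimum of $L_{\mathbf y}^{\mathcal R}(f)$ over $\mathbf y=(y_w)_{w\in\mathcal W_{2d}}$ in $\mathbb H$ with $y_1=1$; $y_w=\overline{y_{w^*}}$; $\mathcal R(y_u)=\mathcal R(y_v)$ whenever $u\stackrel{\mathrm{cyc}}{\sim}v$; $\mathbf M_d(\mathbf y)\succeq0$; $\mathbf M_{d-\lceil\deg(g_i)/2\rceil}(g_i\mathbf y)\succeq0$ for all $i$; $L_{\mathbf y}(uh_jv)=0$ for all $j$ and words with $|u|+|v|\le2d-\deg h_j$; and $L_{\mathbf y}(u[w+w^*,q_i]v)=0$ for all $i$ and words with $|u|+|v|+|w|\le2d-1$. QSOS relaxation: $f_d^*=\sup\{\lambda\in\mathbb R:f-\lambda\in\mathcal Q^{\mathbb H}(\mathbf g,\mathbf h)_{2d}+(\mathcal I_n^{\mathbb H}\cap\operatorname{Sym}\mathscr P\langle\mathbf q,\bar{\mathbf q}\rangle_{2d})\}$. Conventions: $\inf\varnothing=+\infty$, $\sup\varnothing=-\infty$. *)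

theory Defs
  imports "HOL-Analysis.Analysis" "HOL-Library.Poly_Mapping" "HOL-Library.Multiset"
begin

section \<open>The skew field of quaternions\<close>

datatype quat = Quat (qRe: real) (qI: real) (qJ: real) (qK: real)

lemma quat_eq_iff: "x = y \<longleftrightarrow> qRe x = qRe y \<and> qI x = qI y \<and> qJ x = qJ y \<and> qK x = qK y"
  by (cases x; cases y) auto

instantiation quat :: real_div_algebra
begin

definition "0 = Quat 0 0 0 0"
definition "1 = Quat 1 0 0 0"
definition "x + y = Quat (qRe x + qRe y) (qI x + qI y) (qJ x + qJ y) (qK x + qK y)"
definition "- x = Quat (- qRe x) (- qI x) (- qJ x) (- qK x)"
definition "x - (y::quat) = x + - y"
definition "r *\<^sub>R x = Quat (r * qRe x) (r * qI x) (r * qJ x) (r * qK x)"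
definition "x * y = Quat
  (qRe x * qRe y - qI x * qI y - qJ x * qJ y - qK x * qK y)
  (qRe x * qI y + qI x * qRe y + qJ x * qK y - qK x * qJ y)
  (qRe x * qJ y - qI x * qK y + qJ x * qRe y + qK x * qI y)
  (qRe x * qK y + qI x * qJ y - qJ x * qI y + qK x * qRe y)"
definition "inverse x = (1 / ((qRe x)\<^sup>2 + (qI x)\<^sup>2 + (qJ x)\<^sup>2 + (qK x)\<^sup>2)) *\<^sub>R
  Quat (qRe x) (- qI x) (- qJ x) (- qK x)"
definition "x div (y::quat) = x * inverse y"

lemmas quat_ops = zero_quat_def one_quat_def plus_quat_def uminus_quat_def minus_quat_def
  scaleR_quat_def times_quat_def

lemma quat_inverse_aux:
  fixes x :: quat
  assumes "x \<noteq> 0"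
  shows "inverse x * x = 1 \<and> x * inverse x = 1"
proof -
  define N where "N = (qRe x)\<^sup>2 + (qI x)\<^sup>2 + (qJ x)\<^sup>2 + (qK x)\<^sup>2"
  have "qRe x \<noteq> 0 \<or> qI x \<noteq> 0 \<or> qJ x \<noteq> 0 \<or> qK x \<noteq> 0"
    using assms by (auto simp: quat_eq_iff quat_ops)
  then have "N \<noteq> 0"
    unfolding N_def by (smt (verit) zero_le_power2 zero_eq_power2)
  moreover have "qRe x * qRe x + qI x * qI x + qJ x * qJ x + qK x * qK x = N"
    by (simp add: N_def power2_eq_square)
  ultimately show ?thesis
    unfolding inverse_quat_def N_def[symmetric]
    by (simp add: quat_eq_iff quat_ops) (simp add: field_simps)
qed

instance
proof
  show "inverse (0::quat) = 0"
    by (simp add: inverse_quat_def quat_ops)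
qed (auto simp: quat_inverse_aux divide_quat_def,
    auto simp: quat_eq_iff quat_ops algebra_simps)

end

definition qconj :: "quat \<Rightarrow> quat" where
  "qconj x = Quat (qRe x) (- qI x) (- qJ x) (- qK x)"

definition qnonneg :: "quat \<Rightarrow> bool" where
  "qnonneg x \<longleftrightarrow> (\<exists>r\<ge>0. x = of_real r)"

lemma qconj_simps [simp]:
  "qconj (x + y) = qconj x + qconj y" "qconj (x * y) = qconj y * qconj x"
  "qconj (qconj x) = x" "qconj 0 = 0" "qconj 1 = 1" "qconj (- x) = - qconj x"
  by (auto simp: qconj_def quat_eq_iff quat_ops)

lemma of_real_quat: "of_real r = Quat r 0 0 0"
  by (simp add: of_real_def quat_ops)

lemma qconj_of_real [simp]: "qconj (of_real r) = of_real r"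
  by (simp add: of_real_quat qconj_def)

lemma of_real_quat_comm: "of_real r * x = x * (of_real r :: quat)"
  by (simp add: of_real_quat quat_eq_iff quat_ops)


section \<open>Words\<close>

datatype 'n letter = Q 'n | Qbar 'n

fun bar :: "'n letter \<Rightarrow> 'n letter" where
  "bar (Q i) = Qbar i"
| "bar (Qbar i) = Q i"

fun idx :: "'n letter \<Rightarrow> 'n" where
  "idx (Q i) = i"
| "idx (Qbar i) = i"

lemma bar_bar [simp]: "bar (bar x) = x"
  and idx_bar [simp]: "idx (bar x) = idx x"
  by (cases x; simp)+

text \<open>
  A pair \<open>(A, w)\<close> stands for the normal form whose central factor contains \<open>|q\<^sub>i|\<^sup>2\<close> exactly
  \<open>count A i\<close> times, followed by the word \<open>w\<close> without factors \<open>q\<^sub>i q\<^sub>i\<^sup>*\<close> or \<open>q\<^sub>i\<^sup>* q\<^sub>i\<close>.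
\<close>

fun nf_cons :: "'n letter \<Rightarrow> 'n multiset \<times> 'n letter list \<Rightarrow> 'n multiset \<times> 'n letter list" where
  "nf_cons x (A, []) = (A, [x])"
| "nf_cons x (A, y # w) = (if y = bar x then (add_mset (idx x) A, w) else (A, x # y # w))"

definition nf :: "'n letter list \<Rightarrow> 'n multiset \<times> 'n letter list" where
  "nf w = foldr nf_cons w ({#}, [])"

fun reduced :: "'n letter list \<Rightarrow> bool" where
  "reduced (x # y # w) \<longleftrightarrow> y \<noteq> bar x \<and> reduced (y # w)"
| "reduced _ \<longleftrightarrow> True"

lemma reduced_tl: "reduced (x # w) \<Longrightarrow> reduced w"
  by (cases w) auto

lemma nf_cons_add: "nf_cons x (A + B, w) = (A + fst (nf_cons x (B, w)), snd (nf_cons x (B, w)))"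
  by (cases w) auto

lemma nf_cons_reduced: "reduced (snd p) \<Longrightarrow> reduced (snd (nf_cons x p))"
  by (cases p; cases "snd p") (auto dest: reduced_tl)

lemma foldr_nf_cons_reduced: "reduced (snd p) \<Longrightarrow> reduced (snd (foldr nf_cons w p))"
  by (induction w) (auto intro: nf_cons_reduced)

lemma nf_reduced: "reduced (snd (nf w))"
  by (simp add: nf_def foldr_nf_cons_reduced)

lemma foldr_nf_cons_add:
  "foldr nf_cons u (A + B, w) = (A + fst (foldr nf_cons u (B, w)), snd (foldr nf_cons u (B, w)))"
  by (induction u) (auto simp: nf_cons_add)

lemma nf_cons_cancel:
  "reduced (snd p) \<Longrightarrow> nf_cons x (nf_cons (bar x) p) = (add_mset (idx x) (fst p), snd p)"
  by (cases p; cases "snd p") (auto split: if_splits elim: reduced.elims)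

lemma foldr_nf_cons_nf:
  assumes "reduced (snd p)"
  shows "foldr nf_cons u p =
    (fst (nf u) + fst (foldr nf_cons (snd (nf u)) p), snd (foldr nf_cons (snd (nf u)) p))"
proof (induction u)
  case Nil
  then show ?case by (simp add: nf_def)
next
  case (Cons x u)
  obtain A w where Aw: "nf u = (A, w)" by fastforce
  have nfx: "nf (x # u) = nf_cons x (A, w)"
    using Aw by (simp add: nf_def)
  have step: "foldr nf_cons (x # u) p = nf_cons x (A + fst (foldr nf_cons w p), snd (foldr nf_cons w p))"
    using Cons Aw by simp
  show ?case
  proof (cases w)
    case Nil
    then show ?thesis using nfx step by (simp add: nf_cons_add)
  next
    case (Cons y v)
    show ?thesis
    proof (cases "y = bar x")
      case True
      let ?q = "foldr nf_cons v p"
      have r: "reduced (snd ?q)"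
        using assms by (rule foldr_nf_cons_reduced)
      have "nf_cons x (foldr nf_cons w p) = (add_mset (idx x) (fst ?q), snd ?q)"
        using nf_cons_cancel[OF r, of x] Cons True by simp
      then show ?thesis
        using nfx step Cons True by (simp add: nf_cons_add)
    next
      case False
      then show ?thesis using nfx step Cons by (simp add: nf_cons_add)
    qed
  qed
qed

lemma nf_append: "nf (u @ v) = foldr nf_cons u (nf v)"
  by (simp add: nf_def)

lemma nf_append_cong:
  assumes "nf u = nf u'" "nf v = nf v'"
  shows "nf (u @ v) = nf (u' @ v')"
  using assms foldr_nf_cons_nf[OF nf_reduced[of v], of u]
    foldr_nf_cons_nf[OF nf_reduced[of v], of u'] by (simp add: nf_append)

lemma nf_insert_pair:
  "nf (u @ x # bar x # v) = (add_mset (idx x) (fst (nf (u @ v))), snd (nf (u @ v)))"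
proof -
  have "nf (x # bar x # v) = ({#idx x#} + fst (nf v), snd (nf v))"
    using nf_cons_cancel[OF nf_reduced[of v], of x] by (simp add: nf_def)
  then show ?thesis
    using foldr_nf_cons_add[of u "{#idx x#}" "fst (nf v)" "snd (nf v)"] by (simp add: nf_append)
qed

definition rev_bar :: "'n letter list \<Rightarrow> 'n letter list" where
  "rev_bar w = rev (map bar w)"

lemma rev_bar_append: "rev_bar (u @ v) = rev_bar v @ rev_bar u"
  and rev_bar_rev_bar [simp]: "rev_bar (rev_bar u) = u"
  by (simp_all add: rev_bar_def rev_map comp_def)

lemma nf_rev_bar:
  "nf (rev_bar w) =
    (fst (nf w) + fst (nf (rev_bar (snd (nf w)))), snd (nf (rev_bar (snd (nf w)))))"
proof (induction w)
  case Nil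
  then show ?case by (simp add: nf_def rev_bar_def)
next
  case (Cons x w)
  obtain A z where Az: "nf w = (A, z)" by fastforce
  have nfx: "nf (x # w) = nf_cons x (A, z)"
    using Az by (simp add: nf_def)
  have app: "nf (rev_bar (x # w)) =
      (A + fst (nf (rev_bar z @ [bar x])), snd (nf (rev_bar z @ [bar x])))"
  proof -
    have e: "rev_bar (x # w) = rev_bar w @ [bar x]" by (simp add: rev_bar_def)
    have r: "reduced (snd (nf [bar x]))" by (rule nf_reduced)
    show ?thesis
      using Cons Az foldr_nf_cons_nf[OF r, of "rev_bar w"] foldr_nf_cons_nf[OF r, of "rev_bar z"]
      by (simp add: e nf_append add.assoc)
  qed
  show ?case
  proof (cases "z \<noteq> [] \<and> hd z = bar x")
    case True
    then obtain v where z: "z = bar x # v" by (cases z) auto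
    have "rev_bar z @ [bar x] = rev_bar v @ x # bar x # []"
      by (simp add: z rev_bar_def)
    then show ?thesis
      using nfx app nf_insert_pair[of "rev_bar v" x "[]"] by (simp add: z)
  next
    case False
    then have "nf_cons x (A, z) = (A, x # z)" by (cases z) auto
    then show ?thesis
      using nfx app by (simp add: rev_bar_def)
  qed
qed

lemma length_nf: "length w = 2 * size (fst (nf w)) + length (snd (nf w))"
proof (induction w)
  case Nil
  then show ?case by (simp add: nf_def)
next
  case (Cons x w)
  obtain A z where Az: "nf w = (A, z)" by fastforce
  then have "nf (x # w) = nf_cons x (A, z)"
    by (simp add: nf_def)
  then show ?case using Cons Az by (cases z) auto
qed

quotient_type 'n word = "'n letter list" / "\<lambda>u v. nf u = nf v"
  by (intro equivpI reflpI sympI transpI) auto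

text \<open>
  The monoid of words is written additively (\<open>+\<close> is concatenation and \<open>0\<close> is the empty word),
  because \<open>Poly_Mapping\<close> then provides its monoid algebra; it is not commutative.
\<close>

instantiation word :: (type) monoid_add
begin

lift_definition zero_word :: "'a word" is "[]" .

lift_definition plus_word :: "'a word \<Rightarrow> 'a word \<Rightarrow> 'a word" is "(@)"
  by (rule nf_append_cong)

instance
  by standard (transfer; simp)+

end

lift_definition letter :: "'n letter \<Rightarrow> 'n word" is "\<lambda>x. [x]" .

lift_definition wlen :: "'n word \<Rightarrow> nat" is length
  by (metis length_nf)

lift_definition wstar :: "'n word \<Rightarrow> 'n word" is rev_bar
  by (metis nf_rev_bar)

definition words_le :: "nat \<Rightarrow> 'n word set" where
  "words_le t = {w. wlen w \<le> t}"

definition cyc_equiv :: "'n word \<Rightarrow> 'n word \<Rightarrow> bool" where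
  "cyc_equiv u v \<longleftrightarrow> (\<exists>w1 w2. u = w1 + w2 \<and> v = w2 + w1)"

lemma wstar_simps [simp]:
  "wstar (u + v) = wstar v + wstar u" "wstar 0 = 0" "wstar (wstar u) = u"
  by (transfer; simp add: rev_bar_def rev_map comp_def)+

lemma letter_bar_central: "letter x + letter (bar x) + w = w + (letter x + letter (bar x))"
proof (transfer)
  fix x :: "'n letter" and w
  show "nf (([x] @ [bar x]) @ w) = nf (w @ [x] @ [bar x])"
    using nf_insert_pair[of "[]" x w] nf_insert_pair[of w x "[]"] by simp
qed

lemma letter_bar_commute: "letter x + letter (bar x) = letter (bar x) + letter x"
proof (transfer)
  fix x :: "'n letter"
  show "nf ([x] @ [bar x]) = nf ([bar x] @ [x])"
    using nf_insert_pair[of "[]" x "[]"] nf_insert_pair[of "[]" "bar x" "[]"] by simp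
qed

fun letter_eval :: "('n \<Rightarrow> quat) \<Rightarrow> 'n letter \<Rightarrow> quat" where
  "letter_eval a (Q i) = a i"
| "letter_eval a (Qbar i) = qconj (a i)"

definition list_eval :: "('n \<Rightarrow> quat) \<Rightarrow> 'n letter list \<Rightarrow> quat" where
  "list_eval a w = prod_list (map (letter_eval a) w)"

definition qnorm2 :: "quat \<Rightarrow> real" where
  "qnorm2 x = (qRe x)\<^sup>2 + (qI x)\<^sup>2 + (qJ x)\<^sup>2 + (qK x)\<^sup>2"

lemma letter_eval_bar: "letter_eval a x * letter_eval a (bar x) = of_real (qnorm2 (a (idx x)))"
  by (cases x)
    (auto simp: of_real_quat qnorm2_def qconj_def quat_eq_iff quat_ops power2_eq_square)

lemma list_eval_nf:
  "list_eval a w =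
    of_real (\<Prod>i\<in>#fst (nf w). qnorm2 (a i)) * list_eval a (snd (nf w))"
proof (induction w)
  case Nil
  then show ?case by (simp add: nf_def list_eval_def)
next
  case (Cons x w)
  obtain A z where Az: "nf w = (A, z)" by fastforce
  let ?c = "of_real (\<Prod>i\<in>#A. qnorm2 (a i)) :: quat"
  have nfx: "nf (x # w) = nf_cons x (A, z)"
    using Az by (simp add: nf_def)
  have 1: "list_eval a (x # w) = ?c * (letter_eval a x * list_eval a z)"
    using Cons Az of_real_quat_comm[of "\<Prod>i\<in>#A. qnorm2 (a i)" "letter_eval a x"]
    by (simp add: list_eval_def flip: mult.assoc)
  show ?case
  proof (cases "z \<noteq> [] \<and> hd z = bar x")
    case True
    then obtain v where z: "z = bar x # v" by (cases z) auto
    have "letter_eval a x * list_eval a z = of_real (qnorm2 (a (idx x))) * list_eval a v"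
      by (simp add: z list_eval_def letter_eval_bar flip: mult.assoc)
    then have "list_eval a (x # w) = of_real (qnorm2 (a (idx x)) * (\<Prod>i\<in>#A. qnorm2 (a i))) * list_eval a v"
      using 1 by (simp add: mult.commute flip: mult.assoc of_real_mult)
    then show ?thesis
      using nfx by (simp add: z)
  next
    case False
    then have "nf_cons x (A, z) = (A, x # z)" by (cases z) auto
    then show ?thesis
      using nfx 1 by (simp add: list_eval_def)
  qed
qed

lift_definition weval :: "('n \<Rightarrow> quat) \<Rightarrow> 'n word \<Rightarrow> quat" is list_eval
  by (metis list_eval_nf)

lemma weval_simps [simp]:
  "weval a (u + v) = weval a u * weval a v" "weval a 0 = 1"
  by (transfer; simp add: list_eval_def)+


section \<open>Finite families of coefficients\<close>

text \<open>
  The algebra \<open>\<real>\<langle>q, q\<^sup>*\<rangle>\<close> is the monoid algebra \<open>'n word \<Rightarrow>\<^sub>0 real\<close> with the product of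
  \<open>Poly_Mapping\<close>. The types \<open>'n word \<Rightarrow>\<^sub>0 quat\<close> and \<open>'n word \<times> 'n word \<Rightarrow>\<^sub>0 quat\<close> only serve as
  coefficient families of the sums \<open>\<Sum> p\<^sub>w w\<close> and \<open>\<Sum> a p\<^sub>a\<^sub>,\<^sub>b b\<close>; their \<open>Poly_Mapping\<close> products are
  never used.
\<close>

type_synonym 'n rpoly = "'n word \<Rightarrow>\<^sub>0 real"

definition wmono :: "'n word \<Rightarrow> 'n rpoly" where
  "wmono w = Poly_Mapping.single w 1"

definition rstar :: "'n rpoly \<Rightarrow> 'n rpoly" where
  "rstar p = (\<Sum>w\<in>Poly_Mapping.keys p. Poly_Mapping.single (wstar w) (Poly_Mapping.lookup p w))"

text \<open>The degree of the zero element is taken to be \<open>0\<close>.\<close>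

definition wdeg :: "('n word \<Rightarrow>\<^sub>0 'b::zero) \<Rightarrow> nat" where
  "wdeg p = Max (insert 0 (wlen ` Poly_Mapping.keys p))"

definition mdeg :: "('n word \<times> 'n word \<Rightarrow>\<^sub>0 quat) \<Rightarrow> nat" where
  "mdeg p = Max (insert 0 ((\<lambda>(a, b). wlen a + wlen b) ` Poly_Mapping.keys p))"


section \<open>The free product of the quaternions and the real word algebra\<close>

text \<open>
  The free product over \<open>\<real>\<close> is the coproduct of unital real algebras, presented by generators
  and relations: \<open>heq\<close> is the least congruence on terms that makes them a real algebra and makes
  \<open>EConst\<close> and the linear extension of \<open>EWord\<close> homomorphisms of unital real algebras.
  The scalar action of \<open>r\<close> is multiplication by \<open>EConst (of_real r)\<close>.
\<close>

datatype 'n hexp =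
  EConst quat | EWord "'n word" | EAdd "'n hexp" "'n hexp" | EMul "'n hexp" "'n hexp"

inductive heq :: "'n hexp \<Rightarrow> 'n hexp \<Rightarrow> bool" where
  refl: "heq x x"
| sym: "heq x y \<Longrightarrow> heq y x"
| trans: "heq x y \<Longrightarrow> heq y z \<Longrightarrow> heq x z"
| add_cong: "heq x x' \<Longrightarrow> heq y y' \<Longrightarrow> heq (EAdd x y) (EAdd x' y')"
| mul_cong: "heq x x' \<Longrightarrow> heq y y' \<Longrightarrow> heq (EMul x y) (EMul x' y')"
| add_assoc: "heq (EAdd (EAdd x y) z) (EAdd x (EAdd y z))"
| add_comm: "heq (EAdd x y) (EAdd y x)"
| add_zero: "heq (EAdd (EConst 0) x) x"
| add_neg: "heq (EAdd (EMul (EConst (- 1)) x) x) (EConst 0)"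
| mul_assoc: "heq (EMul (EMul x y) z) (EMul x (EMul y z))"
| mul_one: "heq (EMul (EConst 1) x) x"
| distrib_right: "heq (EMul (EAdd x y) z) (EAdd (EMul x z) (EMul y z))"
| distrib_left: "heq (EMul z (EAdd x y)) (EAdd (EMul z x) (EMul z y))"
| real_central: "heq (EMul (EConst (of_real r)) x) (EMul x (EConst (of_real r)))"
| const_add: "heq (EConst (c + d)) (EAdd (EConst c) (EConst d))"
| const_mul: "heq (EConst (c * d)) (EMul (EConst c) (EConst d))"
| word_empty: "heq (EWord 0) (EConst 1)"
| word_mul: "heq (EWord (u + v)) (EMul (EWord u) (EWord v))"

primrec eeval :: "('n \<Rightarrow> quat) \<Rightarrow> 'n hexp \<Rightarrow> quat" where
  "eeval a (EConst c) = c"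
| "eeval a (EWord w) = weval a w"
| "eeval a (EAdd x y) = eeval a x + eeval a y"
| "eeval a (EMul x y) = eeval a x * eeval a y"

primrec estar :: "'n hexp \<Rightarrow> 'n hexp" where
  "estar (EConst c) = EConst (qconj c)"
| "estar (EWord w) = EWord (wstar w)"
| "estar (EAdd x y) = EAdd (estar x) (estar y)"
| "estar (EMul x y) = EMul (estar y) (estar x)"

lemma heq_eeval: "heq x y \<Longrightarrow> eeval a x = eeval a y"
  by (induction rule: heq.induct) (auto simp: algebra_simps of_real_quat_comm)

lemma heq_mul_one_right: "heq (EMul x (EConst 1)) x"
  using heq.real_central[of 1 x] heq.mul_one[of x] by (metis heq.sym heq.trans of_real_1)

lemma heq_estar: "heq x y \<Longrightarrow> heq (estar x) (estar y)"
proof (induction rule: heq.induct)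
  case (add_neg x)
  have "heq (EMul (EConst (- 1)) (estar x)) (EMul (estar x) (EConst (- 1)))"
    using heq.real_central[of "- 1"] by simp
  then show ?case
    using heq.trans[OF heq.add_cong[OF heq.sym heq.refl] heq.add_neg] by simp
next
  case (mul_one x)
  then show ?case by (simp add: heq_mul_one_right)
next
  case (mul_assoc x y z)
  show ?case by (simp, rule heq.sym, rule heq.mul_assoc)
next
  case (real_central r x)
  show ?case by (simp, rule heq.sym, rule heq.real_central)
qed (auto intro: heq.intros)

quotient_type 'n hpoly = "'n hexp" / heq
  by (intro equivpI reflpI sympI transpI) (blast intro: heq.intros)+

lift_definition const :: "quat \<Rightarrow> 'n hpoly" is EConst .
lift_definition hword :: "'n word \<Rightarrow> 'n hpoly" is EWord .
lift_definition heval :: "('n \<Rightarrow> quat) \<Rightarrow> 'n hpoly \<Rightarrow> quat" is eeval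
  by (rule heq_eeval)
lift_definition hstar :: "'n hpoly \<Rightarrow> 'n hpoly" is estar
  by (rule heq_estar)

instantiation hpoly :: (type) real_algebra_1
begin

lift_definition zero_hpoly :: "'a hpoly" is "EConst 0" .
lift_definition one_hpoly :: "'a hpoly" is "EConst 1" .
lift_definition plus_hpoly :: "'a hpoly \<Rightarrow> 'a hpoly \<Rightarrow> 'a hpoly" is EAdd
  by (rule heq.add_cong)
lift_definition times_hpoly :: "'a hpoly \<Rightarrow> 'a hpoly \<Rightarrow> 'a hpoly" is EMul
  by (rule heq.mul_cong)
definition "- x = const (- 1) * (x :: 'a hpoly)"
definition "x - y = x + - (y :: 'a hpoly)"
definition "r *\<^sub>R x = const (of_real r) * (x :: 'a hpoly)"

lemma const_simps: "const (c + d) = const c + const d" "const (c * d) = const c * const d"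
  "const 0 = 0" "const 1 = 1"
  by (transfer; blast intro: heq.intros)+

lemma const_real_central: "x * const (of_real r) = const (of_real r) * x"
  by (transfer; blast intro: heq.intros)

instance
proof
  fix x y z :: "'a hpoly" and r s :: real
  show "x + y + z = x + (y + z)" by (transfer; rule heq.intros)
  show "x + y = y + x" by (transfer; rule heq.intros)
  show "0 + x = x" by (transfer; rule heq.intros)
  show "- x + x = 0" unfolding uminus_hpoly_def by (transfer; rule heq.intros)
  show "x - y = x + - y" by (simp add: minus_hpoly_def)
  show "x * y * z = x * (y * z)" by (transfer; rule heq.intros)
  show "1 * x = x" by (transfer; rule heq.intros)
  show "x * 1 = x" by (transfer; rule heq_mul_one_right)
  show dr: "(x + y) * z = x * z + y * z" for x y z :: "'a hpoly" by (transfer; rule heq.intros)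
  show dl: "x * (y + z) = x * y + x * z" for x y z :: "'a hpoly" by (transfer; rule heq.intros)
  show "(0::'a hpoly) \<noteq> 1"
    by transfer (metis heq_eeval eeval.simps(1) zero_neq_one)
  have as: "x * y * z = x * (y * z)" for x y z :: "'a hpoly" by (transfer; rule heq.intros)
  show "r *\<^sub>R (x + y) = r *\<^sub>R x + r *\<^sub>R y" by (simp add: scaleR_hpoly_def dl)
  show "(r + s) *\<^sub>R x = r *\<^sub>R x + s *\<^sub>R x" by (simp add: scaleR_hpoly_def const_simps dr)
  show "r *\<^sub>R s *\<^sub>R x = (r * s) *\<^sub>R x" by (simp add: scaleR_hpoly_def const_simps as)
  show "1 *\<^sub>R x = x" unfolding scaleR_hpoly_def by (simp, transfer, rule heq.intros)
  show "r *\<^sub>R x * y = r *\<^sub>R (x * y)" by (simp add: scaleR_hpoly_def as)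
  show "x * r *\<^sub>R y = r *\<^sub>R (x * y)"
    by (metis scaleR_hpoly_def as const_real_central)
qed

end

definition of_rpoly :: "'n rpoly \<Rightarrow> 'n hpoly" where
  "of_rpoly p = (\<Sum>w\<in>Poly_Mapping.keys p. Poly_Mapping.lookup p w *\<^sub>R hword w)"

text \<open>The elements \<open>\<Sum> p\<^sub>w w\<close> of \<open>\<L>\<close> and \<open>\<Sum> a p\<^sub>a\<^sub>,\<^sub>b b\<close> of \<open>\<P>\<close> given by coefficient families.\<close>

definition lpoly :: "('n word \<Rightarrow>\<^sub>0 quat) \<Rightarrow> 'n hpoly" where
  "lpoly p = (\<Sum>w\<in>Poly_Mapping.keys p. const (Poly_Mapping.lookup p w) * hword w)"

definition mpoly :: "('n word \<times> 'n word \<Rightarrow>\<^sub>0 quat) \<Rightarrow> 'n hpoly" where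
  "mpoly p = (\<Sum>(a, b)\<in>Poly_Mapping.keys p.
     hword a * const (Poly_Mapping.lookup p (a, b)) * hword b)"

definition P_space :: "'n hpoly set" where
  "P_space = range mpoly"

definition P_le :: "nat \<Rightarrow> 'n hpoly set" where
  "P_le t = {mpoly p | p. mdeg p \<le> t}"

text \<open>
  The family \<open>p\<^sub>a\<^sub>,\<^sub>b\<close> is not unique, since \<open>a r b = r (ab)\<close> for real \<open>r\<close>; the degree is
  that of a representation without superfluous terms.
\<close>

definition hdeg :: "'n hpoly \<Rightarrow> nat" where
  "hdeg x = (LEAST t. x \<in> P_le t)"

definition Sym :: "'n hpoly set \<Rightarrow> 'n hpoly set" where
  "Sym S = {x \<in> S. hstar x = x}"

definition vanishing_ideal :: "'n hpoly set" where
  "vanishing_ideal = {x. \<forall>a. heval a x = 0}"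


section \<open>The polynomial optimization problem\<close>

definition K_set :: "'n rpoly list \<Rightarrow> 'n rpoly list \<Rightarrow> ('n \<Rightarrow> quat) set" where
  "K_set g h = {a. (\<forall>i<length g. qnonneg (heval a (of_rpoly (g ! i)))) \<and>
                   (\<forall>j<length h. heval a (of_rpoly (h ! j)) = 0)}"

text \<open>For symmetric \<open>f\<close> the value \<open>heval a f\<close> is real.\<close>

definition f_min :: "'n hpoly \<Rightarrow> 'n rpoly list \<Rightarrow> 'n rpoly list \<Rightarrow> ereal" where
  "f_min f g h = (INF a\<in>K_set g h. ereal (qRe (heval a f)))"

definition half_deg :: "'n rpoly \<Rightarrow> nat" where
  "half_deg p = nat \<lceil>real (wdeg p) / 2\<rceil>"


section \<open>Quadratic modules and the QSOS relaxation\<close>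

definition SOS :: "'n hpoly set" where
  "SOS = {(\<Sum>p\<leftarrow>ps. hstar (lpoly p) * lpoly p) | ps. True}"

definition SOS_le :: "nat \<Rightarrow> 'n hpoly set" where
  "SOS_le d = SOS \<inter> P_le (2 * d)"

definition qm_expr :: "'n rpoly list \<Rightarrow> 'n rpoly list \<Rightarrow> 'n hpoly \<Rightarrow> (nat \<Rightarrow> 'n hpoly) \<Rightarrow>
    (nat \<Rightarrow> (('n word \<Rightarrow>\<^sub>0 quat) \<times> ('n word \<Rightarrow>\<^sub>0 quat)) list) \<Rightarrow> 'n hpoly" where
  "qm_expr g h \<sigma>0 \<sigma> T =
     \<sigma>0 + (1/2) *\<^sub>R (\<Sum>i<length g. \<sigma> i * of_rpoly (g ! i) + of_rpoly (g ! i) * \<sigma> i)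
     + (\<Sum>j<length h. \<Sum>(\<tau>, \<nu>)\<leftarrow>T j.
          lpoly \<tau> * of_rpoly (h ! j) * hstar (lpoly \<nu>)
          + lpoly \<nu> * hstar (of_rpoly (h ! j)) * hstar (lpoly \<tau>))"

definition QM :: "'n rpoly list \<Rightarrow> 'n rpoly list \<Rightarrow> 'n hpoly set" where
  "QM g h = {qm_expr g h \<sigma>0 \<sigma> T | \<sigma>0 \<sigma> T. \<sigma>0 \<in> SOS \<and> (\<forall>i<length g. \<sigma> i \<in> SOS)}"

text \<open>The degree bound on \<open>\<tau>, \<nu>\<close> is \<open>deg \<tau> + deg \<nu> \<le> 2d - deg h\<^sub>j\<close>, without truncated subtraction.\<close>

definition QM_le :: "'n rpoly list \<Rightarrow> 'n rpoly list \<Rightarrow> nat \<Rightarrow> 'n hpoly set" where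
  "QM_le g h d = {qm_expr g h \<sigma>0 \<sigma> T | \<sigma>0 \<sigma> T.
     \<sigma>0 \<in> SOS_le d \<and>
     (\<forall>i<length g. \<sigma> i \<in> SOS_le (d - half_deg (g ! i))) \<and>
     (\<forall>j<length h. \<forall>(\<tau>, \<nu>)\<in>set (T j). wdeg \<tau> + wdeg \<nu> + wdeg (h ! j) \<le> 2 * d)}"

definition archimedean :: "('n::finite) rpoly list \<Rightarrow> 'n rpoly list \<Rightarrow> bool" where
  "archimedean g h \<longleftrightarrow>
     (\<exists>R>0. of_real R - (\<Sum>i\<in>UNIV. hword (letter (Q i) + letter (Qbar i))) \<in> QM g h)"

definition f_qsos :: "'n hpoly \<Rightarrow> 'n rpoly list \<Rightarrow> 'n rpoly list \<Rightarrow> nat \<Rightarrow> ereal" where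
  "f_qsos f g h d = Sup {ereal l | l.
     \<exists>x\<in>QM_le g h d. \<exists>y\<in>vanishing_ideal \<inter> Sym (P_le (2 * d)). f - of_real l = x + y}"


section \<open>The moment relaxation\<close>

text \<open>
  A sequence \<open>y\<close> is indexed by all words, but only its values on words of length at most \<open>2d\<close>
  enter the relaxation of order \<open>d\<close>.
\<close>

definition L_y :: "('n word \<Rightarrow> quat) \<Rightarrow> 'n rpoly \<Rightarrow> quat" where
  "L_y y p = (\<Sum>w\<in>Poly_Mapping.keys p. Poly_Mapping.lookup p w *\<^sub>R y w)"

text \<open>
  The value is computed from any coefficient family of degree at most \<open>2d\<close> representing \<open>x\<close>. The
  choice is immaterial for sequences with \<open>\<R>(y\<^sub>u) = \<R>(y\<^sub>v)\<close> for cyclically equivalent \<open>u, v\<close>.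
\<close>

definition LR_y :: "nat \<Rightarrow> ('n word \<Rightarrow> quat) \<Rightarrow> 'n hpoly \<Rightarrow> real" where
  "LR_y d y x = (let p = (SOME p. mdeg p \<le> 2 * d \<and> mpoly p = x) in
     qRe (\<Sum>(a, b)\<in>Poly_Mapping.keys p. Poly_Mapping.lookup p (a, b) * y (b + a)))"

definition psd :: "'i set \<Rightarrow> ('i \<Rightarrow> 'i \<Rightarrow> quat) \<Rightarrow> bool" where
  "psd S M \<longleftrightarrow> (\<forall>u\<in>S. \<forall>v\<in>S. M u v = qconj (M v u)) \<and>
     (\<forall>x. qnonneg (\<Sum>u\<in>S. \<Sum>v\<in>S. qconj (x u) * M u v * x v))"

definition moment_matrix :: "('n word \<Rightarrow> quat) \<Rightarrow> 'n word \<Rightarrow> 'n word \<Rightarrow> quat" where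
  "moment_matrix y u v = L_y y (wmono (wstar u + v))"

definition localizing_matrix :: "'n rpoly \<Rightarrow> ('n word \<Rightarrow> quat) \<Rightarrow> 'n word \<Rightarrow> 'n word \<Rightarrow> quat" where
  "localizing_matrix g y u v = L_y y (wmono (wstar u) * g * wmono v)"

definition moment_feasible ::
    "'n rpoly list \<Rightarrow> 'n rpoly list \<Rightarrow> nat \<Rightarrow> ('n word \<Rightarrow> quat) \<Rightarrow> bool" where
  "moment_feasible g h d y \<longleftrightarrow>
     y 0 = 1 \<and>
     (\<forall>w\<in>words_le (2 * d). y w = qconj (y (wstar w))) \<and>
     (\<forall>u\<in>words_le (2 * d). \<forall>v\<in>words_le (2 * d). cyc_equiv u v \<longrightarrow> qRe (y u) = qRe (y v)) \<and>
     psd (words_le d) (moment_matrix y) \<and>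
     (\<forall>i<length g. psd (words_le (d - half_deg (g ! i))) (localizing_matrix (g ! i) y)) \<and>
     (\<forall>j<length h. \<forall>u v. wlen u + wlen v + wdeg (h ! j) \<le> 2 * d \<longrightarrow>
        L_y y (wmono u * (h ! j) * wmono v) = 0) \<and>
     (\<forall>i u v w. wlen u + wlen v + wlen w + 1 \<le> 2 * d \<longrightarrow>
        (let s = wmono w + wmono (wstar w); q = wmono (letter (Q i))
         in L_y y (wmono u * (s * q - q * s) * wmono v) = 0))"

definition f_mom :: "'n hpoly \<Rightarrow> 'n rpoly list \<Rightarrow> 'n rpoly list \<Rightarrow> nat \<Rightarrow> ereal" where
  "f_mom f g h d = (INF y\<in>{y. moment_feasible g h d y}. ereal (LR_y d y f))"

definition admissible_order :: "'n hpoly \<Rightarrow> 'n rpoly list \<Rightarrow> 'n rpoly list \<Rightarrow> nat \<Rightarrow> bool" where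
  "admissible_order f g h d \<longleftrightarrow> hdeg f \<le> 2 * d \<and>
     (\<forall>i<length g. wdeg (g ! i) \<le> 2 * d) \<and> (\<forall>j<length h. wdeg (h ! j) \<le> 2 * d)"

end

theory Submission
  imports Defs
begin

text \<open>
  Both hierarchies converge because \<open>f - \<lambda>\<close> has a certificate in the quadratic module, modulo relations
  that hold for the moments of every point, as soon as \<open>\<lambda> < f\<^sub>m\<^sub>i\<^sub>n\<close>. If it had none, the
  Archimedean property would provide a state \<open>y\<close> with \<open>L\<^sub>y(f) \<le> \<lambda>\<close>, and a lexicographically minimal
  one is extremal. Multiplication by \<open>w + w\<^sup>*\<close>, which is central, and bounded by the Archimedean
  property, splits a state into two, so that \<open>w + w\<^sup>*\<close> acts by a scalar on the GNS space of an extremal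
  state. The word algebra then acts through \<open>\<real>\<close>, \<open>\<complex>\<close> or \<open>\<H>\<close>, and its action has a common
  eigenvector over the quaternions. Normalized, this eigenvector is the evaluation at a point, and
  it is dominated by the state; so the state is that evaluation, at a point of the feasible set
  where \<open>f \<le> \<lambda>\<close>, a contradiction.
\<close>

section \<open>Quaternions\<close>

text \<open>Certificates are sought not in the free product but among functionals of finitely many
  moments, the set \<open>cone\<close>. One membership serves both hierarchies: read on truncations
  of feasible sequences it bounds \<open>f_mom\<close>; read at points it gives an element of the
  quadratic module up to the vanishing ideal, which \<open>f_qsos\<close> allows. The obstacle is
  that the Archimedean hypothesis lives in the free product, where constants do not commute with
  letters. It is transferred by real trace functionals built from conjugated moments, and this only
  bounds single moments by powers of R. Bounds on multiplication operators, also in the forms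
  localized at members of \<open>g\<close>, need a growth argument with Cauchy-Schwarz. The cone is
  not known to be closed, so minima are suprema of certified bounds and small slacks are carried
  along; as countably many entries determine a state, a recursion replaces compactness. No
  completion is formed: vectors are sequences with a bound, and dimensions are never counted,
  because symmetric elements act by scalars.\<close>

lemma quat_sel_simps [simp]:
  "qRe (x + y) = qRe x + qRe y" "qI (x + y) = qI x + qI y"
  "qJ (x + y) = qJ x + qJ y" "qK (x + y) = qK x + qK y"
  "qRe (x - y) = qRe x - qRe y" "qI (x - y) = qI x - qI y"
  "qJ (x - y) = qJ x - qJ y" "qK (x - y) = qK x - qK y"
  "qRe (- x) = - qRe x" "qI (- x) = - qI x" "qJ (- x) = - qJ x" "qK (- x) = - qK x"
  "qRe (r *\<^sub>R x) = r * qRe x" "qI (r *\<^sub>R x) = r * qI x"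
  "qJ (r *\<^sub>R x) = r * qJ x" "qK (r *\<^sub>R x) = r * qK x"
  "qRe 0 = 0" "qI 0 = 0" "qJ 0 = 0" "qK 0 = 0"
  "qRe 1 = 1" "qI 1 = 0" "qJ 1 = 0" "qK 1 = 0"
  "qRe (of_real r) = r" "qI (of_real r) = 0" "qJ (of_real r) = 0" "qK (of_real r) = 0"
  by (simp_all add: quat_ops of_real_quat)

lemma quat_sel_mult:
  "qRe (x * y) = qRe x * qRe y - qI x * qI y - qJ x * qJ y - qK x * qK y"
  "qI (x * y) = qRe x * qI y + qI x * qRe y + qJ x * qK y - qK x * qJ y"
  "qJ (x * y) = qRe x * qJ y - qI x * qK y + qJ x * qRe y + qK x * qI y"
  "qK (x * y) = qRe x * qK y + qI x * qJ y - qJ x * qI y + qK x * qRe y"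
  by (simp_all add: quat_ops)

lemma quat_sel_conj [simp]:
  "qRe (qconj x) = qRe x" "qI (qconj x) = - qI x" "qJ (qconj x) = - qJ x" "qK (qconj x) = - qK x"
  by (simp_all add: qconj_def)

lemma qRe_mult_commute: "qRe (x * y) = qRe (y * x)"
  by (simp add: quat_sel_mult)

lemma qconj_scaleR [simp]: "qconj (r *\<^sub>R x) = r *\<^sub>R qconj x"
  and qconj_diff [simp]: "qconj (x - y) = qconj x - qconj y"
  by (simp_all add: quat_eq_iff)

lemma qRe_sum: "qRe (sum F S) = (\<Sum>x\<in>S. qRe (F x))"
  by (induction S rule: infinite_finite_induct) auto

lemma qRe_sum_list: "qRe (\<Sum>x\<leftarrow>xs. F x) = (\<Sum>x\<leftarrow>xs. qRe (F x))"
  by (induction xs) auto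

lemma qconj_sum: "qconj (sum F S) = (\<Sum>x\<in>S. qconj (F x))"
  by (induction S rule: infinite_finite_induct) auto

lemma qconj_sum_list: "qconj (\<Sum>x\<leftarrow>xs. F x) = (\<Sum>x\<leftarrow>xs. qconj (F x))"
  by (induction xs) auto

lemma qconj_mult_self: "qconj x * x = of_real (qnorm2 x)"
  and mult_qconj_self: "x * qconj x = of_real (qnorm2 x)"
  by (simp_all add: quat_eq_iff quat_sel_mult qnorm2_def power2_eq_square)

lemma qnorm2_nonneg [simp]: "0 \<le> qnorm2 x"
  by (simp add: qnorm2_def)

lemma qnorm2_eq_0_iff [simp]: "qnorm2 x = 0 \<longleftrightarrow> x = 0"
proof
  assume "qnorm2 x = 0"
  then have "qRe x = 0 \<and> qI x = 0 \<and> qJ x = 0 \<and> qK x = 0"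
    unfolding qnorm2_def by (smt (verit) zero_le_power2 zero_eq_power2)
  then show "x = 0" by (simp add: quat_eq_iff)
qed (simp add: qnorm2_def)

lemma qnorm2_mult: "qnorm2 (x * y) = qnorm2 x * qnorm2 y"
  by (simp add: qnorm2_def quat_sel_mult) algebra

lemma qnorm2_scaleR: "qnorm2 (r *\<^sub>R x) = r\<^sup>2 * qnorm2 x"
  by (simp add: qnorm2_def algebra_simps)

lemma qRe_square_le_qnorm2: "(qRe x)\<^sup>2 \<le> qnorm2 x"
  by (simp add: qnorm2_def)

text \<open>The parallelogram law; the crude factor 2 suffices because only the existence of bounds
  matters later.\<close>

lemma qnorm2_add_le: "qnorm2 (x + y) \<le> 2 * qnorm2 x + 2 * qnorm2 y"
proof -
  have "2 * qnorm2 x + 2 * qnorm2 y - qnorm2 (x + y) = qnorm2 (x - y)"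
    by (simp add: qnorm2_def algebra_simps power2_eq_square)
  then show ?thesis using qnorm2_nonneg[of "x - y"] by linarith
qed

lemma qRe_le_of_qnorm2: "qnorm2 x \<le> c\<^sup>2 \<Longrightarrow> 0 \<le> c \<Longrightarrow> \<bar>qRe x\<bar> \<le> c"
  using qRe_square_le_qnorm2[of x] abs_le_square_iff[of "qRe x" c] by auto

lemma qconj_eq_iff_real: "qconj x = x \<longleftrightarrow> x = of_real (qRe x)"
  by (simp add: quat_eq_iff)

text \<open>Test with the conjugate of the difference. This is how quaternionic identities are
  recovered from the real functionals that make up \<open>cone\<close>.\<close>

lemma quat_eqI_Re: "(\<And>c. qRe (c * x) = qRe (c * y)) \<Longrightarrow> x = y"
proof -
  assume "\<And>c. qRe (c * x) = qRe (c * y)"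
  then have "qRe (qconj (x - y) * (x - y)) = 0"
    by (simp add: right_diff_distrib)
  then show ?thesis by (simp add: qconj_mult_self del: qconj_diff)
qed


section \<open>The real word algebra\<close>

instantiation poly_mapping :: (type, real_vector) real_vector
begin

lift_definition scaleR_poly_mapping :: "real \<Rightarrow> ('a \<Rightarrow>\<^sub>0 'b) \<Rightarrow> 'a \<Rightarrow>\<^sub>0 'b"
  is "\<lambda>r f k. r *\<^sub>R f k"
  by (rule finite_subset) auto

instance
  by standard (transfer; simp add: fun_eq_iff algebra_simps)+

end

lemma lookup_scaleR [simp]: "Poly_Mapping.lookup (r *\<^sub>R p) k = r *\<^sub>R Poly_Mapping.lookup p k"
  by transfer simp

lemma poly_mapping_single_induct [case_names zero single add]:
  assumes "P 0" and "\<And>k a. P (Poly_Mapping.single k a)"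
    and "\<And>p q. P p \<Longrightarrow> P q \<Longrightarrow> P (p + q)"
  shows "P (p :: 'a \<Rightarrow>\<^sub>0 'b::monoid_add)"
proof (induction p rule: Poly_Mapping.update_induct)
  case const
  then show ?case by (rule assms(1))
next
  case (update f a b)
  have "Poly_Mapping.update a b f = Poly_Mapping.single a b + f"
    using update(1)
    by (intro poly_mapping_eqI) (auto simp: lookup_update lookup_add lookup_single when_def in_keys_iff)
  then show ?case using assms update by metis
qed

lemma scaleR_single: "r *\<^sub>R Poly_Mapping.single k a = Poly_Mapping.single k (r *\<^sub>R a)"
  by (intro poly_mapping_eqI) (simp add: lookup_single when_def)

instance poly_mapping :: (monoid_add, real_algebra_1) real_algebra_1
proof
  fix r :: real and p q :: "'a \<Rightarrow>\<^sub>0 'b"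
  show "r *\<^sub>R p * q = r *\<^sub>R (p * q)"
  proof (induction p rule: poly_mapping_single_induct)
    case (single k a)
    then show ?case
      by (induction q rule: poly_mapping_single_induct)
        (simp_all add: scaleR_single mult_single algebra_simps)
  qed (simp_all add: algebra_simps)
  show "p * r *\<^sub>R q = r *\<^sub>R (p * q)"
  proof (induction p rule: poly_mapping_single_induct)
    case (single k a)
    then show ?case
      by (induction q rule: poly_mapping_single_induct)
        (simp_all add: scaleR_single mult_single algebra_simps)
  qed (simp_all add: algebra_simps)
qed

lemma sum_keys_add:
  assumes "\<And>k. F k 0 = 0" "\<And>k a b. F k (a + b) = F k a + F k b"
  shows "(\<Sum>k\<in>Poly_Mapping.keys (p + q). F k (Poly_Mapping.lookup (p + q) k)) =
    (\<Sum>k\<in>Poly_Mapping.keys p. F k (Poly_Mapping.lookup p k)) +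
    (\<Sum>k\<in>Poly_Mapping.keys q. F k (Poly_Mapping.lookup q k))"
  by (rule setsum_keys_plus_distrib) (use assms in auto)

lemma sum_keys_single:
  assumes "F k 0 = 0"
  shows "(\<Sum>j\<in>Poly_Mapping.keys (Poly_Mapping.single k a). F j (Poly_Mapping.lookup (Poly_Mapping.single k a) j)) = F k a"
  using assms by (cases "a = 0") auto

lemma sum_keys_superset:
  assumes "finite S" "Poly_Mapping.keys p \<subseteq> S" "\<And>k. F k 0 = 0"
  shows "(\<Sum>k\<in>Poly_Mapping.keys p. F k (Poly_Mapping.lookup p k)) = (\<Sum>k\<in>S. F k (Poly_Mapping.lookup p k))"
  using assms by (intro sum.mono_neutral_left) (auto simp: in_keys_iff)

lemma rpoly_induct [case_names zero mono add scale]: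
  assumes "P 0" "\<And>w. P (wmono w)" "\<And>p q. P p \<Longrightarrow> P q \<Longrightarrow> P (p + q)" "\<And>r p. P p \<Longrightarrow> P (r *\<^sub>R p)"
  shows "P p"
proof (induction p rule: poly_mapping_single_induct)
  case (single k a)
  have "Poly_Mapping.single k a = a *\<^sub>R wmono k"
    by (simp add: wmono_def scaleR_single)
  then show ?case using assms by metis
qed (use assms in auto)

lemma wmono_add: "wmono (u + v) = wmono u * wmono v"
  and wmono_0 [simp]: "wmono 0 = 1"
  by (simp_all add: wmono_def mult_single)

lemma L_y_add [simp]: "L_y y (p + q) = L_y y p + L_y y q"
  unfolding L_y_def by (rule sum_keys_add) (auto simp: algebra_simps)

lemma L_y_single: "L_y y (Poly_Mapping.single w r) = r *\<^sub>R y w"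
  unfolding L_y_def by (rule sum_keys_single) auto

lemma L_y_wmono [simp]: "L_y y (wmono w) = y w"
  by (simp add: wmono_def L_y_single)

lemma L_y_1 [simp]: "L_y y 1 = y 0"
  using L_y_wmono[of y 0] by simp

lemma L_y_0 [simp]: "L_y y 0 = 0"
  by (simp add: L_y_def)

lemma L_y_scaleR [simp]: "L_y y (r *\<^sub>R p) = r *\<^sub>R L_y y p"
  by (induction p rule: poly_mapping_single_induct)
    (simp_all add: scaleR_single L_y_single algebra_simps)

lemma L_y_uminus [simp]: "L_y y (- p) = - L_y y p"
  using L_y_scaleR[of y "-1" p] by simp

lemma L_y_diff [simp]: "L_y y (p - q) = L_y y p - L_y y q"
  using L_y_add[of y p "- q"] by simp

lemma L_y_fun_simps:
  "L_y (\<lambda>w. y w + z w) p = L_y y p + L_y z p"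
  "L_y (\<lambda>w. c * y w) p = c * L_y y p"
  "L_y (\<lambda>w. y w * c) p = L_y y p * c"
  "L_y (\<lambda>w. r *\<^sub>R y w) p = r *\<^sub>R L_y y p"
  by (induction p rule: rpoly_induct) (simp_all add: algebra_simps)

text \<open>Shifts turn sequences into a module over the word algebra: a shifted sequence represents
  the functional composed with a multiplication. Identities checked on words extend to polynomials
  in this way.\<close>

lemma L_y_act:
  "L_y (\<lambda>v. L_y y (p * wmono v)) q = L_y y (p * q)"
  "L_y (\<lambda>v. L_y y (wmono v * p)) q = L_y y (q * p)"
  by (induction q rule: rpoly_induct) (simp_all add: algebra_simps)

lemma rstar_add [simp]: "rstar (p + q) = rstar p + rstar q"
  unfolding rstar_def by (rule sum_keys_add) (auto simp: single_add)

lemma rstar_single: "rstar (Poly_Mapping.single w r) = Poly_Mapping.single (wstar w) r"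
  unfolding rstar_def by (rule sum_keys_single) auto

lemma rstar_wmono [simp]: "rstar (wmono w) = wmono (wstar w)"
  by (simp add: wmono_def rstar_single)

lemma rstar_0 [simp]: "rstar 0 = 0"
  by (simp add: rstar_def)

lemma rstar_1 [simp]: "rstar 1 = 1"
  using rstar_wmono[of 0] by simp

lemma rstar_scaleR [simp]: "rstar (r *\<^sub>R p) = r *\<^sub>R rstar p"
  by (induction p rule: poly_mapping_single_induct)
    (simp_all add: scaleR_single rstar_single algebra_simps)

lemma rstar_uminus [simp]: "rstar (- p) = - rstar p"
  using rstar_scaleR[of "-1" p] by simp

lemma rstar_diff [simp]: "rstar (p - q) = rstar p - rstar q"
  using rstar_add[of p "- q"] by simp

lemma rstar_rstar [simp]: "rstar (rstar p) = p"
  by (induction p rule: rpoly_induct) simp_all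

lemma rstar_mult [simp]: "rstar (p * q) = rstar q * rstar p"
proof (induction p rule: rpoly_induct)
  case (mono w)
  then show ?case
    by (induction q rule: rpoly_induct) (simp_all add: algebra_simps flip: wmono_add)
qed (simp_all add: algebra_simps)

section \<open>Length, involution and central elements of the word monoid\<close>

lemma wlen_add [simp]: "wlen (u + v) = wlen u + wlen v"
  and wlen_wstar [simp]: "wlen (wstar w) = wlen w"
  and wlen_0 [simp]: "wlen 0 = 0"
  and wlen_letter [simp]: "wlen (letter x) = 1"
  by (transfer; simp add: rev_bar_def)+

lemma wstar_letter [simp]: "wstar (letter x) = letter (bar x)"
  by transfer (simp add: rev_bar_def)

lemma abs_word_cases: "\<exists>xs. w = abs_word xs"
  by (induction w rule: word.abs_induct) auto

lemma word_snoc_induct [case_names empty snoc]: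
  assumes "P 0" "\<And>u x. P u \<Longrightarrow> P (u + letter x)"
  shows "P (w :: 'n word)"
proof -
  obtain xs where "w = abs_word xs" using abs_word_cases by blast
  moreover have "P (abs_word xs)"
  proof (induction xs rule: rev_induct)
    case Nil
    then show ?case using assms(1) by (simp add: zero_word_def)
  next
    case (snoc x xs)
    have "abs_word (xs @ [x]) = abs_word xs + letter x"
      by (simp add: plus_word.abs_eq letter.abs_eq)
    then show ?case using assms(2) snoc by simp
  qed
  ultimately show ?thesis by simp
qed

lemma word_cons_induct [case_names empty cons]:
  assumes "P 0" "\<And>u x. P u \<Longrightarrow> P (letter x + u)"
  shows "P (w :: 'n word)"
proof -
  have "P (wstar v)" for v
    by (induction v rule: word_snoc_induct) (use assms in auto)
  from this[of "wstar w"] show ?thesis by simp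
qed

text \<open>The innermost factor \<open>letter x + letter (bar x)\<close> is central by the normal
  form, so it can be pulled out, and what remains is the same expression for the shorter
  prefix.\<close>

lemma word_star_central: "w + wstar w + v = v + (w + wstar w)"
proof (induction w arbitrary: v rule: word_snoc_induct)
  case empty
  then show ?case by simp
next
  case (snoc u x)
  have e: "u + letter x + wstar (u + letter x) = (u + wstar u) + (letter x + letter (bar x))" for u
    using letter_bar_central[of x "wstar u"] by (simp add: add.assoc)
  show ?case
    unfolding e using letter_bar_central[of x v] snoc.IH[of v]
    by (metis add.assoc)
qed

lemma wstar_word_commute: "wstar w + w = w + wstar w"
proof (induction w rule: word_snoc_induct)
  case empty
  then show ?case by simp
next
  case (snoc u x)
  have "wstar (u + letter x) + (u + letter x) = letter (bar x) + (wstar u + u) + letter x"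
    by (simp add: add.assoc)
  also have "\<dots> = (u + wstar u) + (letter (bar x) + letter x)"
    using word_star_central[of u "letter (bar x)"] snoc by (metis add.assoc)
  also have "\<dots> = (u + wstar u) + (letter x + letter (bar x))"
    by (simp add: letter_bar_commute)
  also have "\<dots> = u + letter x + wstar (u + letter x)"
    using letter_bar_central[of x "wstar u"] by (simp add: add.assoc)
  finally show ?case .
qed

lemma weval_letter [simp]: "weval a (letter x) = letter_eval a x"
  by transfer (simp add: list_eval_def)

lemma letter_eval_bar_conj: "letter_eval a (bar x) = qconj (letter_eval a x)"
  by (cases x) auto

lemma weval_wstar: "weval a (wstar w) = qconj (weval a w)"
  by (induction w rule: word_snoc_induct) (simp_all add: letter_eval_bar_conj)

text \<open>Sums over infinite index sets are zero by convention, so the quadratic forms in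
  \<open>psd\<close> have content only because these index sets are finite.\<close>

lemma finite_words_le: "finite (words_le d :: ('n::finite) word set)"
proof -
  have "finite (UNIV :: 'n letter set)"
  proof -
    have "x \<in> range Q \<union> range Qbar" for x :: "'n letter"
      by (cases x) auto
    then have "(UNIV :: 'n letter set) \<subseteq> range Q \<union> range Qbar"
      by blast
    then show ?thesis
      by (rule finite_subset) simp
  qed
  then have "finite {xs :: 'n letter list. set xs \<subseteq> UNIV \<and> length xs \<le> d}"
    by (rule finite_lists_length_le)
  moreover have "words_le d \<subseteq> abs_word ` {xs :: 'n letter list. set xs \<subseteq> UNIV \<and> length xs \<le> d}"
  proof
    fix w :: "'n word" assume "w \<in> words_le d"
    moreover obtain xs where "w = abs_word xs" using abs_word_cases by blast
    ultimately show "w \<in> abs_word ` {xs. set xs \<subseteq> UNIV \<and> length xs \<le> d}"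
      by (auto simp: words_le_def wlen.abs_eq)
  qed
  ultimately show ?thesis by (rule finite_surj)
qed


section \<open>Trace functionals on the free product\<close>

text \<open>
  The free product acts from the right on the quaternion-valued functions of two words:
  constants by right multiplication, and a word by shifting the second argument of the real part
  and the first argument of the imaginary part. Two independent shifts suffice to separate the
  summands \<open>a c b\<close> with real \<open>c\<close> from those with imaginary \<open>c\<close>.
\<close>

primrec hact :: "'n hexp \<Rightarrow> ('n word \<Rightarrow> 'n word \<Rightarrow> quat) \<Rightarrow> 'n word \<Rightarrow> 'n word \<Rightarrow> quat" where
  "hact (EConst c) \<psi> = (\<lambda>a b. \<psi> a b * c)"
| "hact (EWord w) \<psi> = (\<lambda>a b. of_real (qRe (\<psi> a (w + b))) + (\<psi> (w + a) b - of_real (qRe (\<psi> (w + a) b))))"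
| "hact (EAdd x y) \<psi> = (\<lambda>a b. hact x \<psi> a b + hact y \<psi> a b)"
| "hact (EMul x y) \<psi> = hact y (hact x \<psi>)"

lemma hact_add: "hact x (\<lambda>a b. \<psi> a b + \<phi> a b) = (\<lambda>a b. hact x \<psi> a b + hact x \<phi> a b)"
  by (induction x arbitrary: \<psi> \<phi>) (simp_all add: algebra_simps)

lemma hact_scaleR: "hact x (\<lambda>a b. r *\<^sub>R \<psi> a b) = (\<lambda>a b. r *\<^sub>R hact x \<psi> a b)"
proof (induction x arbitrary: \<psi>)
  case (EWord w)
  then show ?case by (simp add: fun_eq_iff quat_eq_iff quat_sel_mult algebra_simps)
qed (simp_all add: algebra_simps)

lemma mult_of_real_quat: "x * of_real r = r *\<^sub>R (x :: quat)"
  by (simp add: scaleR_conv_of_real of_real_quat_comm)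

lemma heq_hact: "heq x y \<Longrightarrow> hact x = hact y"
proof (induction rule: heq.induct)
  case (distrib_right x y z)
  then show ?case by (simp add: fun_eq_iff hact_add)
next
  case (real_central r x)
  then show ?case by (simp add: fun_eq_iff mult_of_real_quat hact_scaleR)
next
  case (add_neg x)
  then show ?case using hact_scaleR[of x "-1"] by (simp add: fun_eq_iff)
next
  case (mul_cong x x' y y')
  then show ?case by (metis ext hact.simps(4))
qed (simp_all add: fun_eq_iff algebra_simps)

lift_definition hfun :: "'n hpoly \<Rightarrow> ('n word \<Rightarrow> 'n word \<Rightarrow> quat) \<Rightarrow> 'n word \<Rightarrow> 'n word \<Rightarrow> quat"
  is hact by (rule heq_hact)

lemma hfun_simps:
  "hfun (const c) \<psi> = (\<lambda>a b. \<psi> a b * c)"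
  "hfun (hword w) \<psi> = (\<lambda>a b. of_real (qRe (\<psi> a (w + b))) + (\<psi> (w + a) b - of_real (qRe (\<psi> (w + a) b))))"
  "hfun (x + y) \<psi> = (\<lambda>a b. hfun x \<psi> a b + hfun y \<psi> a b)"
  "hfun (x * y) \<psi> = hfun y (hfun x \<psi>)"
  "hfun 0 \<psi> = (\<lambda>a b. 0)"
  by (transfer; simp)+

lemma hfun_scaleR: "hfun x (\<lambda>a b. r *\<^sub>R \<psi> a b) = (\<lambda>a b. r *\<^sub>R hfun x \<psi> a b)"
  by transfer (rule hact_scaleR)

lemma hfun_scaleR_left: "hfun (r *\<^sub>R x) \<psi> = (\<lambda>a b. r *\<^sub>R hfun x \<psi> a b)"
  by (simp add: scaleR_hpoly_def hfun_simps mult_of_real_quat hfun_scaleR)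

text \<open>Defined through the action and not through coefficients, hence a function of the element
  of the free product itself. On a term \<open>hword a * const c * hword b\<close> the two shifts
  produce the real part of the entry at \<open>a + b\<close> and the imaginary part of the entry at
  \<open>b + a\<close>; for cyclic \<open>y\<close> they combine into one entry.\<close>

definition trace_fun :: "('n word \<Rightarrow> quat) \<Rightarrow> 'n hpoly \<Rightarrow> real" where
  "trace_fun y x = qRe (hfun x (\<lambda>a b. y (b + a)) 0 0)"

lemma trace_fun_add [simp]: "trace_fun y (x + z) = trace_fun y x + trace_fun y z"
  and trace_fun_0 [simp]: "trace_fun y 0 = 0"
  and trace_fun_scaleR [simp]: "trace_fun y (r *\<^sub>R x) = r * trace_fun y x"
  by (simp_all add: trace_fun_def hfun_simps hfun_scaleR_left)

lemma trace_fun_diff [simp]: "trace_fun y (x - z) = trace_fun y x - trace_fun y z"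
  using trace_fun_add[of y x "(-1) *\<^sub>R z"] trace_fun_scaleR[of y "-1" z] by simp

lemma trace_fun_sum: "trace_fun y (sum F S) = (\<Sum>i\<in>S. trace_fun y (F i))"
  by (induction S rule: infinite_finite_induct) auto

lemma trace_fun_sum_list: "trace_fun y (\<Sum>i\<leftarrow>xs. F i) = (\<Sum>i\<leftarrow>xs. trace_fun y (F i))"
  by (induction xs) auto

definition cyclic :: "('n word \<Rightarrow> quat) \<Rightarrow> bool" where
  "cyclic y \<longleftrightarrow> (\<forall>u v. qRe (y (u + v)) = qRe (y (v + u)))"

lemma trace_fun_monomial:
  assumes "cyclic y"
  shows "trace_fun y (hword a * const c * hword b) = qRe (c * y (b + a))"
proof -
  have "qRe (y (a + b)) = qRe (y (b + a))"
    using assms by (auto simp: cyclic_def)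
  then show ?thesis
    by (simp add: trace_fun_def hfun_simps quat_sel_mult)
qed

lemma trace_fun_real_monomial:
  assumes "\<And>w. y w = of_real (t w)"
  shows "trace_fun y (const c * hword w * const c') = t w * qRe (c * c')"
  by (simp add: trace_fun_def hfun_simps assms quat_sel_mult algebra_simps)

definition pair_eval :: "('n word \<times> 'n word \<Rightarrow>\<^sub>0 quat) \<Rightarrow> ('n word \<Rightarrow> quat) \<Rightarrow> real" where
  "pair_eval p y = qRe (\<Sum>(a, b)\<in>Poly_Mapping.keys p. Poly_Mapping.lookup p (a, b) * y (b + a))"

lemma trace_fun_mpoly: "cyclic y \<Longrightarrow> trace_fun y (mpoly p) = pair_eval p y"
  by (simp add: mpoly_def pair_eval_def trace_fun_sum qRe_sum split_def trace_fun_monomial)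

definition trunc :: "nat \<Rightarrow> ('n word \<Rightarrow> quat) \<Rightarrow> 'n word \<Rightarrow> quat" where
  "trunc D y w = (if wlen w \<le> D then y w else 0)"

lemma mdeg_bound: "(a, b) \<in> Poly_Mapping.keys p \<Longrightarrow> wlen a + wlen b \<le> mdeg p"
  unfolding mdeg_def by (intro Max_ge) force+

lemma pair_eval_trunc: "mdeg p \<le> D \<Longrightarrow> pair_eval p (trunc D y) = pair_eval p y"
  unfolding pair_eval_def
  by (rule arg_cong[of _ _ qRe], rule sum.cong)
    (auto simp: trunc_def dest!: mdeg_bound)

text \<open>Length is additive, so that truncated sequences inherit cyclicity at all degrees.\<close>

lemma cyclic_trunc:
  assumes "\<forall>u\<in>words_le D. \<forall>v\<in>words_le D. cyc_equiv u v \<longrightarrow> qRe (y u) = qRe (y v)"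
  shows "cyclic (trunc D y)"
  unfolding cyclic_def
proof (intro allI)
  fix u v :: "'a word"
  have "cyc_equiv (u + v) (v + u)" by (auto simp: cyc_equiv_def)
  then show "qRe (trunc D y (u + v)) = qRe (trunc D y (v + u))"
    using assms by (auto simp: trunc_def words_le_def add.commute)
qed

text \<open>Independence of the representation picked by \<open>SOME\<close>: the truncated sequence
  is cyclic at all lengths, so both representations compute its \<open>trace_fun\<close>, which
  depends on the element alone.\<close>

lemma LR_y_mpoly:
  assumes "\<forall>u\<in>words_le (2 * d). \<forall>v\<in>words_le (2 * d). cyc_equiv u v \<longrightarrow> qRe (y u) = qRe (y v)"
    and "mdeg p \<le> 2 * d"
  shows "LR_y d y (mpoly p) = pair_eval p y"
proof -
  define p' where "p' = (SOME p'. mdeg p' \<le> 2 * d \<and> mpoly p' = mpoly p)"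
  have p': "mdeg p' \<le> 2 * d \<and> mpoly p' = mpoly p"
    unfolding p'_def by (rule someI[of _ p]) (use assms in auto)
  have c: "cyclic (trunc (2 * d) y)"
    using assms(1) by (rule cyclic_trunc)
  have "LR_y d y (mpoly p) = pair_eval p' y"
    by (simp add: LR_y_def Let_def pair_eval_def flip: p'_def)
  also have "\<dots> = pair_eval p' (trunc (2 * d) y)"
    using p' by (simp add: pair_eval_trunc)
  also have "\<dots> = pair_eval p (trunc (2 * d) y)"
    using trace_fun_mpoly[OF c, of p'] trace_fun_mpoly[OF c, of p] p' by simp
  finally show ?thesis
    using assms(2) by (simp add: pair_eval_trunc)
qed


section \<open>Evaluation, involution and degrees in the free product\<close>

lemma heval_simps [simp]:
  "heval a (const c) = c" "heval a (hword w) = weval a w"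
  "heval a (x + y) = heval a x + heval a y" "heval a (x * y) = heval a x * heval a y"
  "heval a 0 = 0" "heval a 1 = 1"
  by (transfer; simp)+

lemma heval_scaleR [simp]: "heval a (r *\<^sub>R x) = r *\<^sub>R heval a x"
  by (simp add: scaleR_hpoly_def scaleR_conv_of_real)

lemma heval_diff [simp]: "heval a (x - y) = heval a x - heval a y"
  using heval_simps(3)[of a x "(-1) *\<^sub>R y"] heval_scaleR[of a "-1" y] by simp

lemma heval_of_real [simp]: "heval a (of_real r) = of_real r"
  by (simp add: of_real_def)

lemma heval_sum: "heval a (sum F S) = (\<Sum>i\<in>S. heval a (F i))"
  by (induction S rule: infinite_finite_induct) auto

lemma heval_sum_list: "heval a (\<Sum>i\<leftarrow>xs. F i) = (\<Sum>i\<leftarrow>xs. heval a (F i))"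
  by (induction xs) auto

lemma hstar_simps [simp]:
  "hstar (const c) = const (qconj c)" "hstar (hword w) = hword (wstar w)"
  "hstar (x + y) = hstar x + hstar y" "hstar (x * y) = hstar y * hstar x"
  "hstar 0 = 0" "hstar 1 = 1"
  by (transfer; simp add: heq.refl)+

lemma hstar_scaleR [simp]: "hstar (r *\<^sub>R x) = r *\<^sub>R hstar x"
  by (simp add: scaleR_hpoly_def const_real_central)

lemma hstar_diff [simp]: "hstar (x - y) = hstar x - hstar y"
  using hstar_simps(3)[of x "(-1) *\<^sub>R y"] hstar_scaleR[of "-1" y] by simp

lemma hstar_of_real [simp]: "hstar (of_real r) = of_real r"
  by (simp add: of_real_def)

lemma hstar_hstar [simp]: "hstar (hstar x) = x"
proof (transfer)
  fix x :: "'a hexp"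
  have "estar (estar x) = x"
    by (induction x) simp_all
  then show "heq (estar (estar x)) x" by (simp add: heq.refl)
qed

lemma heval_hstar: "heval a (hstar x) = qconj (heval a x)"
proof (transfer)
  fix a and x :: "'a hexp"
  show "eeval a (estar x) = qconj (eeval a x)"
    by (induction x) (simp_all add: weval_wstar)
qed

lemma hword_add: "hword (u + v) = hword u * hword v"
  and hword_0 [simp]: "hword 0 = 1"
  by (transfer; blast intro: heq.intros)+

lemma const_of_real: "const (of_real r) = of_real r"
  unfolding of_real_def scaleR_hpoly_def by (simp add: of_real_def)

lemma const_scaleR: "const (r *\<^sub>R c) = r *\<^sub>R const c"
  by (simp add: scaleR_hpoly_def const_simps scaleR_conv_of_real)

lemma of_rpoly_add [simp]: "of_rpoly (p + q) = of_rpoly p + of_rpoly q"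
  unfolding of_rpoly_def by (rule sum_keys_add) (auto simp: algebra_simps)

lemma of_rpoly_single: "of_rpoly (Poly_Mapping.single w r) = r *\<^sub>R hword w"
  unfolding of_rpoly_def by (rule sum_keys_single) auto

lemma of_rpoly_wmono [simp]: "of_rpoly (wmono w) = hword w"
  by (simp add: wmono_def of_rpoly_single)

lemma of_rpoly_0 [simp]: "of_rpoly 0 = 0"
  by (simp add: of_rpoly_def)

lemma of_rpoly_scaleR [simp]: "of_rpoly (r *\<^sub>R p) = r *\<^sub>R of_rpoly p"
  by (induction p rule: poly_mapping_single_induct)
    (simp_all add: scaleR_single of_rpoly_single algebra_simps)

lemma hstar_of_rpoly: "hstar (of_rpoly p) = of_rpoly (rstar p)"
  by (induction p rule: rpoly_induct) simp_all

lemma heval_of_rpoly: "heval a (of_rpoly p) = L_y (weval a) p"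
  by (induction p rule: rpoly_induct) simp_all

lemma lpoly_add [simp]: "lpoly (p + q) = lpoly p + lpoly q"
  unfolding lpoly_def by (rule sum_keys_add) (auto simp: const_simps algebra_simps)

lemma lpoly_single: "lpoly (Poly_Mapping.single w c) = const c * hword w"
  unfolding lpoly_def by (rule sum_keys_single) (auto simp: const_simps)

lemma lpoly_0 [simp]: "lpoly 0 = 0"
  by (simp add: lpoly_def)

lemma lpoly_scaleR [simp]: "lpoly (r *\<^sub>R p) = r *\<^sub>R lpoly p"
  by (induction p rule: poly_mapping_single_induct)
    (simp_all add: scaleR_single lpoly_single const_scaleR algebra_simps)

lemma mpoly_add [simp]: "mpoly (p + q) = mpoly p + mpoly q"
proof -
  have "mpoly r = (\<Sum>k\<in>Poly_Mapping.keys r. (\<lambda>k c. hword (fst k) * const c * hword (snd k)) k (Poly_Mapping.lookup r k))"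
    for r :: "'a word \<times> 'a word \<Rightarrow>\<^sub>0 quat"
    by (simp add: mpoly_def split_def)
  then show ?thesis
    by (simp only:) (rule sum_keys_add, auto simp: const_simps algebra_simps)
qed

lemma mpoly_single: "mpoly (Poly_Mapping.single (a, b) c) = hword a * const c * hword b"
  by (cases "c = 0") (simp_all add: mpoly_def const_simps)

lemma mpoly_0 [simp]: "mpoly 0 = 0"
  by (simp add: mpoly_def)

lemma mdeg_le_iff: "mdeg p \<le> D \<longleftrightarrow> (\<forall>(a, b)\<in>Poly_Mapping.keys p. wlen a + wlen b \<le> D)"
  unfolding mdeg_def by (subst Max_le_iff) auto

lemma wdeg_le_iff: "wdeg p \<le> D \<longleftrightarrow> (\<forall>w\<in>Poly_Mapping.keys p. wlen w \<le> D)"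
  unfolding wdeg_def by (subst Max_le_iff) auto

lemma P_le_add: "x \<in> P_le t \<Longrightarrow> y \<in> P_le t \<Longrightarrow> x + y \<in> P_le t"
proof -
  assume "x \<in> P_le t" "y \<in> P_le t"
  then obtain p q where "x = mpoly p" "mdeg p \<le> t" "y = mpoly q" "mdeg q \<le> t"
    by (auto simp: P_le_def)
  then have "x + y = mpoly (p + q)" "mdeg (p + q) \<le> t"
    using Poly_Mapping.keys_add[of p q] by (auto simp: mdeg_le_iff)
  then show ?thesis by (auto simp: P_le_def simp del: mpoly_add)
qed

lemma P_le_0: "0 \<in> P_le t"
  by (auto simp: P_le_def mdeg_def intro!: exI[of _ 0])

lemma P_le_mono: "s \<le> t \<Longrightarrow> P_le s \<subseteq> P_le t"
  unfolding P_le_def using le_trans by blast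

lemma P_space_eq: "P_space = (\<Union>t. P_le t)"
  by (auto simp: P_space_def P_le_def)

lemma P_space_add: "x \<in> P_space \<Longrightarrow> y \<in> P_space \<Longrightarrow> x + y \<in> P_space"
  by (auto simp: P_space_def) (metis mpoly_add rangeI)

lemma P_space_0: "0 \<in> P_space"
  using P_le_0 by (auto simp: P_space_eq)

lemma P_space_monomial: "hword a * const c * hword b \<in> P_space"
  by (auto simp: P_space_def simp flip: mpoly_single)

lemma P_space_induct [consumes 1, case_names zero monomial add]:
  assumes "x \<in> P_space" "X 0" "\<And>a c b. X (hword a * const c * hword b)" "\<And>x y. X x \<Longrightarrow> X y \<Longrightarrow> X (x + y)"
  shows "X x"
proof -
  obtain p where "x = mpoly p" using assms(1) by (auto simp: P_space_def)
  moreover have "X (mpoly p)"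
    by (induction p rule: poly_mapping_single_induct) (auto simp: mpoly_single assms(2-))
  ultimately show ?thesis by simp
qed

lemma P_space_scaleR: "x \<in> P_space \<Longrightarrow> r *\<^sub>R x \<in> P_space"
proof (induction rule: P_space_induct)
  case (monomial a c b)
  have "r *\<^sub>R (hword a * const c * hword b) = hword a * const (r *\<^sub>R c) * hword b"
    by (simp add: const_scaleR)
  then show ?case by (simp add: P_space_monomial)
qed (auto simp: scaleR_add_right intro: P_space_0 P_space_add)

lemma P_space_mult_of_rpoly:
  assumes "x \<in> P_space"
  shows "x * of_rpoly q \<in> P_space" "of_rpoly q * x \<in> P_space"
  using assms
proof (induction rule: P_space_induct)
  case (monomial a c b)
  { case 1
    show ?case
      by (induction q rule: rpoly_induct)
        (auto simp: algebra_simps P_space_0 mult.assoc[symmetric] hword_add[symmetric]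
           intro: P_space_add P_space_scaleR P_space_monomial simp del: mult.assoc,
         metis P_space_monomial hword_add mult.assoc)
  next
    case 2
    show ?case
      by (induction q rule: rpoly_induct)
        (auto simp: algebra_simps P_space_0 intro: P_space_add P_space_scaleR,
         metis P_space_monomial hword_add mult.assoc) }
qed (auto simp: algebra_simps intro: P_space_0 P_space_add)

text \<open>In a product of two terms the constants meet in the middle, between the starred word and
  the other word, which is the shape of a term of \<open>P_space\<close>.\<close>

lemma SOS_monomials: "hstar (lpoly p) * lpoly p \<in> P_space"
proof -
  have "hstar (lpoly q) * lpoly p \<in> P_space" for q
  proof (induction q rule: poly_mapping_single_induct)
    case (single w c)
    show ?case
    proof (induction p rule: poly_mapping_single_induct)
      case (single v c')
      have "hstar (lpoly (Poly_Mapping.single w c)) * lpoly (Poly_Mapping.single v c') =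
          hword (wstar w) * const (qconj c * c') * hword v"
        by (simp add: lpoly_single const_simps mult.assoc)
      then show ?case by (simp add: P_space_monomial)
    qed (auto simp: algebra_simps intro: P_space_0 P_space_add)
  qed (auto simp: algebra_simps intro: P_space_0 P_space_add)
  then show ?thesis .
qed

lemma P_space_const_mult: "const c * of_rpoly q \<in> P_space" "of_rpoly q * const c \<in> P_space"
  using P_space_mult_of_rpoly[of "const c" q] P_space_monomial[of 0 c 0] by auto


section \<open>The cone of functionals certified by the quadratic module\<close>

lemma sum_list_swap_sum:
  "(\<Sum>x\<leftarrow>xs. \<Sum>s\<in>S. F x s) = (\<Sum>s\<in>S. \<Sum>x\<leftarrow>xs. (F x s :: 'b::comm_monoid_add))"
  by (induction xs) (auto simp: sum.distrib)

lemma sum_list_bilinear: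
  "(\<Sum>x\<leftarrow>xs. f x) * m * (\<Sum>y\<leftarrow>ys. k y) = (\<Sum>x\<leftarrow>xs. \<Sum>y\<leftarrow>ys. f x * m * (k y :: 'b::semiring_0))"
  by (induction xs) (simp_all add: semiring_class.distrib_right sum_list_const_mult)

text \<open>The quadratic form of the localizing matrix of \<open>q\<close> at the vector with right
  coefficients that is the sum of all \<open>U\<close> times \<open>a\<close>. A list of pairs, with
  repetitions allowed, makes concatenation, scaling and multiplication of all \<open>U\<close> by
  one polynomial simple operations.\<close>

definition qf :: "'n rpoly \<Rightarrow> (quat \<times> 'n rpoly) list \<Rightarrow> ('n word \<Rightarrow> quat) \<Rightarrow> real" where
  "qf q xs y = qRe (\<Sum>(a, U)\<leftarrow>xs. \<Sum>(b, V)\<leftarrow>xs. qconj a * L_y y (rstar U * q * V) * b)"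

text \<open>Finite support is essential: a certificate then involves words of bounded length only,
  and therefore applies from some finite order on.\<close>

definition lin :: "(('n word \<Rightarrow> quat) \<Rightarrow> real) \<Rightarrow> bool" where
  "lin F \<longleftrightarrow> (\<exists>xs. F = (\<lambda>y. \<Sum>(c, w)\<leftarrow>xs. qRe (c * y w)))"

definition moment_rel :: "('n word \<Rightarrow> quat) \<Rightarrow> bool" where
  "moment_rel y \<longleftrightarrow> (\<forall>w. y (wstar w) = qconj (y w)) \<and> cyclic y \<and>
     (\<forall>u w v i. y (u + w + letter (Q i) + v) + y (u + wstar w + letter (Q i) + v) =
        y (u + letter (Q i) + w + v) + y (u + letter (Q i) + wstar w + v))"

text \<open>
  Functionals of finitely many entries of a sequence that are nonnegative on moment sequences
  for an algebraic reason. The relations are homogeneous with respect to word length, so that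
  they also hold for truncations of feasible sequences.
\<close>

inductive_set cone :: "'n rpoly list \<Rightarrow> 'n rpoly list \<Rightarrow> (('n word \<Rightarrow> quat) \<Rightarrow> real) set"
  for g h where
  square: "q = 1 \<or> q \<in> set g \<Longrightarrow> qf q xs \<in> cone g h"
| equation: "k \<in> set h \<Longrightarrow> (\<lambda>y. qRe (c * L_y y (wmono u * k * wmono v))) \<in> cone g h"
| add: "F \<in> cone g h \<Longrightarrow> G \<in> cone g h \<Longrightarrow> (\<lambda>y. F y + G y) \<in> cone g h"
| cong: "F \<in> cone g h \<Longrightarrow> lin G \<Longrightarrow> (\<And>y. moment_rel y \<Longrightarrow> F y = G y) \<Longrightarrow> G \<in> cone g h"

lemma lin_0: "lin (\<lambda>y. 0)"
  unfolding lin_def by (rule exI[of _ "[]"]) simp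

lemma lin_entry: "lin (\<lambda>y. qRe (c * y w))"
  unfolding lin_def by (rule exI[of _ "[(c, w)]"]) simp

lemma lin_add: "lin F \<Longrightarrow> lin G \<Longrightarrow> lin (\<lambda>y. F y + G y)"
proof -
  assume "lin F" "lin G"
  then obtain xs ys where "F = (\<lambda>y. \<Sum>(c, w)\<leftarrow>xs. qRe (c * y w))" "G = (\<lambda>y. \<Sum>(c, w)\<leftarrow>ys. qRe (c * y w))"
    by (auto simp: lin_def)
  then show ?thesis
    unfolding lin_def by (intro exI[of _ "xs @ ys"]) simp
qed

lemma lin_scale: "lin F \<Longrightarrow> lin (\<lambda>y. r * F y)"
proof -
  assume "lin F"
  then obtain xs where "F = (\<lambda>y. \<Sum>(c, w)\<leftarrow>xs. qRe (c * y w))"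
    by (auto simp: lin_def)
  then show ?thesis
    unfolding lin_def
    by (intro exI[of _ "map (\<lambda>(c, w). (r *\<^sub>R c, w)) xs"])
       (simp add: sum_list_const_mult[symmetric] split_def comp_def)
qed

lemma lin_diff: "lin F \<Longrightarrow> lin G \<Longrightarrow> lin (\<lambda>y. F y - G y)"
  using lin_add[of F "\<lambda>y. (-1) * G y"] lin_scale[of G "-1"] by simp

lemma lin_sum: "(\<And>i. i \<in> S \<Longrightarrow> lin (F i)) \<Longrightarrow> lin (\<lambda>y. \<Sum>i\<in>S. F i y)"
  by (induction S rule: infinite_finite_induct) (auto intro: lin_0 lin_add)

lemma lin_sum_list: "(\<And>i. i \<in> set xs \<Longrightarrow> lin (F i)) \<Longrightarrow> lin (\<lambda>y. \<Sum>i\<leftarrow>xs. F i y)"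
  by (induction xs) (auto intro: lin_0 lin_add)

lemma lin_L_y: "lin (\<lambda>y. qRe (c * L_y y p * d))"
proof (induction p rule: rpoly_induct)
  case (mono w)
  have "qRe (c * y w * d) = qRe (d * c * y w)" for y :: "'a word \<Rightarrow> quat"
    using qRe_mult_commute[of "c * y w" d] by (simp add: mult.assoc)
  then show ?case using lin_entry[of "d * c" w] by simp
qed (auto simp: algebra_simps intro: lin_0 lin_add lin_scale)

lemma lin_Re_entry: "lin (\<lambda>y. qRe (y w))"
  using lin_entry[of 1] by simp

lemma lin_qf: "lin (qf q xs)"
  unfolding qf_def qRe_sum_list split_def by (intro lin_sum_list lin_L_y)

lemma lin_cone: "F \<in> cone g h \<Longrightarrow> lin F"
proof (induction rule: cone.induct)
  case (equation k c u v)
  then show ?case using lin_L_y[of c _ 1] by simp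
qed (auto intro: lin_qf lin_add)

lemma lin_apply_add: "lin F \<Longrightarrow> F (\<lambda>w. y w + z w) = F y + F z"
  by (auto simp: lin_def algebra_simps sum_list_addf split_def)

lemma lin_apply_scale: "lin F \<Longrightarrow> F (\<lambda>w. r *\<^sub>R y w) = r * F y"
  by (auto simp: lin_def sum_list_const_mult split_def)

lemma lin_local: "lin F \<Longrightarrow> \<exists>D. \<forall>y z. (\<forall>w. wlen w \<le> D \<longrightarrow> y w = z w) \<longrightarrow> F y = F z"
proof -
  assume "lin F"
  then obtain xs where F: "F = (\<lambda>y. \<Sum>(c, w)\<leftarrow>xs. qRe (c * y w))"
    by (auto simp: lin_def)
  have "finite (insert 0 ((wlen \<circ> snd) ` set xs))" by simp
  then have "wlen w \<le> Max (insert 0 ((wlen \<circ> snd) ` set xs))" if "(c, w) \<in> set xs" for c w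
    by (intro Max_ge) (use that in force)+
  then show ?thesis
    unfolding F
    by (intro exI[of _ "Max (insert 0 ((wlen \<circ> snd) ` set xs))"])
       (auto intro!: arg_cong[where f = sum_list])
qed

lemma qf_eq_Re: "qf q xs y = (\<Sum>(a, U)\<leftarrow>xs. \<Sum>(b, V)\<leftarrow>xs. qRe (qconj a * L_y y (rstar U * q * V) * b))"
  by (simp add: qf_def qRe_sum_list split_def)

lemma qf_scale: "qf q (map (\<lambda>(a, U). (s *\<^sub>R a, U)) xs) y = s\<^sup>2 * qf q xs y"
  by (simp add: qf_eq_Re split_def comp_def power2_eq_square sum_list_const_mult flip: mult.assoc)

lemma cone_0: "(\<lambda>y. 0) \<in> cone g h"
  using cone.square[of 1 g "[]" h] by (simp add: qf_def[abs_def])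

lemma cone_scale: "F \<in> cone g h \<Longrightarrow> 0 \<le> t \<Longrightarrow> (\<lambda>y. t * F y) \<in> cone g h"
proof (induction rule: cone.induct)
  case (square q xs)
  \<comment> \<open>Coefficients enter quadratically, so the square root of the scalar is absorbed
    into them.\<close>
  then have "qf q (map (\<lambda>(a, U). (sqrt t *\<^sub>R a, U)) xs) \<in> cone g h"
    by (auto intro: cone.square)
  then show ?case
    using square by (simp add: qf_scale[abs_def])
next
  case (equation k c u v)
  then show ?case using cone.equation[of k h "t *\<^sub>R c"] by simp
next
  case (add F G)
  then show ?case using cone.add by (fastforce simp: algebra_simps)
next
  case (cong F G)
  then show ?case by (auto intro: cone.cong[where F = "\<lambda>y. t * F y"] lin_scale)
qed

lemma cone_sum: "(\<And>i. i \<in> S \<Longrightarrow> F i \<in> cone g h) \<Longrightarrow> (\<lambda>y. \<Sum>i\<in>S. F i y) \<in> cone g h"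
  by (induction S rule: infinite_finite_induct) (auto intro: cone_0 cone.add)

lemma cone_sum_list: "(\<And>i. i \<in> set xs \<Longrightarrow> F i \<in> cone g h) \<Longrightarrow> (\<lambda>y. \<Sum>i\<leftarrow>xs. F i y) \<in> cone g h"
  by (induction xs) (auto intro: cone_0 cone.add)


section \<open>Certified functionals and the moment relaxation\<close>

lemma L_y_expand:
  assumes "finite S" "Poly_Mapping.keys U \<subseteq> S" "Poly_Mapping.keys V \<subseteq> S"
  shows "L_y y (rstar U * q * V) =
    (\<Sum>u\<in>S. \<Sum>v\<in>S. (Poly_Mapping.lookup U u * Poly_Mapping.lookup V v) *\<^sub>R localizing_matrix q y u v)"
proof -
  have 1: "L_y y (p * V) = (\<Sum>v\<in>S. Poly_Mapping.lookup V v *\<^sub>R L_y y (p * wmono v))" for p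
  proof -
    have "L_y y (p * V) = L_y (\<lambda>v. L_y y (p * wmono v)) V"
      by (simp add: L_y_act)
    then show ?thesis
      using sum_keys_superset[OF assms(1,3), of "\<lambda>k r. r *\<^sub>R L_y y (p * wmono k)"] by (simp add: L_y_def)
  qed
  have "L_y y (rstar U * p) = (\<Sum>u\<in>S. Poly_Mapping.lookup U u *\<^sub>R L_y y (wmono (wstar u) * p))" for p
  proof -
    have "L_y y (rstar U * p) = L_y (\<lambda>u. L_y y (wmono (wstar u) * p)) U"
      by (induction U rule: rpoly_induct) (simp_all add: algebra_simps)
    then show ?thesis
      using sum_keys_superset[OF assms(1,2), of "\<lambda>k r. r *\<^sub>R L_y y (wmono (wstar k) * p)"] by (simp add: L_y_def)
  qed
  then have "L_y y (rstar U * q * V) =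
      (\<Sum>u\<in>S. Poly_Mapping.lookup U u *\<^sub>R L_y y (wmono (wstar u) * q * V))"
    by (simp add: mult.assoc)
  then show ?thesis
    by (simp only: 1 localizing_matrix_def scaleR_right.sum scaleR_scaleR)
qed

lemma qf_nonneg_of_psd:
  assumes "psd S (localizing_matrix q y)" "finite S"
    and "\<And>a U. (a, U) \<in> set xs \<Longrightarrow> Poly_Mapping.keys U \<subseteq> S"
  shows "0 \<le> qf q xs y"
proof -
  \<comment> \<open>The list of polynomials is collapsed into its coefficient vector over words,
    which is the vector to be tested against the matrix.\<close>
  define x where "x = (\<lambda>u. \<Sum>(a, U)\<leftarrow>xs. Poly_Mapping.lookup U u *\<^sub>R a)"
  let ?M = "localizing_matrix q y"
  let ?s = "\<Sum>u\<in>S. \<Sum>v\<in>S. qconj (x u) * ?M u v * x v"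
  have "qnonneg ?s"
    using assms(1) unfolding psd_def by blast
  then have "0 \<le> qRe ?s" by (auto simp: qnonneg_def)
  moreover have "(\<Sum>(a, U)\<leftarrow>xs. \<Sum>(b, V)\<leftarrow>xs. qconj a * L_y y (rstar U * q * V) * b) = ?s"
  proof -
    have "(\<Sum>(a, U)\<leftarrow>xs. \<Sum>(b, V)\<leftarrow>xs. qconj a * L_y y (rstar U * q * V) * b) =
       (\<Sum>(a, U)\<leftarrow>xs. \<Sum>(b, V)\<leftarrow>xs. \<Sum>u\<in>S. \<Sum>v\<in>S.
          qconj (Poly_Mapping.lookup U u *\<^sub>R a) * ?M u v * (Poly_Mapping.lookup V v *\<^sub>R b))"
      using assms(2,3)
      by (intro arg_cong[where f = sum_list] map_cong refl)
        (auto simp: L_y_expand sum_distrib_left sum_distrib_right mult.commute intro!: arg_cong[where f = sum_list])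
    also have "\<dots> = (\<Sum>u\<in>S. \<Sum>v\<in>S. \<Sum>(a, U)\<leftarrow>xs. \<Sum>(b, V)\<leftarrow>xs.
          qconj (Poly_Mapping.lookup U u *\<^sub>R a) * ?M u v * (Poly_Mapping.lookup V v *\<^sub>R b))"
      by (simp add: sum_list_swap_sum split_def)
    also have "\<dots> = ?s"
      unfolding x_def split_def qconj_sum_list sum_list_bilinear ..
    finally show ?thesis .
  qed
  ultimately show ?thesis by (simp add: qf_def)
qed

lemma moment_feasibleD:
  assumes "moment_feasible g h d y"
  shows "y 0 = 1"
    and "wlen w \<le> 2 * d \<Longrightarrow> y (wstar w) = qconj (y w)"
    and "\<forall>u\<in>words_le (2 * d). \<forall>v\<in>words_le (2 * d). cyc_equiv u v \<longrightarrow> qRe (y u) = qRe (y v)"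
    and "psd (words_le d) (moment_matrix y)"
    and "i < length g \<Longrightarrow> psd (words_le (d - half_deg (g ! i))) (localizing_matrix (g ! i) y)"
    and "j < length h \<Longrightarrow> wlen u + wlen v + wdeg (h ! j) \<le> 2 * d \<Longrightarrow>
      L_y y (wmono u * (h ! j) * wmono v) = 0"
    and "wlen u + wlen v + wlen w + 1 \<le> 2 * d \<Longrightarrow>
      L_y y (wmono u * ((wmono w + wmono (wstar w)) * wmono (letter (Q k)) -
        wmono (letter (Q k)) * (wmono w + wmono (wstar w))) * wmono v) = 0"
proof -
  have star: "\<forall>w\<in>words_le (2 * d). y w = qconj (y (wstar w))"
    using assms unfolding moment_feasible_def by blast
  show "y (wstar w) = qconj (y w)" if "wlen w \<le> 2 * d"
    using bspec[OF star, of "wstar w"] that by (simp add: words_le_def)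
qed (use assms in \<open>unfold moment_feasible_def Let_def, blast+\<close>)

lemma moment_rel_trunc:
  assumes "moment_feasible g h d y"
  shows "moment_rel (trunc (2 * d) y)"
  unfolding moment_rel_def
proof (intro conjI allI)
  fix w :: "'a word"
  show "trunc (2 * d) y (wstar w) = qconj (trunc (2 * d) y w)"
    using moment_feasibleD(2)[OF assms, of w] by (simp add: trunc_def)
  show "cyclic (trunc (2 * d) y)"
    by (rule cyclic_trunc[OF moment_feasibleD(3)[OF assms]])
  fix u v :: "'a word" and i
  show "trunc (2 * d) y (u + w + letter (Q i) + v) + trunc (2 * d) y (u + wstar w + letter (Q i) + v) =
        trunc (2 * d) y (u + letter (Q i) + w + v) + trunc (2 * d) y (u + letter (Q i) + wstar w + v)"
  proof (cases "wlen u + wlen v + wlen w + 1 \<le> 2 * d")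
    case True
    from moment_feasibleD(7)[OF assms this, of i] show ?thesis
      using True by (simp add: trunc_def algebra_simps flip: wmono_add)
  \<comment> \<open>The four words have equal length, so beyond the bound all entries
    vanish.\<close>
  qed (simp add: trunc_def)
qed

text \<open>The required order depends on the certificate: on the degrees in its squares and
  equations, and on the lengths of the words seen by the functionals that are rewritten.\<close>

lemma cone_moment_nonneg:
  fixes g h :: "('n::finite) rpoly list"
  assumes "F \<in> cone g h"
  shows "\<exists>d0. \<forall>d\<ge>d0. \<forall>y. moment_feasible g h d y \<longrightarrow> 0 \<le> F y"
  using assms
proof (induction rule: cone.induct)
  case (square q xs)
  define D where "D = (\<Sum>(a, U)\<leftarrow>xs. wdeg U)"
  have keys: "Poly_Mapping.keys U \<subseteq> words_le t" if "(a, U) \<in> set xs" "D \<le> t" for a U t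
  proof -
    have "wdeg U \<le> D"
      unfolding D_def using that by (intro member_le_sum_list) (auto simp: image_iff split_def, force)
    then show ?thesis using that wdeg_le_iff[of U t] by (auto simp: words_le_def)
  qed
  from square show ?case
  proof
    assume q: "q = 1"
    have "localizing_matrix 1 y = moment_matrix y" for y :: "'n word \<Rightarrow> quat"
      by (simp add: fun_eq_iff localizing_matrix_def moment_matrix_def flip: wmono_add)
    then show ?thesis
      unfolding q
      by (metis finite_words_le keys moment_feasibleD(4) qf_nonneg_of_psd)
  next
    assume "q \<in> set g"
    then obtain i where i: "i < length g" "q = g ! i" by (auto simp: in_set_conv_nth)
    show ?thesis
    \<comment> \<open>Adding \<open>half_deg q\<close> compensates the subtraction in the size of
      the localizing matrix.\<close>
    proof (intro exI[of _ "D + half_deg q"] allI impI)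
      fix d and y :: "'n word \<Rightarrow> quat" assume "d \<ge> D + half_deg q" "moment_feasible g h d y"
      then show "0 \<le> qf q xs y"
        using i moment_feasibleD(5)[of g h d y i]
        by (intro qf_nonneg_of_psd[of "words_le (d - half_deg q)"] finite_words_le keys) auto
    qed
  qed
next
  case (equation k c u v)
  then obtain j where j: "j < length h" "k = h ! j" by (auto simp: in_set_conv_nth)
  then show ?case
    by (intro exI[of _ "wlen u + wlen v + wdeg k"]) (auto simp: moment_feasibleD(6))
next
  case (add F G)
  then obtain d1 d2 where "\<forall>d\<ge>d1. \<forall>y. moment_feasible g h d y \<longrightarrow> 0 \<le> F y"
    "\<forall>d\<ge>d2. \<forall>y. moment_feasible g h d y \<longrightarrow> 0 \<le> G y" by blast
  then show ?case by (intro exI[of _ "max d1 d2"]) auto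
next
  case (cong F G)
  from cong.IH obtain d0 where d0: "\<forall>d\<ge>d0. \<forall>y. moment_feasible g h d y \<longrightarrow> 0 \<le> F y" by blast
  obtain D1 where D1: "\<And>y z. (\<forall>w. wlen w \<le> D1 \<longrightarrow> y w = z w) \<Longrightarrow> F y = F z"
    using lin_local[OF lin_cone[OF cong.hyps(1)]] by blast
  obtain D2 where D2: "\<And>y z. (\<forall>w. wlen w \<le> D2 \<longrightarrow> y w = z w) \<Longrightarrow> G y = G z"
    using lin_local[OF cong.hyps(2)] by blast
  show ?case
  proof (intro exI[of _ "d0 + D1 + D2"] allI impI)
    fix d y assume d: "d \<ge> d0 + D1 + D2" and y: "moment_feasible g h d y"
    \<comment> \<open>Both functionals see only short words, where \<open>y\<close> agrees with its
      truncation; it is the truncation that satisfies the relations at every length.\<close>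
    have "G y = G (trunc (2 * d) y)"
      using d by (intro D2) (auto simp: trunc_def)
    also have "\<dots> = F (trunc (2 * d) y)"
      using cong.hyps(3)[OF moment_rel_trunc[OF y]] by simp
    also have "\<dots> = F y"
      using d by (intro D1) (auto simp: trunc_def)
    finally show "0 \<le> G y" using d0 d y by (metis add.assoc add_leD1)
  qed
qed


section \<open>Certified functionals and the quadratic module\<close>

lemma of_rpoly_mult: "of_rpoly (p * q) = of_rpoly p * of_rpoly q"
proof (induction p rule: rpoly_induct)
  case (mono w)
  then show ?case
    by (induction q rule: rpoly_induct) (simp_all add: algebra_simps hword_add flip: wmono_add)
qed (simp_all add: algebra_simps)

lemma L_y_weval_mult: "L_y (weval a) (p * q) = L_y (weval a) p * L_y (weval a) q"
  by (simp add: of_rpoly_mult flip: heval_of_rpoly)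

lemma L_y_weval_rstar: "L_y (weval a) (rstar p) = qconj (L_y (weval a) p)"
  by (simp add: heval_hstar flip: heval_of_rpoly hstar_of_rpoly)

text \<open>A polynomial plus its star evaluates to a real number, which commutes with every
  quaternion.\<close>

lemma moment_rel_weval: "moment_rel (weval a)"
proof -
  have "L_y (weval a) (p + rstar p) * x = x * L_y (weval a) (p + rstar p)" for p x
  proof -
    have "L_y (weval a) (p + rstar p) = of_real (2 * qRe (L_y (weval a) p))"
      by (simp add: L_y_weval_rstar quat_eq_iff del: of_real_mult)
    then show ?thesis by (simp only: of_real_quat_comm)
  qed
  note comm = this
  show ?thesis
    unfolding moment_rel_def
  proof (intro conjI allI)
    fix u w v :: "'a word" and i
    let ?W = "weval a w + weval a (wstar w)" and ?x = "weval a (letter (Q i))"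
    have "?W * ?x = ?x * ?W"
      using comm[of "wmono w" ?x] by (simp del: weval_letter)
    then have "weval a u * (?W * ?x) * weval a v = weval a u * (?x * ?W) * weval a v"
      by (simp only:)
    then have "weval a u * weval a w * ?x * weval a v + weval a u * weval a (wstar w) * ?x * weval a v =
        weval a u * ?x * weval a w * weval a v + weval a u * ?x * weval a (wstar w) * weval a v"
      by (simp only: semiring_class.distrib_left semiring_class.distrib_right mult.assoc)
    then show "weval a (u + w + letter (Q i) + v) + weval a (u + wstar w + letter (Q i) + v) =
        weval a (u + letter (Q i) + w + v) + weval a (u + letter (Q i) + wstar w + v)"
      by (simp only: weval_simps)
  qed (simp_all add: weval_wstar cyclic_def qRe_mult_commute)
qed

text \<open>At a point the localizing form has rank one: the value of \<open>q\<close> is sandwiched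
  between a quaternion and its conjugate, and the real part of a product is invariant under cyclic
  rotation.\<close>

lemma qf_weval:
  "qf q xs (weval a) = qnorm2 (\<Sum>(b, V)\<leftarrow>xs. L_y (weval a) V * b) * qRe (L_y (weval a) q)"
proof -
  define s where "s = (\<Sum>(b, V)\<leftarrow>xs. L_y (weval a) V * b)"
  have "qf q xs (weval a) = qRe (qconj s * L_y (weval a) q * s)"
    unfolding qf_def s_def qconj_sum_list split_def sum_list_bilinear
    by (simp add: L_y_weval_mult L_y_weval_rstar mult.assoc)
  also have "\<dots> = qRe (L_y (weval a) q * (s * qconj s))"
    using qRe_mult_commute[of "qconj s" "L_y (weval a) q * s"] by (simp add: mult.assoc)
  also have "\<dots> = qnorm2 s * qRe (L_y (weval a) q)"
    by (simp add: mult_qconj_self mult_of_real_quat)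
  finally show ?thesis by (simp add: s_def)
qed

text \<open>In \<open>lpoly\<close> the coefficients stand to the left of the words, in
  \<open>qf\<close> to the right; conjugation exchanges the sides. The square built from the element
  found here has the norm in \<open>qf_weval\<close> as its value at each point.\<close>

lemma lpoly_exists: "\<exists>p. \<forall>a. heval a (lpoly p) = qconj (\<Sum>(b, V)\<leftarrow>xs. L_y (weval a) V * b)"
proof -
  have 1: "\<exists>p. \<forall>a. heval a (lpoly p) = c * L_y (weval a) U" for c and U :: "'a rpoly"
  proof (induction U rule: rpoly_induct)
    case zero
    then show ?case by (intro exI[of _ 0]) simp
  next
    case (mono w)
    then show ?case by (intro exI[of _ "Poly_Mapping.single w c"]) (simp add: lpoly_single)
  next
    case (add p q)
    then obtain p' q' where "\<forall>a. heval a (lpoly p') = c * L_y (weval a) p" "\<forall>a. heval a (lpoly q') = c * L_y (weval a) q"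
      by blast
    then show ?case by (intro exI[of _ "p' + q'"]) (simp add: algebra_simps)
  next
    case (scale r p)
    then obtain p' where "\<forall>a. heval a (lpoly p') = c * L_y (weval a) p" by blast
    then show ?case by (intro exI[of _ "r *\<^sub>R p'"]) simp
  qed
  show ?thesis
  proof (induction xs)
    case Nil
    then show ?case by (intro exI[of _ 0]) simp
  next
    case (Cons x xs)
    obtain b V where x: "x = (b, V)" by fastforce
    obtain p where "\<forall>a. heval a (lpoly p) = qconj (\<Sum>(b, V)\<leftarrow>xs. L_y (weval a) V * b)"
      using Cons by blast
    moreover obtain p' where "\<forall>a. heval a (lpoly p') = qconj b * L_y (weval a) (rstar V)"
      using 1 by blast
    ultimately show ?case
      by (intro exI[of _ "p' + p"]) (simp add: x L_y_weval_rstar)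
  qed
qed

lemma SOS_add: "x \<in> SOS \<Longrightarrow> y \<in> SOS \<Longrightarrow> x + y \<in> SOS"
proof -
  assume "x \<in> SOS" "y \<in> SOS"
  then obtain ps qs where "x = (\<Sum>p\<leftarrow>ps. hstar (lpoly p) * lpoly p)" "y = (\<Sum>p\<leftarrow>qs. hstar (lpoly p) * lpoly p)"
    by (auto simp: SOS_def)
  then have "x + y = (\<Sum>p\<leftarrow>ps @ qs. hstar (lpoly p) * lpoly p)" by simp
  then show ?thesis unfolding SOS_def by blast
qed

lemma SOS_square: "hstar (lpoly p) * lpoly p \<in> SOS"
  unfolding SOS_def by (intro CollectI exI[of _ "[p]"]) simp

lemma SOS_0: "0 \<in> SOS"
  unfolding SOS_def by (intro CollectI exI[of _ "[]"]) simp

lemma SOS_le_add: "x \<in> SOS_le d \<Longrightarrow> y \<in> SOS_le d \<Longrightarrow> x + y \<in> SOS_le d"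
  by (auto simp: SOS_le_def intro: SOS_add P_le_add)

lemma SOS_le_0: "0 \<in> SOS_le d"
  by (auto simp: SOS_le_def intro: SOS_0 P_le_0)

lemma SOS_le_mono: "d \<le> d' \<Longrightarrow> SOS_le d \<subseteq> SOS_le d'"
  using P_le_mono[of "2 * d" "2 * d'"] by (auto simp: SOS_le_def)

lemma QM_le_mono: "d \<le> d' \<Longrightarrow> QM_le g h d \<subseteq> QM_le g h d'"
proof
  fix x assume d: "d \<le> d'" and "x \<in> QM_le g h d"
  then obtain \<sigma>0 \<sigma> T where x: "x = qm_expr g h \<sigma>0 \<sigma> T" "\<sigma>0 \<in> SOS_le d"
     "\<forall>i<length g. \<sigma> i \<in> SOS_le (d - half_deg (g ! i))"
     "\<forall>j<length h. \<forall>(\<tau>, \<nu>)\<in>set (T j). wdeg \<tau> + wdeg \<nu> + wdeg (h ! j) \<le> 2 * d"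
    by (auto simp: QM_le_def)
  have "\<sigma>0 \<in> SOS_le d'"
    using x SOS_le_mono[OF d] by blast
  moreover have "\<forall>i<length g. \<sigma> i \<in> SOS_le (d' - half_deg (g ! i))"
    using x(3) SOS_le_mono d by (meson diff_le_mono in_mono)
  moreover have "\<forall>j<length h. \<forall>(\<tau>, \<nu>)\<in>set (T j). wdeg \<tau> + wdeg \<nu> + wdeg (h ! j) \<le> 2 * d'"
    using x(4) d by fastforce
  ultimately show "x \<in> QM_le g h d'"
    using x(1) unfolding QM_le_def by blast
qed

lemma QM_le_add: "x \<in> QM_le g h d \<Longrightarrow> y \<in> QM_le g h d \<Longrightarrow> x + y \<in> QM_le g h d"
proof -
  assume "x \<in> QM_le g h d" "y \<in> QM_le g h d"
  then obtain \<sigma>0 \<sigma> T \<sigma>0' \<sigma>' T' where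
    x: "x = qm_expr g h \<sigma>0 \<sigma> T" "\<sigma>0 \<in> SOS_le d"
     "\<forall>i<length g. \<sigma> i \<in> SOS_le (d - half_deg (g ! i))"
     "\<forall>j<length h. \<forall>(\<tau>, \<nu>)\<in>set (T j). wdeg \<tau> + wdeg \<nu> + wdeg (h ! j) \<le> 2 * d" and
    y: "y = qm_expr g h \<sigma>0' \<sigma>' T'" "\<sigma>0' \<in> SOS_le d"
     "\<forall>i<length g. \<sigma>' i \<in> SOS_le (d - half_deg (g ! i))"
     "\<forall>j<length h. \<forall>(\<tau>, \<nu>)\<in>set (T' j). wdeg \<tau> + wdeg \<nu> + wdeg (h ! j) \<le> 2 * d"
    unfolding QM_le_def by blast
  have "x + y = qm_expr g h (\<sigma>0 + \<sigma>0') (\<lambda>i. \<sigma> i + \<sigma>' i) (\<lambda>j. T j @ T' j)"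
    by (simp add: x(1) y(1) qm_expr_def sum.distrib algebra_simps)
  moreover have "\<forall>j<length h. \<forall>(\<tau>, \<nu>)\<in>set (T j @ T' j). wdeg \<tau> + wdeg \<nu> + wdeg (h ! j) \<le> 2 * d"
    using x(4) y(4) by auto
  ultimately show ?thesis
    unfolding QM_le_def using x(2,3) y(2,3) SOS_le_add
    by (intro CollectI exI[of _ "\<sigma>0 + \<sigma>0'"] exI[of _ "\<lambda>i. \<sigma> i + \<sigma>' i"] exI[of _ "\<lambda>j. T j @ T' j"]) blast
qed

lemma square_degree: "\<exists>t. \<forall>d\<ge>t. hstar (lpoly p) * lpoly p \<in> SOS_le d"
proof -
  obtain t where t: "hstar (lpoly p) * lpoly p \<in> P_le t"
    using SOS_monomials[of p] by (auto simp: P_space_eq)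
  have "hstar (lpoly p) * lpoly p \<in> SOS_le d" if "d \<ge> t" for d
    using t P_le_mono[of t "2 * d"] that SOS_square by (auto simp: SOS_le_def)
  then show ?thesis by blast
qed

text \<open>Agreement at points is all that is required, because the remaining difference will be
  absorbed by the vanishing ideal. For the same reason rewriting along \<open>moment_rel\<close>
  costs nothing.\<close>

lemma cone_QM:
  fixes g h :: "'n rpoly list"
  assumes "F \<in> cone g h" and g: "\<forall>i<length g. rstar (g ! i) = g ! i"
  shows "\<exists>d. \<exists>x\<in>QM_le g h d. x \<in> P_space \<and> hstar x = x \<and> (\<forall>a. F (weval a) = qRe (heval a x))"
  using assms(1)
proof (induction rule: cone.induct)
  case (square q xs)
  obtain p where p: "\<forall>a. heval a (lpoly p) = qconj (\<Sum>(b, V)\<leftarrow>xs. L_y (weval a) V * b)"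
    using lpoly_exists by blast
  define \<sigma> where "\<sigma> = hstar (lpoly p) * lpoly p"
  obtain t where t: "\<forall>d\<ge>t. \<sigma> \<in> SOS_le d"
    using square_degree unfolding \<sigma>_def by blast
  have \<sigma>: "\<sigma> \<in> P_space" "hstar \<sigma> = \<sigma>" "heval a \<sigma> = of_real (qnorm2 (\<Sum>(b, V)\<leftarrow>xs. L_y (weval a) V * b))" for a
    unfolding \<sigma>_def using SOS_monomials by (auto simp: heval_hstar p qconj_mult_self mult_qconj_self)
  from square show ?case
  proof
    assume q: "q = 1"
    have "qm_expr g h \<sigma> (\<lambda>_. 0) (\<lambda>_. []) = \<sigma>"
      by (simp add: qm_expr_def)
    then have "\<sigma> \<in> QM_le g h t"
      unfolding QM_le_def using t SOS_le_0
      by (intro CollectI exI[of _ "\<sigma>"] exI[of _ "\<lambda>_. 0"] exI[of _ "\<lambda>_. []"]) auto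
    then show ?thesis
      using \<sigma> by (intro exI[of _ t] bexI[of _ \<sigma>]) (auto simp: q qf_weval)
  next
    assume "q \<in> set g"
    then obtain i where i: "i < length g" "q = g ! i" by (auto simp: in_set_conv_nth)
    let ?x = "(1/2) *\<^sub>R (\<sigma> * of_rpoly q + of_rpoly q * \<sigma>)"
    let ?\<sigma> = "\<lambda>k. if k = i then \<sigma> else 0"
    have "?\<sigma> k * of_rpoly (g ! k) + of_rpoly (g ! k) * ?\<sigma> k =
        (if k = i then \<sigma> * of_rpoly q + of_rpoly q * \<sigma> else 0)" for k
      by (simp add: i)
    then have "qm_expr g h 0 ?\<sigma> (\<lambda>_. []) = ?x"
      using i by (simp add: qm_expr_def)
    moreover have "\<forall>k<length g. ?\<sigma> k \<in> SOS_le (t + half_deg q - half_deg (g ! k))"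
      using t i SOS_le_0 by auto
    ultimately have "?x \<in> QM_le g h (t + half_deg q)"
      unfolding QM_le_def using SOS_le_0
      by (intro CollectI exI[of _ 0] exI[of _ ?\<sigma>] exI[of _ "\<lambda>_. []"]) auto
    moreover have "hstar ?x = ?x"
      using g i \<sigma> by (simp add: hstar_of_rpoly add.commute)
    moreover have "?x \<in> P_space"
      using \<sigma> by (intro P_space_scaleR P_space_add P_space_mult_of_rpoly)
    moreover have "qf q xs (weval a) = qRe (heval a ?x)" for a
      by (simp add: qf_weval \<sigma> heval_of_rpoly mult_of_real_quat of_real_quat_comm)
    ultimately show ?thesis by blast
  qed
next
  case (equation k c u v)
  then obtain j where j: "j < length h" "k = h ! j" by (auto simp: in_set_conv_nth)
  \<comment> \<open>In the quadratic module the term comes with its adjoint, which doubles the real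
    part; the coefficient one half compensates.\<close>
  define \<tau> \<nu> :: "'n word \<Rightarrow>\<^sub>0 quat"
    where "\<tau> = Poly_Mapping.single u ((1/2) *\<^sub>R c)" and "\<nu> = Poly_Mapping.single (wstar v) 1"
  let ?x = "lpoly \<tau> * of_rpoly k * hstar (lpoly \<nu>) + lpoly \<nu> * hstar (of_rpoly k) * hstar (lpoly \<tau>)"
  let ?T = "\<lambda>l. if l = j then [(\<tau>, \<nu>)] else []"
  have "(\<Sum>(\<tau>, \<nu>)\<leftarrow>?T l. lpoly \<tau> * of_rpoly (h ! l) * hstar (lpoly \<nu>)
          + lpoly \<nu> * hstar (of_rpoly (h ! l)) * hstar (lpoly \<tau>)) = (if l = j then ?x else 0)" for l
    by (simp add: j)
  then have "qm_expr g h 0 (\<lambda>_. 0) ?T = ?x"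
    using j by (simp add: qm_expr_def)
  moreover have "\<forall>l<length h. \<forall>(\<tau>', \<nu>')\<in>set (?T l). wdeg \<tau>' + wdeg \<nu>' + wdeg (h ! l) \<le> 2 * (wdeg \<tau> + wdeg \<nu> + wdeg k)"
    by (auto simp: j)
  ultimately have "?x \<in> QM_le g h (wdeg \<tau> + wdeg \<nu> + wdeg k)"
    unfolding QM_le_def using SOS_le_0
    by (intro CollectI exI[of _ 0] exI[of _ "\<lambda>_. 0"] exI[of _ ?T]) auto
  moreover have "hstar ?x = ?x"
    by (simp add: add.commute mult.assoc)
  moreover have "?x \<in> P_space"
  proof -
    have "?x = const ((1/2) *\<^sub>R c) * of_rpoly (wmono u * k * wmono v) +
        of_rpoly (wmono (wstar v) * rstar k * wmono (wstar u)) * const (qconj ((1/2) *\<^sub>R c))"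
      by (simp add: \<tau>_def \<nu>_def lpoly_single hstar_of_rpoly of_rpoly_mult const_simps mult.assoc)
    then show ?thesis by (simp only:) (intro P_space_add P_space_const_mult)
  qed
  moreover have "qRe (c * L_y (weval a) (wmono u * k * wmono v)) = qRe (heval a ?x)" for a
  proof -
    let ?z = "c * (weval a u * L_y (weval a) k * weval a v)"
    have "heval a ?x = (1/2) *\<^sub>R ?z + qconj ((1/2) *\<^sub>R ?z)"
      by (simp add: \<tau>_def \<nu>_def lpoly_single heval_hstar heval_of_rpoly weval_wstar mult.assoc const_simps)
    then have "qRe (heval a ?x) = qRe ?z"
      by (simp del: heval_simps qconj_simps(2))
    then show ?thesis by (simp add: L_y_weval_mult mult.assoc)
  qed
  ultimately show ?case by blast
next
  case (add F G)
  then obtain d1 x d2 z where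
    "x \<in> QM_le g h d1" "x \<in> P_space" "hstar x = x" "\<forall>a. F (weval a) = qRe (heval a x)"
    "z \<in> QM_le g h d2" "z \<in> P_space" "hstar z = z" "\<forall>a. G (weval a) = qRe (heval a z)" by blast
  moreover have "x + z \<in> QM_le g h (max d1 d2)"
    using calculation QM_le_mono[of d1 "max d1 d2" g h] QM_le_mono[of d2 "max d1 d2" g h]
    by (intro QM_le_add) auto
  ultimately show ?case
    by (intro exI[of _ "max d1 d2"] bexI[of _ "x + z"]) (auto intro: P_space_add)
next
  case (cong F G)
  then show ?case using moment_rel_weval by metis
qed


section \<open>The Archimedean property of the cone\<close>

lemma of_rpoly_1: "of_rpoly 1 = 1"
  using of_rpoly_wmono[of 0] by simp

lemma moment_relD:
  assumes "moment_rel y"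
  shows "y (wstar w) = qconj (y w)" "cyclic y"
    "y (u + w + letter (Q i) + v) + y (u + wstar w + letter (Q i) + v) =
        y (u + letter (Q i) + w + v) + y (u + letter (Q i) + wstar w + v)"
  using assms unfolding moment_rel_def by blast+

lemma L_y_rstar: "moment_rel y \<Longrightarrow> L_y y (rstar p) = qconj (L_y y p)"
  by (induction p rule: rpoly_induct) (simp_all add: moment_relD(1))

lemma L_y_cyclic:
  assumes "cyclic y"
  shows "qRe (L_y y (p * q)) = qRe (L_y y (q * p))"
proof (induction p rule: rpoly_induct)
  case (mono u)
  show ?case
  proof (induction q rule: rpoly_induct)
    case (mono v)
    have "qRe (y (u + v)) = qRe (y (v + u))"
      using assms by (auto simp: cyclic_def)
    then show ?case by (simp flip: wmono_add)
  qed (simp_all add: algebra_simps)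
qed (simp_all add: algebra_simps)

text \<open>For a barred letter, conjugate the relation for the unbarred one, with the outer words
  starred and exchanged.\<close>

lemma moment_rel_commute_letter:
  assumes "moment_rel y"
  shows "y (u + w + letter x + v) + y (u + wstar w + letter x + v) =
        y (u + letter x + w + v) + y (u + letter x + wstar w + v)"
proof (cases x)
  case (Q i)
  then show ?thesis using moment_relD(3)[OF assms] by simp
next
  case (Qbar i)
  have "qconj (y (wstar v + letter (Q i) + wstar w + wstar u) + y (wstar v + letter (Q i) + w + wstar u)) =
    qconj (y (wstar v + wstar w + letter (Q i) + wstar u) + y (wstar v + w + letter (Q i) + wstar u))"
    using moment_relD(3)[OF assms, of "wstar v" w i "wstar u"] by (simp add: add.commute)
  then show ?thesis
    by (simp add: Qbar flip: moment_relD(1)[OF assms]) (simp add: add.assoc)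
qed

lemma moment_rel_commute_word:
  assumes "moment_rel y"
  shows "y (u + w + b + v) + y (u + wstar w + b + v) = y (u + b + w + v) + y (u + b + wstar w + v)"
proof (induction b arbitrary: v rule: word_snoc_induct)
  case empty
  then show ?case by simp
next
  case (snoc b x)
  have "y (u + w + (b + letter x) + v) + y (u + wstar w + (b + letter x) + v) =
      y (u + b + w + (letter x + v)) + y (u + b + wstar w + (letter x + v))"
    using snoc[of "letter x + v"] by (simp add: add.assoc)
  also have "\<dots> = y (u + b + letter x + w + v) + y (u + b + letter x + wstar w + v)"
    using moment_rel_commute_letter[OF assms, of "u + b" w x v] by (simp add: add.assoc)
  finally show ?case by (simp add: add.assoc)
qed

lemma L_y_act_middle: "L_y (\<lambda>w. L_y y (p * wmono w * q)) b = L_y y (p * b * q)"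
  by (induction b rule: rpoly_induct) (simp_all add: algebra_simps)

lemma L_y_act_trace:
  "L_y (\<lambda>w. L_y y (p * (wmono w + wmono (wstar w)) * q)) b = L_y y (p * (b + rstar b) * q)"
  by (induction b rule: rpoly_induct) (simp_all add: algebra_simps)

text \<open>Both sides are linear in \<open>q\<close>, \<open>b\<close>, \<open>s\<close> and
  \<open>p\<close>; starting from words, these arguments become arbitrary one after the other, in
  this order.\<close>

lemma L_y_commute_trace:
  assumes "moment_rel y"
  shows "L_y y (p * (s + rstar s) * b * q) = L_y y (p * b * (s + rstar s) * q)"
proof -
  have 1: "L_y y (wmono u * (wmono w + wmono (wstar w)) * wmono c * wmono v) =
      L_y y (wmono u * wmono c * (wmono w + wmono (wstar w)) * wmono v)" for u w c v
    using moment_rel_commute_word[OF assms, of u w c v]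
    by (simp add: algebra_simps flip: wmono_add)
  have 2: "L_y y (wmono u * (wmono w + wmono (wstar w)) * wmono c * q) =
      L_y y (wmono u * wmono c * (wmono w + wmono (wstar w)) * q)" for u w c
    unfolding L_y_act(1)[symmetric, of y _ q] by (simp only: 1)
  have 3: "L_y y (wmono u * (wmono w + wmono (wstar w)) * b * q) =
      L_y y (wmono u * b * (wmono w + wmono (wstar w)) * q)" for u w
    using L_y_act_middle[of y "wmono u * (wmono w + wmono (wstar w))" q b]
      L_y_act_middle[of y "wmono u" "(wmono w + wmono (wstar w)) * q" b]
    by (simp only: 2 mult.assoc[symmetric])
  have 4: "L_y y (wmono u * (s + rstar s) * b * q) = L_y y (wmono u * b * (s + rstar s) * q)" for u
    using L_y_act_trace[of y "wmono u" "b * q" s] L_y_act_trace[of y "wmono u * b" q s]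
    by (simp only: 3 mult.assoc[symmetric])
  show ?thesis
    using L_y_act(2)[of y "(s + rstar s) * b * q" p] L_y_act(2)[of y "b * (s + rstar s) * q" p]
    by (simp only: 4 mult.assoc[symmetric])
qed

lemma L_y_commute_symmetric:
  assumes "moment_rel y" "rstar s = s"
  shows "L_y y (p * s * b * q) = L_y y (p * b * s * q)"
proof -
  have "2 *\<^sub>R L_y y (p * s * b * q) = 2 *\<^sub>R L_y y (p * b * s * q)"
    using L_y_commute_trace[OF assms(1), of p s b q]
    by (simp add: assms(2) semiring_class.distrib_left semiring_class.distrib_right scaleR_2)
  then show ?thesis by simp
qed

text \<open>The component of a quaternionic polynomial along one of the units 1, i, j, k. Since
  \<open>qRe (qconj a * b)\<close> is the Euclidean inner product, the real trace of a quaternionic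
  square splits into four squares of real polynomials.\<close>

definition sel_part :: "(quat \<Rightarrow> real) \<Rightarrow> ('n word \<Rightarrow>\<^sub>0 quat) \<Rightarrow> 'n rpoly" where
  "sel_part s p = (\<Sum>w\<in>Poly_Mapping.keys p. Poly_Mapping.single w (s (Poly_Mapping.lookup p w)))"

definition sels :: "(quat \<Rightarrow> real) list" where
  "sels = [qRe, qI, qJ, qK]"

lemma sel_additive: "s \<in> set sels \<Longrightarrow> s (a + b) = s a + s b" "s \<in> set sels \<Longrightarrow> s 0 = 0"
  by (auto simp: sels_def)

lemma sel_part_simps:
  assumes "s \<in> set sels"
  shows "sel_part s (p + q) = sel_part s p + sel_part s q" "sel_part s 0 = 0"
    "sel_part s (Poly_Mapping.single w c) = s c *\<^sub>R wmono w"
proof -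
  show "sel_part s (p + q) = sel_part s p + sel_part s q"
    unfolding sel_part_def by (rule sum_keys_add) (auto simp: sel_additive[OF assms] single_add)
  show "sel_part s (Poly_Mapping.single w c) = s c *\<^sub>R wmono w"
    unfolding sel_part_def
    by (subst sum_keys_single[where F = "\<lambda>w c. Poly_Mapping.single w (s c)"])
      (auto simp: sel_additive[OF assms] wmono_def scaleR_single)
qed (simp add: sel_part_def)

lemma sum_sels: "(\<Sum>s\<leftarrow>sels. s a * s b) = qRe (qconj a * b)"
  by (simp add: sels_def quat_sel_mult)

text \<open>
  A conjugate \<open>u w u\<^sup>*\<close> is a cyclic permutation of a word with central factor \<open>u\<^sup>* u\<close>; so the
  real parts of its moments are again cyclic in \<open>w\<close>, and a quaternionic certificate may be
  evaluated on them. Only the real parts of products of its coefficients then contribute.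
\<close>

definition conj_moments :: "('n word \<Rightarrow> quat) \<Rightarrow> 'n word \<Rightarrow> 'n word \<Rightarrow> real" where
  "conj_moments y u w = qRe (y (u + w + wstar u))"

abbreviation conj_trace :: "('n word \<Rightarrow> quat) \<Rightarrow> 'n word \<Rightarrow> 'n hpoly \<Rightarrow> real" where
  "conj_trace y u \<equiv> trace_fun (\<lambda>w. of_real (conj_moments y u w))"

lemma conj_moments_cyclic:
  assumes "cyclic y"
  shows "conj_moments y u (v + w) = conj_moments y u (w + v)"
proof -
  let ?k = "wstar u + u"
  have c: "qRe (y (a + b)) = qRe (y (b + a))" for a b
    using assms by (auto simp: cyclic_def)
  have k: "?k + b = b + ?k" for b
    using word_star_central[of "wstar u" b] by simp
  have *: "conj_moments y u w = qRe (y (w + ?k))" for w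
    using c[of u "w + wstar u"] by (simp add: conj_moments_def add.assoc)
  have "qRe (y (v + w + ?k)) = qRe (y (w + ?k + v))"
    using c[of v "w + ?k"] by (simp add: add.assoc)
  also have "w + ?k + v = w + v + ?k"
    using k[of v] by (simp add: add.assoc)
  finally show ?thesis by (simp add: *)
qed

lemma conj_trace_monomial:
  assumes "cyclic y"
  shows "conj_trace y u (hword a * const c * hword b) = qRe c * conj_moments y u (a + b)"
proof -
  have "cyclic (\<lambda>w. of_real (conj_moments y u w))"
    using conj_moments_cyclic[OF assms] by (simp add: cyclic_def)
  then show ?thesis
    using conj_moments_cyclic[OF assms, of u a b]
    by (simp add: trace_fun_monomial quat_sel_mult)
qed

lemma conj_trace_word:
  assumes "cyclic y"
  shows "conj_trace y u (hword w) = conj_moments y u w"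
  using conj_trace_monomial[OF assms, of u 0 1 w] by (simp add: const_simps)

lemma conj_trace_outer: "conj_trace y u (const c * hword w * const c') = qRe (c * c') * conj_moments y u w"
  by (subst trace_fun_real_monomial) auto

text \<open>Real moments see only the real part of the product of the two coefficients, which
  \<open>sum_sels\<close> distributes over the four components. The side on which \<open>q\<close>
  stands does not matter, so both halves of a symmetrized term of the quadratic module have the same
  trace.\<close>

lemma conj_trace_product:
  assumes "cyclic y"
  shows "conj_trace y u (hstar (lpoly p) * lpoly p' * of_rpoly q) =
      (\<Sum>s\<leftarrow>sels. qRe (L_y y (wmono u * rstar (sel_part s p) * sel_part s p' * q * wmono (wstar u))))" (is ?A)
    and "conj_trace y u (of_rpoly q * (hstar (lpoly p) * lpoly p')) =
      (\<Sum>s\<leftarrow>sels. qRe (L_y y (wmono u * rstar (sel_part s p) * sel_part s p' * q * wmono (wstar u))))" (is ?B)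
proof -
  let ?R = "\<lambda>p p' q. (\<Sum>s\<leftarrow>sels. qRe (L_y y (wmono u * rstar (sel_part s p) * sel_part s p' * q * wmono (wstar u))))"
  have R_single: "?R (Poly_Mapping.single w c) (Poly_Mapping.single v c') (wmono b) =
      qRe (qconj c * c') * conj_moments y u (wstar w + v + b)" for w c v c' b
  proof -
    have "?R (Poly_Mapping.single w c) (Poly_Mapping.single v c') (wmono b) =
       (\<Sum>s\<leftarrow>sels. s c * s c') * qRe (y (u + (wstar w + v + b) + wstar u))"
      by (simp add: sels_def sel_part_simps sels_def algebra_simps flip: wmono_add)
    then show ?thesis by (simp add: sum_sels conj_moments_def)
  qed
  have R_add: "?R (p1 + p2) p' q = ?R p1 p' q + ?R p2 p' q" "?R p (p1' + p2') q = ?R p p1' q + ?R p p2' q"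
     "?R p p' (q1 + q2) = ?R p p' q1 + ?R p p' q2" "?R p p' (r *\<^sub>R q) = r * ?R p p' q"
     "?R 0 p' q = 0" "?R p 0 q = 0" "?R p p' 0 = 0" for p1 p2 p p1' p2' p' q1 q2 q r
    by (simp_all add: sels_def sel_part_simps[unfolded sels_def] algebra_simps)
  have A: "conj_trace y u (hstar (lpoly p) * lpoly p' * hword b) = ?R p p' (wmono b)" for b
  proof (induction p rule: poly_mapping_single_induct)
    case (single w c)
    show ?case
    proof (induction p' rule: poly_mapping_single_induct)
      case (single v c')
      have "hstar (lpoly (Poly_Mapping.single w c)) * lpoly (Poly_Mapping.single v c') * hword b =
          hword (wstar w) * const (qconj c * c') * hword (v + b)"
        by (simp add: lpoly_single const_simps hword_add mult.assoc)
      then show ?case by (simp only: R_single conj_trace_monomial[OF assms] add.assoc)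
    qed (simp_all add: R_add semiring_class.distrib_left semiring_class.distrib_right)
  qed (simp_all add: R_add semiring_class.distrib_left semiring_class.distrib_right)
  have B: "conj_trace y u (hword b * (hstar (lpoly p) * lpoly p')) = ?R p p' (wmono b)" for b
  proof (induction p rule: poly_mapping_single_induct)
    case (single w c)
    show ?case
    proof (induction p' rule: poly_mapping_single_induct)
      case (single v c')
      have "hword b * (hstar (lpoly (Poly_Mapping.single w c)) * lpoly (Poly_Mapping.single v c')) =
          hword (b + wstar w) * const (qconj c * c') * hword v"
        by (simp add: lpoly_single const_simps hword_add mult.assoc)
      then show ?case
        using conj_moments_cyclic[OF assms, of u b "wstar w + v"]
        by (simp only: R_single conj_trace_monomial[OF assms] add.assoc)
    qed (simp_all add: R_add semiring_class.distrib_left semiring_class.distrib_right)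
  qed (simp_all add: R_add semiring_class.distrib_left semiring_class.distrib_right)
  show ?A
  proof (induction q rule: rpoly_induct)
    case (add q1 q2)
    then show ?case
      unfolding of_rpoly_add R_add by (simp add: semiring_class.distrib_left semiring_class.distrib_right)
  next
    case (scale r q)
    then show ?case unfolding of_rpoly_scaleR R_add by simp
  qed (simp_all add: A R_add)
  show ?B
  proof (induction q rule: rpoly_induct)
    case (add q1 q2)
    then show ?case
      unfolding of_rpoly_add R_add by (simp add: semiring_class.distrib_left semiring_class.distrib_right)
  next
    case (scale r q)
    then show ?case unfolding of_rpoly_scaleR R_add by simp
  qed (simp_all add: B R_add)
qed

lemma conj_trace_equation:
  shows "conj_trace y u (lpoly p * of_rpoly k * hstar (lpoly p')) =
      (\<Sum>s\<leftarrow>sels. qRe (L_y y (wmono u * sel_part s p * k * rstar (sel_part s p') * wmono (wstar u))))"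
proof -
  let ?R = "\<lambda>p p' q. (\<Sum>s\<leftarrow>sels. qRe (L_y y (wmono u * sel_part s p * q * rstar (sel_part s p') * wmono (wstar u))))"
  have R_single: "?R (Poly_Mapping.single w c) (Poly_Mapping.single v c') (wmono b) =
      qRe (c * qconj c') * conj_moments y u (w + b + wstar v)" for w c v c' b
  proof -
    \<comment> \<open>Conjugating both coefficients changes each imaginary sign twice and brings the
      sum into the form of \<open>sum_sels\<close>.\<close>
    have "?R (Poly_Mapping.single w c) (Poly_Mapping.single v c') (wmono b) =
       (\<Sum>s\<leftarrow>sels. s (qconj c) * s (qconj c')) * qRe (y (u + (w + b + wstar v) + wstar u))"
      by (simp add: sels_def sel_part_simps sels_def algebra_simps flip: wmono_add)
    then show ?thesis by (simp add: sum_sels conj_moments_def)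
  qed
  have R_add: "?R (p1 + p2) p' q = ?R p1 p' q + ?R p2 p' q" "?R p (p1' + p2') q = ?R p p1' q + ?R p p2' q"
     "?R p p' (q1 + q2) = ?R p p' q1 + ?R p p' q2" "?R p p' (r *\<^sub>R q) = r * ?R p p' q"
     "?R 0 p' q = 0" "?R p 0 q = 0" "?R p p' 0 = 0" for p1 p2 p p1' p2' p' q1 q2 q r
    by (simp_all add: sels_def sel_part_simps[unfolded sels_def] algebra_simps)
  have "conj_trace y u (lpoly p * hword b * hstar (lpoly p')) = ?R p p' (wmono b)" for b
  proof (induction p rule: poly_mapping_single_induct)
    case (single w c)
    show ?case
    proof (induction p' rule: poly_mapping_single_induct)
      case (single v c')
      have "lpoly (Poly_Mapping.single w c) * hword b * hstar (lpoly (Poly_Mapping.single v c')) =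
          const c * hword (w + b + wstar v) * const (qconj c')"
        by (simp add: lpoly_single hword_add mult.assoc)
      then show ?case by (simp only: R_single conj_trace_outer)
    qed (simp_all add: R_add semiring_class.distrib_left semiring_class.distrib_right)
  qed (simp_all add: R_add semiring_class.distrib_left semiring_class.distrib_right)
  note word = this
  show ?thesis
  proof (induction k rule: rpoly_induct)
    case (add q1 q2)
    then show ?case
      unfolding of_rpoly_add R_add by (simp add: semiring_class.distrib_left semiring_class.distrib_right)
  next
    case (scale r q)
    then show ?case unfolding of_rpoly_scaleR R_add by simp
  qed (simp_all add: word R_add)
qed

text \<open>Cyclicity moves the factor \<open>wmono u * rstar r\<close> to the end, and
  \<open>q\<close>, being symmetric, commutes past \<open>wmono (wstar u)\<close>; what results is
  one value of the form localized at \<open>q\<close>.\<close>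

lemma conj_trace_square:
  assumes "moment_rel y" "rstar q = q"
  shows "conj_trace y u (hstar (lpoly p) * lpoly p * of_rpoly q) =
      (\<Sum>s\<leftarrow>sels. qf q [(1, wmono u * rstar (sel_part s p))] y)"
    and "conj_trace y u (of_rpoly q * (hstar (lpoly p) * lpoly p)) =
      (\<Sum>s\<leftarrow>sels. qf q [(1, wmono u * rstar (sel_part s p))] y)"
proof -
  have "qRe (L_y y (wmono u * rstar r * r * q * wmono (wstar u))) = qf q [(1, wmono u * rstar r)] y" for r
  proof -
    have "qRe (L_y y (wmono u * rstar r * r * q * wmono (wstar u))) =
        qRe (L_y y (r * q * wmono (wstar u) * (wmono u * rstar r)))"
      using L_y_cyclic[OF moment_relD(2)[OF assms(1)], of "wmono u * rstar r" "r * q * wmono (wstar u)"]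
      by (simp add: mult.assoc)
    also have "\<dots> = qRe (L_y y (r * wmono (wstar u) * q * (wmono u * rstar r)))"
      by (simp only: L_y_commute_symmetric[OF assms])
    finally show ?thesis by (simp add: qf_def)
  qed
  then show "conj_trace y u (hstar (lpoly p) * lpoly p * of_rpoly q) =
      (\<Sum>s\<leftarrow>sels. qf q [(1, wmono u * rstar (sel_part s p))] y)"
    and "conj_trace y u (of_rpoly q * (hstar (lpoly p) * lpoly p)) =
      (\<Sum>s\<leftarrow>sels. qf q [(1, wmono u * rstar (sel_part s p))] y)"
    by (simp_all only: conj_trace_product[OF moment_relD(2)[OF assms(1)]])
qed

lemma cone_equation_poly:
  assumes "k \<in> set h"
  shows "(\<lambda>y. qRe (c * L_y y (U * k * V))) \<in> cone g h"
proof -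
  have "(\<lambda>y. qRe (c * L_y y (wmono u * k * V))) \<in> cone g h" for u c
  proof (induction V arbitrary: c rule: rpoly_induct)
    case (add p q)
    then show ?case using cone.add by (fastforce simp: algebra_simps)
  next
    case (scale r p)
    then show ?case using scale[of "r *\<^sub>R c"] by simp
  qed (auto intro: cone_0 cone.equation assms)
  then show ?thesis
  proof (induction U arbitrary: c rule: rpoly_induct)
    case (add p q)
    then show ?case using cone.add by (fastforce simp: algebra_simps)
  next
    case (scale r p)
    then show ?case using scale(1)[of "r *\<^sub>R c"] scale(2) by simp
  qed (auto intro: cone_0)
qed

text \<open>The Archimedean identity of the free product is evaluated under
  \<open>conj_trace y u\<close>: squares turn into squares of the cone, equations into equations,
  and the ball polynomial into its conjugate by \<open>u\<close>.\<close>

lemma cone_ball_word: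
  fixes g h :: "('n::finite) rpoly list"
  assumes R: "of_real R - (\<Sum>i\<in>UNIV. hword (letter (Q i) + letter (Qbar i))) \<in> QM g h"
    and g: "\<forall>i<length g. rstar (g ! i) = g ! i"
  shows "(\<lambda>y. R * qRe (y (u + wstar u)) - (\<Sum>i\<in>UNIV. qRe (y (u + letter (Q i) + letter (Qbar i) + wstar u)))) \<in> cone g h"
proof -
  obtain \<sigma>0 \<sigma> T where eq: "of_real R - (\<Sum>i\<in>UNIV. hword (letter (Q i) + letter (Qbar i))) = qm_expr g h \<sigma>0 \<sigma> T"
     "\<sigma>0 \<in> SOS" "\<forall>i<length g. \<sigma> i \<in> SOS"
    using R unfolding QM_def by blast
  obtain ps0 where ps0: "\<sigma>0 = (\<Sum>p\<leftarrow>ps0. hstar (lpoly p) * lpoly p)"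
    using eq(2) by (auto simp: SOS_def)
  have "\<forall>i. \<exists>ps. i < length g \<longrightarrow> \<sigma> i = (\<Sum>p\<leftarrow>ps. hstar (lpoly p) * lpoly p)"
    using eq(3) by (auto simp: SOS_def)
  then obtain ps where ps: "\<And>i. i < length g \<Longrightarrow> \<sigma> i = (\<Sum>p\<leftarrow>ps i. hstar (lpoly p) * lpoly p)"
    by metis
  define E where "E q p = (\<lambda>y. \<Sum>s\<leftarrow>sels. qf q [(1, wmono u * rstar (sel_part s p))] y)" for q p
  \<comment> \<open>An equation term and its adjoint have equal real traces, hence the factor
    2.\<close>
  define H where "H k p p' = (\<lambda>y. \<Sum>s\<leftarrow>sels. qRe (2 * L_y y ((wmono u * sel_part s p) * k * (rstar (sel_part s p') * wmono (wstar u)))))" for k p p'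
  define G where "G = (\<lambda>y. (\<Sum>p\<leftarrow>ps0. E 1 p y) + (\<Sum>i<length g. \<Sum>p\<leftarrow>ps i. E (g ! i) p y) +
     (\<Sum>j<length h. \<Sum>x\<leftarrow>T j. H (h ! j) (fst x) (snd x) y))"
  have "E q p \<in> cone g h" if "q = 1 \<or> q \<in> set g" for q p
    unfolding E_def by (intro cone_sum_list cone.square that)
  moreover have "H k p p' \<in> cone g h" if "k \<in> set h" for k p p'
    unfolding H_def by (intro cone_sum_list cone_equation_poly that)
  ultimately have "G \<in> cone g h"
    unfolding G_def by (intro cone.add cone_sum cone_sum_list) (auto simp: nth_mem)
  then show ?thesis
  proof (rule cone.cong)
    show "lin (\<lambda>y. R * qRe (y (u + wstar u)) - (\<Sum>i\<in>UNIV. qRe (y (u + letter (Q i) + letter (Qbar i) + wstar u))))"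
      by (intro lin_diff lin_scale lin_sum lin_Re_entry)
    fix y :: "'n word \<Rightarrow> quat" assume y: "moment_rel y"
    note cyc = moment_relD(2)[OF y]
    have E: "conj_trace y u (hstar (lpoly p) * lpoly p * of_rpoly q) = E q p y"
      "conj_trace y u (of_rpoly q * (hstar (lpoly p) * lpoly p)) = E q p y" if "rstar q = q" for p q
      unfolding E_def using conj_trace_square[OF y that] by auto
    have H: "conj_trace y u (lpoly p * of_rpoly k * hstar (lpoly p') + lpoly p' * hstar (of_rpoly k) * hstar (lpoly p)) = H k p p' y" for p p' k
    proof -
      have "qRe (L_y y (wmono u * a * rstar k * rstar b * wmono (wstar u))) =
         qRe (L_y y (wmono u * b * k * rstar a * wmono (wstar u)))" for a b
        using L_y_rstar[OF y, of "wmono u * b * k * rstar a * wmono (wstar u)"] by (simp add: mult.assoc)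
      from this[of "sel_part _ p'" "sel_part _ p"] show ?thesis
        unfolding trace_fun_add hstar_of_rpoly conj_trace_equation H_def sels_def mult_2
        by (simp add: mult.assoc)
    qed
    have "conj_trace y u (qm_expr g h \<sigma>0 \<sigma> T) = G y"
    proof -
      have "conj_trace y u \<sigma>0 = (\<Sum>p\<leftarrow>ps0. E 1 p y)"
        using E(1)[OF rstar_1] by (simp add: ps0 trace_fun_sum_list of_rpoly_1)
      moreover have "conj_trace y u (\<sigma> i * of_rpoly (g ! i) + of_rpoly (g ! i) * \<sigma> i) = 2 * (\<Sum>p\<leftarrow>ps i. E (g ! i) p y)"
        if i: "i < length g" for i
      proof -
        have "conj_trace y u (\<sigma> i * of_rpoly (g ! i)) = (\<Sum>p\<leftarrow>ps i. E (g ! i) p y)"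
          using g i by (simp add: ps[OF i] trace_fun_sum_list E flip: sum_list_mult_const)
        moreover have "conj_trace y u (of_rpoly (g ! i) * \<sigma> i) = (\<Sum>p\<leftarrow>ps i. E (g ! i) p y)"
          using g i by (simp add: ps[OF i] trace_fun_sum_list E flip: sum_list_const_mult)
        ultimately show ?thesis by simp
      qed
      ultimately show ?thesis
        by (simp add: qm_expr_def G_def trace_fun_sum trace_fun_sum_list split_def
            H[unfolded trace_fun_add] flip: sum_distrib_left)
    qed
    moreover have "conj_trace y u (of_real R) = R * qRe (y (u + wstar u))"
      using conj_trace_word[OF cyc, of u 0] by (simp add: of_real_def conj_moments_def)
    ultimately show "G y = R * qRe (y (u + wstar u)) - (\<Sum>i\<in>UNIV. qRe (y (u + letter (Q i) + letter (Qbar i) + wstar u)))"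
      unfolding eq(1)[symmetric]
      by (simp add: trace_fun_sum conj_trace_word[OF cyc]) (simp add: conj_moments_def add.assoc)
  qed
qed

lemma cone_word_square: "(\<lambda>y. qRe (y (w + wstar w))) \<in> cone g h"
proof -
  have "qf 1 [(1, wmono (wstar w))] = (\<lambda>y. qRe (y (w + wstar w)))"
    by (simp add: fun_eq_iff qf_def flip: wmono_add)
  then show ?thesis using cone.square[of 1 g "[(1, wmono (wstar w))]" h] by simp
qed

locale archimedean_module =
  fixes g h :: "('n::finite) rpoly list" and R :: real
  assumes R_pos: "0 < R"
    and ball: "of_real R - (\<Sum>i\<in>UNIV. hword (letter (Q i) + letter (Qbar i))) \<in> QM g h"
    and sym: "\<And>q. q \<in> set g \<Longrightarrow> rstar q = q"
begin

lemma cone_word_bound: "(\<lambda>y. R ^ wlen w * qRe (y 0) - qRe (y (w + wstar w))) \<in> cone g h"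
proof (induction w rule: word_snoc_induct)
  case empty
  then show ?case using cone_0 by simp
next
  case (snoc u x)
  let ?S = "\<lambda>i y. qRe (y (u + letter (Q i) + letter (Qbar i) + wstar u))"
  have S: "?S i \<in> cone g h" for i
    using cone_word_square[of "u + letter (Q i)"] by (simp add: add.assoc)
  have x: "qRe (y (u + letter x + wstar (u + letter x))) = ?S (idx x) y" for y :: "'n word \<Rightarrow> quat"
  proof (cases x)
    case (Qbar i)
    have "letter (Qbar i) + (letter (Q i) + w) = letter (Q i) + (letter (Qbar i) + w)" for w
      using letter_bar_commute[of "Qbar i"] by (simp flip: add.assoc)
    then show ?thesis by (simp add: Qbar add.assoc)
  qed (simp add: add.assoc)
  have sum: "(\<Sum>i\<in>UNIV. ?S i y) = ?S (idx x) y + (\<Sum>i\<in>UNIV - {idx x}. ?S i y)" for y :: "'n word \<Rightarrow> quat"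
    by (subst sum.remove[of _ "idx x"]) auto
  have g: "\<forall>i<length g. rstar (g ! i) = g ! i"
    using sym by auto
  \<comment> \<open>Multiply the induction hypothesis by \<open>R\<close>, add the ball inequality
    at \<open>u\<close>, and add back the squares of all letters with an index other than that of
    the last one.\<close>
  have "(\<lambda>y. R * (R ^ wlen u * qRe (y 0) - qRe (y (u + wstar u))) +
      (R * qRe (y (u + wstar u)) - (\<Sum>i\<in>UNIV. ?S i y)) + (\<Sum>i\<in>UNIV - {idx x}. ?S i y)) \<in> cone g h"
    using R_pos by (intro cone.add cone_scale snoc cone_ball_word[OF ball g] cone_sum S) auto
  then show ?case
    unfolding x sum by (simp add: algebra_simps)
qed

lemma cone_order_unit_entry: "\<exists>N. (\<lambda>y. N * qRe (y 0) - qRe (c * y w)) \<in> cone g h"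
proof -
  \<comment> \<open>Completing the square: the norm of \<open>wmono w\<close> minus half the
    conjugate of \<open>c\<close> bounds \<open>qRe (c * y w)\<close> by a constant plus
    \<open>qRe (y (w + wstar w))\<close>, which \<open>cone_word_bound\<close> controls.\<close>
  have "(\<lambda>y. qf 1 [(- (1/2) *\<^sub>R qconj c, 1), (1, wmono w)] y +
      (R ^ wlen w * qRe (y 0) - qRe (y (w + wstar w)))) \<in> cone g h"
    by (intro cone.add cone.square cone_word_bound) auto
  then have "(\<lambda>y. (qnorm2 c / 4 + R ^ wlen w) * qRe (y 0) - qRe (c * y w)) \<in> cone g h"
  proof (rule cone.cong)
    show "lin (\<lambda>y. (qnorm2 c / 4 + R ^ wlen w) * qRe (y 0) - qRe (c * y w))"
      by (intro lin_diff lin_scale lin_Re_entry lin_entry)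
    fix y :: "'n word \<Rightarrow> quat" assume y: "moment_rel y"
    have "qRe (c * y 0 * qconj c) = qnorm2 c * qRe (y 0)"
      using qRe_mult_commute[of "c * y 0" "qconj c"]
      by (simp add: qconj_mult_self flip: mult.assoc) (simp add: of_real_quat_comm mult_of_real_quat)
    moreover have "qRe (qconj (y w) * qconj c) = qRe (c * y w)"
      using quat_sel_conj(1)[of "c * y w"] by simp
    ultimately show "qf 1 [(- (1/2) *\<^sub>R qconj c, 1), (1, wmono w)] y +
      (R ^ wlen w * qRe (y 0) - qRe (y (w + wstar w))) = (qnorm2 c / 4 + R ^ wlen w) * qRe (y 0) - qRe (c * y w)"
      by (simp add: qf_def algebra_simps moment_relD(1)[OF y] wstar_word_commute flip: wmono_add)
  qed
  then show ?thesis by blast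
qed

text \<open>The entry at the empty word is an order unit. This is the form in which boundedness
  enters the construction of extremal states.\<close>

lemma cone_order_unit:
  assumes "lin F"
  shows "\<exists>N. (\<lambda>y. N * qRe (y 0) - F y) \<in> cone g h"
proof -
  obtain xs where F: "F = (\<lambda>y. \<Sum>(c, w)\<leftarrow>xs. qRe (c * y w))"
    using assms by (auto simp: lin_def)
  show ?thesis
    unfolding F
  proof (induction xs)
    case Nil
    then show ?case using cone_0 by (intro exI[of _ 0]) simp
  next
    case (Cons x xs)
    obtain c w where x: "x = (c, w)" by fastforce
    obtain N where N: "(\<lambda>y. N * qRe (y 0) - (\<Sum>(c, w)\<leftarrow>xs. qRe (c * y w))) \<in> cone g h"
      using Cons by blast
    obtain M where "(\<lambda>y. M * qRe (y 0) - qRe (c * y w)) \<in> cone g h"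
      using cone_order_unit_entry by blast
    from cone.add[OF this N] show ?case
      by (intro exI[of _ "M + N"]) (simp add: x algebra_simps)
  qed
qed

end


section \<open>Lexicographically minimal states\<close>

text \<open>Separation without topology: \<open>u\<close> is an order unit for a countable family
  \<open>e\<close>, and a functional is constructed on the span of \<open>e\<close> only.\<close>

locale order_cone =
  fixes C :: "('a \<Rightarrow> real) set" and u :: "'a \<Rightarrow> real" and e :: "nat \<Rightarrow> 'a \<Rightarrow> real"
  assumes zero: "(\<lambda>y. 0) \<in> C"
    and add: "F \<in> C \<Longrightarrow> G \<in> C \<Longrightarrow> (\<lambda>y. F y + G y) \<in> C"
    and scale: "F \<in> C \<Longrightarrow> 0 \<le> t \<Longrightarrow> (\<lambda>y. t * F y) \<in> C"
    and unit: "u \<in> C"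
    and proper: "(\<lambda>y. - u y) \<notin> C"
    and bounded: "\<exists>N. (\<lambda>y. N * u y - e k y) \<in> C \<and> (\<lambda>y. N * u y + e k y) \<in> C"
begin

text \<open>
  Each step minimizes the next functional among the states that minimize all earlier ones;
  \<open>low (lex k) (e k)\<close> is the minimum, and \<open>lex (Suc k)\<close> is dual to the face where it is attained.
\<close>

definition low :: "('a \<Rightarrow> real) set \<Rightarrow> ('a \<Rightarrow> real) \<Rightarrow> real" where
  "low D v = Sup {t. (\<lambda>y. v y - t * u y) \<in> D}"

primrec lex :: "nat \<Rightarrow> ('a \<Rightarrow> real) set" where
  "lex 0 = C"
| "lex (Suc k) = {(\<lambda>y. F y + s * (low (lex k) (e k) * u y - e k y)) | F s. F \<in> lex k \<and> 0 \<le> s}"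

definition m :: "nat \<Rightarrow> real" where
  "m k = low (lex k) (e k)"

lemma lex_Suc: "lex (Suc k) = {(\<lambda>y. F y + s * (m k * u y - e k y)) | F s. F \<in> lex k \<and> 0 \<le> s}"
  by (simp add: m_def)

declare lex.simps(2) [simp del]

lemma lex_add: "F \<in> lex k \<Longrightarrow> G \<in> lex k \<Longrightarrow> (\<lambda>y. F y + G y) \<in> lex k"
proof (induction k arbitrary: F G)
  case (Suc k)
  then obtain F' s G' t where
    "F' \<in> lex k" "0 \<le> s" "F = (\<lambda>y. F' y + s * (m k * u y - e k y))"
    "G' \<in> lex k" "0 \<le> t" "G = (\<lambda>y. G' y + t * (m k * u y - e k y))"
    by (auto simp: lex_Suc)
  then show ?case
    unfolding lex_Suc using Suc.IH[of F' G']
    by (intro CollectI exI[of _ "\<lambda>y. F' y + G' y"] exI[of _ "s + t"]) (auto simp: algebra_simps)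
qed (auto intro: add)

lemma lex_scale: "F \<in> lex k \<Longrightarrow> 0 \<le> t \<Longrightarrow> (\<lambda>y. t * F y) \<in> lex k"
proof (induction k arbitrary: F)
  case (Suc k)
  then obtain F' s where "F' \<in> lex k" "0 \<le> s" "F = (\<lambda>y. F' y + s * (m k * u y - e k y))"
    by (auto simp: lex_Suc)
  then show ?case
    unfolding lex_Suc using Suc
    by (intro CollectI exI[of _ "\<lambda>y. t * F' y"] exI[of _ "t * s"]) (auto simp: algebra_simps)
qed (auto intro: scale)

lemma lex_Suc_mono: "lex k \<subseteq> lex (Suc k)"
  unfolding lex_Suc by (auto intro!: exI[of _ 0])

lemma lex_mono: "j \<le> k \<Longrightarrow> lex j \<subseteq> lex k"
  using lift_Suc_mono_le[of lex] lex_Suc_mono by blast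

lemma C_subset_lex: "C \<subseteq> lex k"
  using lex_mono[of 0 k] by simp

text \<open>The constant \<open>N\<close> bounding \<open>e k\<close> from above also bounds every
  certified \<open>t\<close>: a larger \<open>t\<close> would put a positive multiple of
  \<open>- u\<close> into the cone.\<close>

lemma lower_bounds:
  assumes "(\<lambda>y. - u y) \<notin> lex k"
  shows "{t. (\<lambda>y. e k y - t * u y) \<in> lex k} \<noteq> {}" "bdd_above {t. (\<lambda>y. e k y - t * u y) \<in> lex k}"
proof -
  obtain N where N: "(\<lambda>y. N * u y - e k y) \<in> lex k" "(\<lambda>y. N * u y + e k y) \<in> lex k"
    using bounded[of k] C_subset_lex by blast
  then have "- N \<in> {t. (\<lambda>y. e k y - t * u y) \<in> lex k}"
    by (simp add: add.commute)
  then show "{t. (\<lambda>y. e k y - t * u y) \<in> lex k} \<noteq> {}" by blast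
  have "t \<le> N" if t: "(\<lambda>y. e k y - t * u y) \<in> lex k" for t
  proof (rule ccontr)
    assume "\<not> t \<le> N"
    then have "(\<lambda>y. inverse (t - N) * ((N * u y - e k y) + (e k y - t * u y))) \<in> lex k"
      by (intro lex_scale lex_add N t) auto
    moreover have "inverse (t - N) * ((N * u y - e k y) + (e k y - t * u y)) = - u y" for y
      using \<open>\<not> t \<le> N\<close> by (simp add: field_simps)
    ultimately show False using assms by simp
  qed
  then show "bdd_above {t. (\<lambda>y. e k y - t * u y) \<in> lex k}"
    by (auto simp: bdd_above_def)
qed

text \<open>If \<open>- u\<close> entered at a step with weight \<open>s\<close>, dividing by
  \<open>s\<close> would certify the lower bound \<open>m k + inverse s\<close> for
  \<open>e k\<close>, beyond the supremum \<open>m k\<close>.\<close>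

lemma lex_proper: "(\<lambda>y. - u y) \<notin> lex k"
proof (induction k)
  case 0
  then show ?case using proper by simp
next
  case (Suc k)
  show ?case
  proof
    assume "(\<lambda>y. - u y) \<in> lex (Suc k)"
    then obtain F s where F: "F \<in> lex k" "0 \<le> s" "\<And>y. - u y = F y + s * (m k * u y - e k y)"
      by (auto simp: lex_Suc fun_eq_iff)
    have "s \<noteq> 0"
    proof
      assume "s = 0"
      then have "F = (\<lambda>y. - u y)" using F(3) by (simp add: fun_eq_iff)
      then show False using F(1) Suc by simp
    qed
    then have s: "s > 0" using F(2) by simp
    have "inverse s * F y = e k y - (m k + inverse s) * u y" for y
    proof -
      have F': "F y = s * e k y - s * m k * u y - u y"
        using F(3)[of y] by (simp add: algebra_simps)
      show ?thesis unfolding F' using s by (simp add: field_simps)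
    qed
    then have "(\<lambda>y. e k y - (m k + inverse s) * u y) \<in> lex k"
      using lex_scale[OF F(1), of "inverse s"] s by simp
    then have "m k + inverse s \<le> m k"
      unfolding m_def low_def using lower_bounds[OF Suc] by (intro cSup_upper) auto
    then show False using s by simp
  qed
qed

text \<open>The supremum \<open>m k\<close> itself may fail to be a certified bound, because the
  cones are not assumed to be closed; every smaller number is one.\<close>

lemma below_m:
  assumes "t < m k"
  shows "(\<lambda>y. e k y - t * u y) \<in> lex k"
proof -
  obtain t' where t': "t < t'" "(\<lambda>y. e k y - t' * u y) \<in> lex k"
    using less_cSupD[OF lower_bounds(1)[OF lex_proper], of t k] assms
    by (auto simp: m_def low_def)
  have "u \<in> lex k" using unit C_subset_lex by blast
  then have "(\<lambda>y. (e k y - t' * u y) + (t' - t) * u y) \<in> lex k"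
    using t' by (intro lex_add lex_scale) auto
  then show ?thesis by (simp add: algebra_simps)
qed

definition lim :: "('a \<Rightarrow> real) set" where
  "lim = (\<Union>k. lex k)"

lemma C_subset_lim: "C \<subseteq> lim"
  using C_subset_lex unfolding lim_def by blast

lemma lim_add: "F \<in> lim \<Longrightarrow> G \<in> lim \<Longrightarrow> (\<lambda>y. F y + G y) \<in> lim"
proof -
  assume "F \<in> lim" "G \<in> lim"
  then obtain j k where "F \<in> lex j" "G \<in> lex k" by (auto simp: lim_def)
  then have "F \<in> lex (max j k)" "G \<in> lex (max j k)"
    using lex_mono[of j "max j k"] lex_mono[of k "max j k"] by auto
  then show ?thesis unfolding lim_def using lex_add by blast
qed

lemma lim_scale: "F \<in> lim \<Longrightarrow> 0 \<le> t \<Longrightarrow> (\<lambda>y. t * F y) \<in> lim"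
  unfolding lim_def using lex_scale by blast

lemma lim_unit: "0 \<le> t \<Longrightarrow> (\<lambda>y. t * u y) \<in> lim"
  using unit C_subset_lim by (intro lim_scale) auto

lemma lim_unit_iff: "(\<lambda>y. t * u y) \<in> lim \<longleftrightarrow> 0 \<le> t"
proof
  assume *: "(\<lambda>y. t * u y) \<in> lim"
  show "0 \<le> t"
  proof (rule ccontr)
    assume "\<not> 0 \<le> t"
    then have "(\<lambda>y. inverse (- t) * (t * u y)) \<in> lim"
      by (intro lim_scale[OF *]) auto
    moreover have "inverse (- t) * (t * u y) = - u y" for y
      using \<open>\<not> 0 \<le> t\<close> by simp
    ultimately have "(\<lambda>y. - u y) \<in> lim" by (simp only:)
    then show False using lex_proper by (simp add: lim_def)
  qed
qed (rule lim_unit)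

text \<open>The value of the minimal state on a combination of the \<open>e k\<close>. It is a
  relation because the \<open>e k\<close> may be linearly dependent; that the value is well defined
  is a consequence of positivity, in \<open>rep_unique\<close>.\<close>

definition rep :: "('a \<Rightarrow> real) \<Rightarrow> real \<Rightarrow> bool" where
  "rep F r \<longleftrightarrow> (\<exists>n a. F = (\<lambda>y. \<Sum>k<n. a k * e k y) \<and> r = (\<Sum>k<n. a k * m k))"

lemma rep_0: "rep (\<lambda>y. 0) 0"
  unfolding rep_def by (intro exI[of _ 0]) simp

lemma rep_extend:
  assumes "rep F r"
  shows "\<exists>n0. \<forall>n\<ge>n0. \<exists>a. F = (\<lambda>y. \<Sum>k<n. a k * e k y) \<and> r = (\<Sum>k<n. a k * m k)"
proof -
  obtain n0 a where a: "F = (\<lambda>y. \<Sum>k<n0. a k * e k y)" "r = (\<Sum>k<n0. a k * m k)"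
    using assms by (auto simp: rep_def)
  have "(\<Sum>k<n0. a k * x k) = (\<Sum>k<n. (if k < n0 then a k else 0) * x k)" if "n \<ge> n0" for n and x :: "nat \<Rightarrow> real"
    using that by (intro sum.mono_neutral_cong_left) auto
  note ext = this
  show ?thesis
  proof (intro exI[of _ n0] allI impI)
    fix n assume n: "n0 \<le> n"
    show "\<exists>a. F = (\<lambda>y. \<Sum>k<n. a k * e k y) \<and> r = (\<Sum>k<n. a k * m k)"
      unfolding a by (intro exI[of _ "\<lambda>k. if k < n0 then a k else 0"]) (simp only: ext[OF n])
  qed
qed

lemma rep_add: "rep F r \<Longrightarrow> rep G s \<Longrightarrow> rep (\<lambda>y. F y + G y) (r + s)"
proof -
  assume "rep F r" "rep G s"
  obtain n1 where n1: "\<forall>n\<ge>n1. \<exists>a. F = (\<lambda>y. \<Sum>k<n. a k * e k y) \<and> r = (\<Sum>k<n. a k * m k)"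
    using rep_extend[OF \<open>rep F r\<close>] by blast
  obtain n2 where n2: "\<forall>n\<ge>n2. \<exists>a. G = (\<lambda>y. \<Sum>k<n. a k * e k y) \<and> s = (\<Sum>k<n. a k * m k)"
    using rep_extend[OF \<open>rep G s\<close>] by blast
  obtain a where "F = (\<lambda>y. \<Sum>k<max n1 n2. a k * e k y)" "r = (\<Sum>k<max n1 n2. a k * m k)"
    using n1 max.cobounded1[of n1 n2] by blast
  moreover obtain b where "G = (\<lambda>y. \<Sum>k<max n1 n2. b k * e k y)" "s = (\<Sum>k<max n1 n2. b k * m k)"
    using n2 max.cobounded2[of n2 n1] by blast
  ultimately show ?thesis
    unfolding rep_def
    by (intro exI[of _ "max n1 n2"] exI[of _ "\<lambda>k. a k + b k"]) (simp add: sum.distrib algebra_simps)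
qed

lemma rep_scale: "rep F r \<Longrightarrow> rep (\<lambda>y. t * F y) (t * r)"
proof -
  assume "rep F r"
  then obtain n a where "F = (\<lambda>y. \<Sum>k<n. a k * e k y)" "r = (\<Sum>k<n. a k * m k)"
    by (auto simp: rep_def)
  then show ?thesis
    unfolding rep_def
    by (intro exI[of _ n] exI[of _ "\<lambda>k. t * a k"]) (simp add: sum_distrib_left mult.assoc)
qed

lemma rep_basis: "rep (e k) (m k)"
proof -
  have "(\<Sum>j<Suc k. (if j = k then 1 else 0) * x j) = x k" for x :: "nat \<Rightarrow> real"
    by simp
  then show ?thesis
    unfolding rep_def by (intro exI[of _ "Suc k"] exI[of _ "\<lambda>j. if j = k then 1 else 0"]) auto
qed

text \<open>A nonnegative coefficient uses the generator adjoined at step \<open>k\<close>, a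
  negative one the bounds strictly below \<open>m k\<close>; the latter are what makes the slack
  necessary.\<close>

lemma rep_lim:
  assumes "rep F r" "0 < \<delta>"
  shows "(\<lambda>y. (r + \<delta>) * u y - F y) \<in> lim"
proof -
  obtain n a where a: "F = (\<lambda>y. \<Sum>k<n. a k * e k y)" "r = (\<Sum>k<n. a k * m k)"
    using assms(1) by (auto simp: rep_def)
  have one: "(\<lambda>y. (a k * m k + \<delta>) * u y - a k * e k y) \<in> lim" if "0 < \<delta>" for k \<delta>
  proof (cases "0 \<le> a k")
    case True
    have "(\<lambda>y. m k * u y - e k y) \<in> lex (Suc k)"
      unfolding lex_Suc using zero C_subset_lex
      by (intro CollectI exI[of _ "\<lambda>y. 0"] exI[of _ 1]) auto
    then have "(\<lambda>y. m k * u y - e k y) \<in> lim" unfolding lim_def by blast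
    then have "(\<lambda>y. a k * (m k * u y - e k y) + \<delta> * u y) \<in> lim"
      using True that by (intro lim_add lim_scale lim_unit) auto
    then show ?thesis by (simp add: algebra_simps)
  next
    case False
    \<comment> \<open>The slack is divided by \<open>- a k\<close> beforehand, so that it becomes
      \<open>\<delta>\<close> after scaling.\<close>
    then have "(\<lambda>y. e k y - (m k - \<delta> / - a k) * u y) \<in> lex k"
      using that by (intro below_m) (simp add: divide_pos_neg)
    then have "(\<lambda>y. e k y - (m k - \<delta> / - a k) * u y) \<in> lim" unfolding lim_def by blast
    then have "(\<lambda>y. - a k * (e k y - (m k - \<delta> / - a k) * u y)) \<in> lim"
      using False by (intro lim_scale) auto
    moreover have "- a k * (e k y - (m k - \<delta> / - a k) * u y) = (a k * m k + \<delta>) * u y - a k * e k y" for y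
      using False by (simp add: field_simps)
    ultimately show ?thesis by simp
  qed
  have "(\<lambda>y. ((\<Sum>k<n. a k * m k) + \<delta>) * u y - (\<Sum>k<n. a k * e k y)) \<in> lim" if "0 < \<delta>" for \<delta>
    using that
  proof (induction n arbitrary: \<delta>)
    case 0
    then show ?case using lim_unit[of \<delta>] by simp
  next
    case (Suc n)
    have "(\<lambda>y. (((\<Sum>k<n. a k * m k) + \<delta> / 2) * u y - (\<Sum>k<n. a k * e k y)) +
       ((a n * m n + \<delta> / 2) * u y - a n * e n y)) \<in> lim"
      using Suc by (intro lim_add one) auto
    moreover have "((\<Sum>k<n. a k * m k) + \<delta> / 2) * u y - (\<Sum>k<n. a k * e k y) +
       ((a n * m n + \<delta> / 2) * u y - a n * e n y) =
       ((\<Sum>k<Suc n. a k * m k) + \<delta>) * u y - (\<Sum>k<Suc n. a k * e k y)" for y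
      by (simp add: field_simps)
    ultimately show ?case by (simp only:)
  qed
  then show ?thesis using a assms(2) by simp
qed

lemma rep_nonneg:
  assumes "rep F r" "F \<in> C"
  shows "0 \<le> r"
proof (rule field_le_epsilon)
  fix \<delta> :: real assume "0 < \<delta>"
  have "F \<in> lim" using assms(2) C_subset_lim by blast
  then have "(\<lambda>y. ((r + \<delta>) * u y - F y) + F y) \<in> lim"
    by (intro lim_add rep_lim assms \<open>0 < \<delta>\<close>)
  then show "0 \<le> r + \<delta>" by (simp add: lim_unit_iff)
qed

lemma rep_unique:
  assumes "rep F r" "rep F s"
  shows "r = s"
proof -
  have "rep (\<lambda>y. 0) (r - s)" "rep (\<lambda>y. 0) (s - r)"
    using rep_add[OF assms(1) rep_scale[OF assms(2), of "-1"]]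
      rep_add[OF assms(2) rep_scale[OF assms(1), of "-1"]] by simp_all
  then have "0 \<le> r - s" "0 \<le> s - r"
    using rep_nonneg zero by blast+
  then show ?thesis by simp
qed

lemma rep_unit:
  assumes "rep u r"
  shows "r = 1"
proof -
  have 1: "1 \<le> r + \<delta>" if "0 < \<delta>" for \<delta>
  proof -
    have "(\<lambda>y. (r + \<delta> - 1) * u y) \<in> lim"
      using rep_lim[OF assms that] by (simp add: algebra_simps)
    then show ?thesis by (simp add: lim_unit_iff)
  qed
  have 2: "r \<le> 1 + \<delta>" if "0 < \<delta>" for \<delta>
  proof -
    have "(\<lambda>y. (- r + \<delta> + 1) * u y) \<in> lim"
      using rep_lim[OF rep_scale[OF assms, of "-1"] that] by (simp add: algebra_simps)
    then show ?thesis by (simp add: lim_unit_iff)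
  qed
  show ?thesis
    by (rule antisym; rule field_le_epsilon; rule 1 2)
qed

text \<open>States on the current face satisfy \<open>m k \<le> e k y\<close>, while a proper convex
  combination of the two attains \<open>m k\<close>; so both attain it and lie on the next
  face.\<close>

lemma extremal:
  assumes pos: "\<And>F. F \<in> C \<Longrightarrow> 0 \<le> F y1" "\<And>F. F \<in> C \<Longrightarrow> 0 \<le> F y2"
    and unit: "u y1 = 1" "u y2 = 1" and \<alpha>: "0 < \<alpha>" "\<alpha> < 1"
    and conv: "\<And>k. m k = \<alpha> * e k y1 + (1 - \<alpha>) * e k y2"
  shows "e k y1 = m k"
proof -
  have eq: "e k y1 = m k \<and> e k y2 = m k" if "\<forall>F\<in>lex k. 0 \<le> F y1 \<and> 0 \<le> F y2" for k
  proof -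
    have "t \<le> e k y1 \<and> t \<le> e k y2" if "t < m k" for t
      using below_m[OF that] \<open>\<forall>F\<in>lex k. _\<close> unit by fastforce
    then have ge: "m k \<le> e k y1" "m k \<le> e k y2"
      by (auto intro: dense_ge simp: dense_le)
    have "\<alpha> * (e k y1 - m k) + (1 - \<alpha>) * (e k y2 - m k) = 0"
      using conv[of k] by (simp add: algebra_simps)
    moreover have "0 \<le> \<alpha> * (e k y1 - m k)" "0 \<le> (1 - \<alpha>) * (e k y2 - m k)"
      using ge \<alpha> by auto
    ultimately have "\<alpha> * (e k y1 - m k) = 0 \<and> (1 - \<alpha>) * (e k y2 - m k) = 0"
      by linarith
    then show ?thesis using \<alpha> by simp
  qed
  have "\<forall>F\<in>lex k. 0 \<le> F y1 \<and> 0 \<le> F y2" for k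
  proof (induction k)
    case 0
    then show ?case using pos by simp
  next
    case (Suc k)
    then show ?case using eq[OF Suc] unit by (auto simp: lex_Suc)
  qed
  then show ?thesis using eq by blast
qed

end


section \<open>Extremal states of the cone\<close>

definition state :: "'n rpoly list \<Rightarrow> 'n rpoly list \<Rightarrow> ('n word \<Rightarrow> quat) \<Rightarrow> bool" where
  "state g h y \<longleftrightarrow> (\<forall>F\<in>cone g h. 0 \<le> F y) \<and> qRe (y 0) = 1"

definition extremal_state :: "'n rpoly list \<Rightarrow> 'n rpoly list \<Rightarrow> ('n word \<Rightarrow> quat) \<Rightarrow> bool" where
  "extremal_state g h y \<longleftrightarrow> state g h y \<and>
     (\<forall>y1 y2 \<alpha>. state g h y1 \<longrightarrow> state g h y2 \<longrightarrow> 0 < \<alpha> \<longrightarrow> \<alpha> < 1 \<longrightarrow>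
        (\<forall>w. y w = \<alpha> *\<^sub>R y1 w + (1 - \<alpha>) *\<^sub>R y2 w) \<longrightarrow> y1 = y)"

instance letter :: (countable) countable
  by countable_datatype

lemma countable_words: "countable (UNIV :: ('n::finite) word set)"
proof -
  have "(UNIV :: 'n word set) = abs_word ` UNIV"
    using abs_word_cases by auto
  then show ?thesis by (metis countable_image countableI_type)
qed

definition qunits :: "quat set" where
  "qunits = {1, Quat 0 1 0 0, Quat 0 0 1 0, Quat 0 0 0 1}"

lemma extremal_state_exists:
  fixes g h :: "('n::finite) rpoly list"
  assumes order_unit: "\<And>F. lin F \<Longrightarrow> \<exists>N. (\<lambda>y. N * qRe (y 0) - F y) \<in> cone g h"
    and f: "lin f" "(\<lambda>y. f y - l * qRe (y 0)) \<notin> cone g h"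
  shows "\<exists>y. extremal_state g h y \<and> f y \<le> l"
proof -
  define u :: "('n word \<Rightarrow> quat) \<Rightarrow> real" where "u = (\<lambda>y. qRe (y 0))"
  define E :: "(('n word \<Rightarrow> quat) \<Rightarrow> real) set" where "E = (\<lambda>(c, w) y. qRe (c * y w)) ` (qunits \<times> UNIV)"
  \<comment> \<open>The objective comes first, so that it is minimized before any entry of the
    sequence; this yields \<open>f y \<le> l\<close> in the end.\<close>
  define e where "e = case_nat f (from_nat_into E)"
  have "countable E"
    unfolding E_def qunits_def
    by (intro countable_image countable_SIGMA countable_words) (auto intro: countable_finite)
  moreover have "E \<noteq> {}" by (simp add: E_def qunits_def)
  ultimately have E: "range (from_nat_into E) = E"
    by (intro range_from_nat_into)
  have lin_e: "lin (e k)" for k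
  proof (cases k)
    case (Suc j)
    then have "e k \<in> E" using E by (auto simp: e_def)
    then show ?thesis by (auto simp: E_def intro: lin_entry)
  qed (simp add: e_def f)
  have unit: "u \<in> cone g h"
  proof -
    have "qf 1 [(1, 1)] \<in> cone g h" by (rule cone.square) simp
    then show ?thesis by (simp add: u_def qf_def[abs_def])
  qed
  have unit_ge: "\<exists>N\<ge>N0. (\<lambda>y. N * u y - F y) \<in> cone g h" if "lin F" for F N0
  proof -
    obtain N where N: "(\<lambda>y. N * u y - F y) \<in> cone g h"
      using order_unit[OF \<open>lin F\<close>] by (auto simp: u_def)
    have "(\<lambda>y. (N * u y - F y) + max 0 (N0 - N) * u y) \<in> cone g h"
      by (intro cone.add cone_scale N unit) auto
    then show ?thesis
      by (intro exI[of _ "N + max 0 (N0 - N)"]) (auto simp: algebra_simps)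
  qed
  have lin_neg: "lin (\<lambda>y. - F y)" if "lin F" for F :: "('n word \<Rightarrow> quat) \<Rightarrow> real"
    using lin_scale[OF that, of "-1"] by simp
  have proper: "(\<lambda>y. - u y) \<notin> cone g h"
  proof
    assume neg: "(\<lambda>y. - u y) \<in> cone g h"
    \<comment> \<open>Adding the nonnegative multiple \<open>N + l\<close> of \<open>- u\<close> to
      \<open>N * u + f\<close> would give the excluded functional \<open>f - l * u\<close>.\<close>
    obtain N where N: "N \<ge> - l" "(\<lambda>y. N * u y - - f y) \<in> cone g h"
      using unit_ge[OF lin_neg[OF f(1)]] by blast
    then have "(\<lambda>y. (N * u y - - f y) + (N + l) * (- u y)) \<in> cone g h"
      using neg by (intro cone.add cone_scale) auto
    then show False using f(2) by (simp add: u_def algebra_simps)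
  qed
  have bounded: "\<exists>N. (\<lambda>y. N * u y - e k y) \<in> cone g h \<and> (\<lambda>y. N * u y + e k y) \<in> cone g h" for k
  proof -
    obtain N where N: "(\<lambda>y. N * u y - e k y) \<in> cone g h" using unit_ge[OF lin_e] by blast
    obtain M where M: "M \<ge> N" "(\<lambda>y. M * u y - - e k y) \<in> cone g h"
      using unit_ge[OF lin_neg[OF lin_e]] by blast
    have "(\<lambda>y. (N * u y - e k y) + (M - N) * u y) \<in> cone g h"
      using M by (intro cone.add cone_scale N unit) auto
    then show ?thesis using M by (intro exI[of _ M]) (simp add: algebra_simps)
  qed
  interpret order_cone "cone g h" u e
    by unfold_locales (fact cone_0 cone.add cone_scale unit proper bounded)+
  have "\<exists>r. rep (\<lambda>z. qRe (c * z w)) r" if "c \<in> qunits" for c w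
  proof -
    have "(\<lambda>z. qRe (c * z w)) \<in> E" using that by (force simp: E_def)
    then obtain j where "from_nat_into E j = (\<lambda>z. qRe (c * z w))" using E by (metis imageE)
    then show ?thesis using rep_basis[of "Suc j"] by (auto simp: e_def)
  qed
  then obtain M where M: "\<And>c w. c \<in> qunits \<Longrightarrow> rep (\<lambda>z. qRe (c * z w)) (M c w)"
    by metis
  \<comment> \<open>The signs come from \<open>qRe (Quat 0 1 0 0 * x) = - qI x\<close> and its
    analogues for the other two units.\<close>
  define y where "y = (\<lambda>w. Quat (M 1 w) (- M (Quat 0 1 0 0) w) (- M (Quat 0 0 1 0) w) (- M (Quat 0 0 0 1) w))"
  have rep_entry: "rep (\<lambda>z. qRe (c * z w)) (qRe (c * y w))" for c w
  proof -
    have 1: "qRe (c * x) = qRe c * qRe (1 * x) + qI c * qRe (Quat 0 1 0 0 * x) +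
        qJ c * qRe (Quat 0 0 1 0 * x) + qK c * qRe (Quat 0 0 0 1 * x)" for x
      by (simp add: quat_sel_mult)
    have "qRe (1 * y w) = M 1 w" "qRe (Quat 0 1 0 0 * y w) = M (Quat 0 1 0 0) w"
      "qRe (Quat 0 0 1 0 * y w) = M (Quat 0 0 1 0) w" "qRe (Quat 0 0 0 1 * y w) = M (Quat 0 0 0 1) w"
      by (simp_all add: y_def quat_sel_mult)
    then show ?thesis
      unfolding 1 by (simp only:) (intro rep_add rep_scale M, simp_all add: qunits_def)
  qed
  have rep_lin: "rep F (F y)" if F: "lin F" for F
  proof -
    obtain xs where "F = (\<lambda>y. \<Sum>(c, w)\<leftarrow>xs. qRe (c * y w))"
      using F by (auto simp: lin_def)
    moreover have "rep (\<lambda>z. \<Sum>(c, w)\<leftarrow>xs. qRe (c * z w)) (\<Sum>(c, w)\<leftarrow>xs. qRe (c * y w))"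
      by (induction xs) (auto intro: rep_0 rep_add rep_entry)
    ultimately show ?thesis by simp
  qed
  have m: "e k y = m k" for k
    using rep_unique[OF rep_lin[OF lin_e] rep_basis] .
  have st: "state g h y"
    unfolding state_def
  proof (intro conjI ballI)
    fix F assume "F \<in> cone g h"
    then show "0 \<le> F y" using rep_nonneg rep_lin lin_cone by blast
  next
    show "qRe (y 0) = 1"
      using rep_unit[OF rep_lin[OF lin_cone[OF unit]]] by (simp add: u_def)
  qed
  moreover have "y1 = y" if y12: "state g h y1" "state g h y2" "0 < \<alpha>" "\<alpha> < 1"
    and conv: "\<forall>w. y w = \<alpha> *\<^sub>R y1 w + (1 - \<alpha>) *\<^sub>R y2 w" for y1 y2 \<alpha>
  proof
    fix w
    have "y = (\<lambda>w. \<alpha> *\<^sub>R y1 w + (1 - \<alpha>) *\<^sub>R y2 w)" using conv by auto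
    then have "m k = \<alpha> * e k y1 + (1 - \<alpha>) * e k y2" for k
      using lin_apply_add[OF lin_e] lin_apply_scale[OF lin_e] m by metis
    then have ek: "e k y1 = e k y" for k
      unfolding m using y12 by (intro extremal[of y1 y2 \<alpha>]) (auto simp: state_def u_def)
    have "qRe (c * y1 w) = qRe (c * y w)" if "c \<in> qunits" for c
    proof -
      have "(\<lambda>z. qRe (c * z w)) \<in> E" using that by (force simp: E_def)
      then obtain j where "from_nat_into E j = (\<lambda>z. qRe (c * z w))" using E by (metis imageE)
      then show ?thesis using ek[of "Suc j"] by (simp add: e_def)
    qed
    from this[of 1] this[of "Quat 0 1 0 0"] this[of "Quat 0 0 1 0"] this[of "Quat 0 0 0 1"]
    show "y1 w = y w"
      by (simp add: qunits_def quat_sel_mult quat_eq_iff)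
  qed
  ultimately have "extremal_state g h y"
    unfolding extremal_state_def by blast
  moreover have "f y \<le> l"
  proof -
    have "l \<ge> m 0"
    proof (rule ccontr)
      assume "\<not> l \<ge> m 0"
      then have "(\<lambda>y. e 0 y - l * u y) \<in> lex 0" by (intro below_m) simp
      then have "(\<lambda>y. f y - l * qRe (y 0)) \<in> cone g h"
        unfolding lex.simps(1) by (simp add: e_def u_def)
      then show False using f(2) by simp
    qed
    then show ?thesis using m[of 0] by (simp add: e_def)
  qed
  ultimately show ?thesis by blast
qed


section \<open>Extremal states are multiplicative on traces\<close>

text \<open>By rule \<open>cong\<close>, applied to the zero functional, both \<open>G\<close> and
  its negative belong to the cone.\<close>

lemma state_vanish:
  assumes "state g h y" "lin G" "\<And>z. moment_rel z \<Longrightarrow> G z = 0"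
  shows "G y = 0"
proof -
  have "G \<in> cone g h"
    by (rule cone.cong[OF cone_0 assms(2)]) (simp add: assms(3))
  moreover have "(\<lambda>y. (-1) * G y) \<in> cone g h"
    by (rule cone.cong[OF cone_0 lin_scale[OF assms(2)]]) (simp add: assms(3))
  ultimately have "0 \<le> G y" "0 \<le> - G y"
    using assms(1) by (auto simp: state_def)
  then show ?thesis by simp
qed

lemma state_moment_rel:
  assumes "state g h y"
  shows "moment_rel y"
  unfolding moment_rel_def
proof (intro conjI allI)
  fix w
  show "y (wstar w) = qconj (y w)"
  proof (rule quat_eqI_Re)
    fix c
    have *: "qRe (c * qconj x) = qRe (qconj c * x)" for x
      using quat_sel_conj(1)[of "c * qconj x"] qRe_mult_commute[of x "qconj c"] by simp
    have "qRe (c * y (wstar w)) - qRe (qconj c * y w) = 0"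
      by (rule state_vanish[OF assms], intro lin_diff lin_entry) (simp add: moment_relD(1) *)
    then show "qRe (c * y (wstar w)) = qRe (c * qconj (y w))" by (simp add: *)
  qed
next
  show "cyclic y"
    unfolding cyclic_def
  proof (intro allI)
    fix u v
    have "qRe (y (u + v)) - qRe (y (v + u)) = 0"
      by (rule state_vanish[OF assms], intro lin_diff lin_Re_entry)
        (use moment_relD(2) in \<open>auto simp: cyclic_def\<close>)
    then show "qRe (y (u + v)) = qRe (y (v + u))" by simp
  qed
next
  fix u w v i
  show "y (u + w + letter (Q i) + v) + y (u + wstar w + letter (Q i) + v) =
        y (u + letter (Q i) + w + v) + y (u + letter (Q i) + wstar w + v)"
  proof (rule quat_eqI_Re)
    fix c
    have "(qRe (c * y (u + w + letter (Q i) + v)) + qRe (c * y (u + wstar w + letter (Q i) + v))) -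
        (qRe (c * y (u + letter (Q i) + w + v)) + qRe (c * y (u + letter (Q i) + wstar w + v))) = 0"
    proof (rule state_vanish[OF assms], intro lin_diff lin_add lin_entry)
      fix z :: "'a word \<Rightarrow> quat" assume z: "moment_rel z"
      show "(qRe (c * z (u + w + letter (Q i) + v)) + qRe (c * z (u + wstar w + letter (Q i) + v))) -
        (qRe (c * z (u + letter (Q i) + w + v)) + qRe (c * z (u + letter (Q i) + wstar w + v))) = 0"
        using arg_cong[OF moment_relD(3)[OF z, of u w i v], of "\<lambda>x. qRe (c * x)"]
        by (simp add: semiring_class.distrib_left)
    qed
    then show "qRe (c * (y (u + w + letter (Q i) + v) + y (u + wstar w + letter (Q i) + v))) =
        qRe (c * (y (u + letter (Q i) + w + v) + y (u + letter (Q i) + wstar w + v)))"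
      by (simp add: semiring_class.distrib_left)
  qed
qed

lemma stateD:
  assumes "state g h y"
  shows "y 0 = 1" "q = 1 \<or> q \<in> set g \<Longrightarrow> 0 \<le> qf q xs y" "k \<in> set h \<Longrightarrow> L_y y (U * k * V) = 0"
proof -
  have "y 0 = of_real (qRe (y 0))"
    using moment_relD(1)[OF state_moment_rel[OF assms], of 0] by (simp flip: qconj_eq_iff_real)
  then show "y 0 = 1" using assms by (simp add: state_def)
  show "0 \<le> qf q xs y" if "q = 1 \<or> q \<in> set g"
    using assms cone.square[OF that] by (auto simp: state_def)
  show "L_y y (U * k * V) = 0" if k: "k \<in> set h"
  proof (rule quat_eqI_Re)
    fix c
    have "0 \<le> qRe (c * L_y y (U * k * V))" for c
      using assms cone_equation_poly[OF k, of c U V g] by (auto simp: state_def)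
    from this[of c] this[of "- c"] show "qRe (c * L_y y (U * k * V)) = qRe (c * 0)"
      by simp
  qed
qed

lemma stateI:
  assumes "moment_rel y" "qRe (y 0) = 1"
    and "\<And>q xs. q = 1 \<or> q \<in> set g \<Longrightarrow> 0 \<le> qf q xs y"
    and "\<And>k u v. k \<in> set h \<Longrightarrow> L_y y (wmono u * k * wmono v) = 0"
  shows "state g h y"
  unfolding state_def
proof (intro conjI ballI)
  fix F assume "F \<in> cone g h"
  then show "0 \<le> F y"
  proof (induction rule: cone.induct)
    case (cong F G)
    then show ?case using assms(1) by metis
  qed (use assms in auto)
qed (rule assms(2))

section \<open>Calculus of the quadratic forms and a growth lemma\<close>

lemma qf_poly_simps:
  "qf (p + q) xs y = qf p xs y + qf q xs y"
  "qf (r *\<^sub>R q) xs y = r * qf q xs y"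
  by (simp_all add: qf_eq_Re semiring_class.distrib_left semiring_class.distrib_right split_def
      sum_list_addf sum_list_const_mult)

lemma qf_poly_diff: "qf (p - q) xs y = qf p xs y - qf q xs y"
  using qf_poly_simps(1)[of p "(-1) *\<^sub>R q"] qf_poly_simps(2)[of "-1" q] by simp

lemma qf_seq_simps:
  "qf q xs (\<lambda>w. y w + z w) = qf q xs y + qf q xs z"
  "qf q xs (\<lambda>w. r *\<^sub>R y w) = r * qf q xs y"
  using lin_apply_add[OF lin_qf] lin_apply_scale[OF lin_qf] by blast+

definition shift :: "'n rpoly \<Rightarrow> (quat \<times> 'n rpoly) list \<Rightarrow> (quat \<times> 'n rpoly) list" where
  "shift b xs = map (\<lambda>(a, U). (a, b * U)) xs"

lemma qf_shift: "qf q (shift b xs) y = qf (rstar b * q * b) xs y"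
  by (simp add: qf_def shift_def split_def comp_def mult.assoc)

lemma qf_cong:
  assumes "\<And>a U b V. (a, U) \<in> set xs \<Longrightarrow> (b, V) \<in> set xs \<Longrightarrow> L_y y (rstar U * p * V) = L_y z (rstar U * q * V)"
  shows "qf p xs y = qf q xs z"
  unfolding qf_def
  by (intro arg_cong[where f = qRe] arg_cong[where f = sum_list] map_cong refl)
    (auto intro!: arg_cong[where f = sum_list] simp: assms)

lemma qf_append_scaled:
  "qf q (xs @ map (\<lambda>(a, U). (t *\<^sub>R a, U)) (shift b xs)) y =
    qf q xs y + t * (qf (q * b) xs y + qf (rstar b * q) xs y) + t\<^sup>2 * qf (rstar b * q * b) xs y"
  by (simp add: qf_eq_Re shift_def split_def comp_def sum_list_addf sum_list_const_mult
      algebra_simps power2_eq_square)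

lemma quadratic_nonneg_discriminant:
  fixes a b c :: real
  assumes "\<And>t. 0 \<le> a + t * (2 * b) + t\<^sup>2 * c" "0 \<le> c"
  shows "b\<^sup>2 \<le> a * c"
proof (cases "c = 0")
  case True
  have "b = 0"
  proof (rule ccontr)
    assume "b \<noteq> 0"
    \<comment> \<open>At this \<open>t\<close> the expression takes the value -1.\<close>
    then show False using assms(1)[of "- (a + 1) / (2 * b)"] True by (simp add: field_simps)
  qed
  then show ?thesis using True by simp
next
  case False
  then have c: "0 < c" using assms(2) by simp
  have "0 \<le> c * (a + (- b / c) * (2 * b) + (- b / c)\<^sup>2 * c)"
    using c assms(1)[of "- b / c"] by (intro mult_nonneg_nonneg) auto
  also have "\<dots> = a * c - b\<^sup>2"
    using c by (simp add: field_simps power2_eq_square)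
  finally show ?thesis by simp
qed

text \<open>A spectral radius argument: if the ratio \<open>x\<close> of \<open>s 1\<close> to
  \<open>\<rho> * s 0\<close> exceeded one, iterating the inequality along powers of two would make
  \<open>s (2 ^ k)\<close> at least \<open>s 0 * (\<rho> * x) ^ (2 ^ k)\<close>, which outgrows
  every multiple of \<open>\<rho> ^ (2 ^ k)\<close>.\<close>

lemma doubling_growth:
  fixes s :: "nat \<Rightarrow> real"
  assumes sq: "\<And>m. (s m)\<^sup>2 \<le> s 0 * s (2 * m)" and s0: "0 \<le> s 0"
    and growth: "\<And>m. \<bar>s m\<bar> \<le> c * \<rho> ^ m" and \<rho>: "0 < \<rho>"
  shows "s 1 \<le> \<rho> * s 0"
proof (rule ccontr)
  assume less: "\<not> s 1 \<le> \<rho> * s 0"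
  have "s 0 \<noteq> 0"
  proof
    assume "s 0 = 0"
    then have "s 1 = 0" using sq[of 1] by simp
    then show False using less \<open>s 0 = 0\<close> by simp
  qed
  then have s0: "0 < s 0" using s0 by simp
  define x where "x = s 1 / (\<rho> * s 0)"
  have x: "1 < x" using less s0 \<rho> by (simp add: x_def field_simps)
  have lower: "s 0 * (\<rho> * x) ^ (2 ^ k) \<le> s (2 ^ k)" for k
  proof (induction k)
    case 0
    then show ?case using s0 \<rho> by (simp add: x_def)
  next
    case (Suc k)
    have "(s 0 * (\<rho> * x) ^ (2 ^ k))\<^sup>2 \<le> (s (2 ^ k))\<^sup>2"
      using Suc x \<rho> s0 by (intro power_mono) auto
    also have "\<dots> \<le> s 0 * s (2 ^ Suc k)"
      using sq[of "2 ^ k"] by simp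
    finally have "s 0 * (s 0 * (\<rho> * x) ^ (2 ^ Suc k)) \<le> s 0 * s (2 ^ Suc k)"
      by (simp add: power_mult_distrib power_even_eq power2_eq_square algebra_simps)
    then show ?case using s0 by simp
  qed
  obtain n where n: "c / s 0 < x ^ n" using real_arch_pow[OF x] by blast
  have "x ^ n \<le> x ^ (2 ^ n)"
    using x less_exp[of n] by (intro power_increasing) auto
  have "s 0 * (\<rho> ^ (2 ^ n) * x ^ (2 ^ n)) \<le> c * \<rho> ^ (2 ^ n)"
    using lower[of n] growth[of "2 ^ n"] by (simp add: power_mult_distrib)
  then have "\<rho> ^ (2 ^ n) * (s 0 * x ^ (2 ^ n)) \<le> \<rho> ^ (2 ^ n) * c"
    by (simp add: mult_ac)
  then have "s 0 * x ^ (2 ^ n) \<le> c" using \<rho> by simp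
  then have "x ^ (2 ^ n) \<le> c / s 0" using s0 by (simp add: field_simps)
  then show False using n \<open>x ^ n \<le> x ^ (2 ^ n)\<close> by linarith
qed

context archimedean_module
begin

lemma state_entry_bound:
  assumes "state g h y"
  shows "qRe (y (w + wstar w)) \<le> R ^ wlen w" "qnorm2 (y w) \<le> R ^ wlen w"
proof -
  have "0 \<le> R ^ wlen w * qRe (y 0) - qRe (y (w + wstar w))"
    using assms cone_word_bound[of w] by (auto simp: state_def)
  then show 1: "qRe (y (w + wstar w)) \<le> R ^ wlen w"
    by (simp add: stateD(1)[OF assms])
  have "0 \<le> qf 1 [(qconj (y w), 1), (-1, wmono (wstar w))] y"
    by (rule stateD(2)[OF assms]) simp
  also have "\<dots> = qRe (y w * qconj (y w)) - 2 * qRe (y w * qconj (y w)) + qRe (y (w + wstar w))"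
    by (simp add: qf_def stateD(1)[OF assms] moment_relD(1)[OF state_moment_rel[OF assms]] flip: wmono_add)
  finally have "qnorm2 (y w) \<le> qRe (y (w + wstar w))"
    by (simp add: mult_qconj_self)
  then show "qnorm2 (y w) \<le> R ^ wlen w" using 1 by simp
qed

lemma square_word_central: "wmono (w + wstar w) * p = p * wmono (w + wstar w)"
  by (induction p rule: rpoly_induct)
    (simp_all add: word_star_central semiring_class.distrib_left semiring_class.distrib_right
      del: wmono_add flip: wmono_add)

lemma square_word_power_central: "wmono (w + wstar w) ^ m * p = p * wmono (w + wstar w) ^ m"
  by (rule power_commuting_commutes) (rule square_word_central)

lemma rstar_power_square_word: "rstar (wmono (w + wstar w) ^ m) = wmono (w + wstar w) ^ m"
  by (induction m) (simp_all add: power_commutes)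

text \<open>The word obtained from \<open>v\<close> by \<open>m\<close> factors
  \<open>w + wstar w\<close> has length \<open>wlen v + 2 * m * wlen w\<close>, so the bound on
  single moments already gives the right rate; the constant depends on \<open>xs\<close>, which is
  harmless.\<close>

lemma square_word_growth:
  assumes "state g h y"
  shows "\<exists>c. \<forall>m. \<bar>qf (q * wmono (w + wstar w) ^ m) xs y\<bar> \<le> c * (R ^ wlen w) ^ m"
proof -
  let ?K = "wmono (w + wstar w)" and ?\<rho> = "R ^ wlen w"
  have \<rho>: "0 < ?\<rho>" using R_pos by simp
  have "\<exists>c. \<forall>m. qnorm2 (L_y y (?K ^ m * p)) \<le> c * ?\<rho> ^ (2 * m)" for p
  proof (induction p rule: rpoly_induct)
    case zero
    then show ?case by (intro exI[of _ 0]) (simp add: qnorm2_def)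
  next
    case (mono v)
    show ?case
    proof (intro exI[of _ "R ^ wlen v"] allI)
      fix m
      have "\<exists>x. ?K ^ m * wmono v = wmono x \<and> wlen x = wlen v + 2 * m * wlen w"
      proof (induction m)
        case (Suc m)
        then obtain x where "?K ^ m * wmono v = wmono x" "wlen x = wlen v + 2 * m * wlen w" by blast
        then show ?case
          by (intro exI[of _ "w + wstar w + x"]) (simp add: mult.assoc wmono_add)
      qed auto
      then obtain x where x: "?K ^ m * wmono v = wmono x" "wlen x = wlen v + 2 * m * wlen w" by blast
      have "qnorm2 (L_y y (?K ^ m * wmono v)) \<le> R ^ wlen x"
        unfolding x(1) using state_entry_bound(2)[OF assms] by simp
      also have "\<dots> = R ^ wlen v * ?\<rho> ^ (2 * m)"
        by (simp add: x power_add power_mult[symmetric] mult_ac)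
      finally show "qnorm2 (L_y y (?K ^ m * wmono v)) \<le> R ^ wlen v * ?\<rho> ^ (2 * m)" .
    qed
  next
    case (add p1 p2)
    then obtain c1 c2 where c: "\<forall>m. qnorm2 (L_y y (?K ^ m * p1)) \<le> c1 * ?\<rho> ^ (2 * m)"
      "\<forall>m. qnorm2 (L_y y (?K ^ m * p2)) \<le> c2 * ?\<rho> ^ (2 * m)" by blast
    show ?case
    proof (intro exI[of _ "2 * c1 + 2 * c2"] allI)
      fix m
      show "qnorm2 (L_y y (?K ^ m * (p1 + p2))) \<le> (2 * c1 + 2 * c2) * ?\<rho> ^ (2 * m)"
        using qnorm2_add_le[of "L_y y (?K ^ m * p1)" "L_y y (?K ^ m * p2)"] c[rule_format, of m]
        by (simp add: semiring_class.distrib_left semiring_class.distrib_right)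
    qed
  next
    case (scale r p)
    then obtain c where c: "\<forall>m. qnorm2 (L_y y (?K ^ m * p)) \<le> c * ?\<rho> ^ (2 * m)" by blast
    show ?case
      by (intro exI[of _ "r\<^sup>2 * c"] allI) (simp add: qnorm2_scaleR mult.assoc mult_left_mono c)
  qed
  note poly = this
  have entry: "\<exists>c. \<forall>m. \<bar>qRe (a * L_y y (?K ^ m * p) * b)\<bar> \<le> c * ?\<rho> ^ m" for a b p
  proof -
    obtain c where c: "\<forall>m. qnorm2 (L_y y (?K ^ m * p)) \<le> c * ?\<rho> ^ (2 * m)"
      using poly by blast
    have c0: "0 \<le> c" using c[rule_format, of 0] qnorm2_nonneg[of "L_y y p"] by (simp del: qnorm2_nonneg)
    show ?thesis
    proof (intro exI[of _ "sqrt (qnorm2 a * qnorm2 b * c)"] allI qRe_le_of_qnorm2)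
      fix m
      have "qnorm2 (a * L_y y (?K ^ m * p) * b) = qnorm2 a * qnorm2 b * qnorm2 (L_y y (?K ^ m * p))"
        by (simp add: qnorm2_mult)
      also have "\<dots> \<le> qnorm2 a * qnorm2 b * (c * ?\<rho> ^ (2 * m))"
        using c by (intro mult_left_mono) auto
      also have "\<dots> = (sqrt (qnorm2 a * qnorm2 b * c) * ?\<rho> ^ m)\<^sup>2"
        using c0 by (simp add: power_mult_distrib power_even_eq)
      finally show "qnorm2 (a * L_y y (?K ^ m * p) * b) \<le> (sqrt (qnorm2 a * qnorm2 b * c) * ?\<rho> ^ m)\<^sup>2" .
      show "0 \<le> sqrt (qnorm2 a * qnorm2 b * c) * ?\<rho> ^ m" using c0 \<rho> by simp
    qed
  qed
  have sum: "\<exists>c. \<forall>m. \<bar>\<Sum>x\<leftarrow>zs. F x m\<bar> \<le> c * ?\<rho> ^ m" if F: "\<And>x. \<exists>c. \<forall>m. \<bar>F x m\<bar> \<le> c * ?\<rho> ^ m"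
    for F :: "quat \<times> 'n rpoly \<Rightarrow> nat \<Rightarrow> real" and zs
  proof (induction zs)
    case Nil
    then show ?case by (intro exI[of _ 0]) simp
  next
    case (Cons x zs)
    obtain c1 where c1: "\<forall>m. \<bar>\<Sum>x\<leftarrow>zs. F x m\<bar> \<le> c1 * ?\<rho> ^ m" using Cons by blast
    obtain c2 where c2: "\<forall>m. \<bar>F x m\<bar> \<le> c2 * ?\<rho> ^ m" using F by blast
    show ?case
    proof (intro exI[of _ "c1 + c2"] allI)
      fix m
      show "\<bar>\<Sum>x\<leftarrow>x # zs. F x m\<bar> \<le> (c1 + c2) * ?\<rho> ^ m"
        using c1[rule_format, of m] c2[rule_format, of m] by (simp add: semiring_class.distrib_right)
    qed
  qed
  have *: "qf (q * ?K ^ m) xs y = (\<Sum>(a, U)\<leftarrow>xs. \<Sum>(b, V)\<leftarrow>xs. qRe (qconj a * L_y y (?K ^ m * (rstar U * q * V)) * b))" for m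
  proof -
    have "rstar U * (q * ?K ^ m) * V = ?K ^ m * (rstar U * q * V)" for U V
      using arg_cong[OF square_word_power_central[of w m "rstar U * q"], of "\<lambda>p. p * V"]
      by (simp only: mult.assoc)
    then show ?thesis by (simp add: qf_eq_Re)
  qed
  show ?thesis
    unfolding * split_def by (intro sum entry)
qed

text \<open>The bounds on single moments become a bound in each localized form: Cauchy-Schwarz
  between \<open>xs\<close> and its shift by the \<open>m\<close>-th power gives the doubling
  inequality, and \<open>doubling_growth\<close> removes the dependence on
  \<open>xs\<close>.\<close>

lemma square_word_bound:
  assumes "state g h y" "q = 1 \<or> q \<in> set g"
  shows "qf (q * wmono (w + wstar w)) xs y \<le> R ^ wlen w * qf q xs y"
proof -
  let ?K = "wmono (w + wstar w)"
  define s where "s m = qf (q * ?K ^ m) xs y" for m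
  obtain c where c: "\<forall>m. \<bar>s m\<bar> \<le> c * (R ^ wlen w) ^ m"
    using square_word_growth[OF assms(1)] unfolding s_def by blast
  have double: "rstar (?K ^ m) * q * ?K ^ m = q * ?K ^ (2 * m)" for m
    by (simp add: rstar_power_square_word square_word_power_central mult.assoc mult_2 flip: power_add)
  have "(s m)\<^sup>2 \<le> s 0 * s (2 * m)" for m
  proof (rule quadratic_nonneg_discriminant)
    fix t
    have "0 \<le> qf q (xs @ map (\<lambda>(a, U). (t *\<^sub>R a, U)) (shift (?K ^ m) xs)) y"
      by (rule stateD(2)[OF assms])
    then show "0 \<le> s 0 + t * (2 * s m) + t\<^sup>2 * s (2 * m)"
      unfolding qf_append_scaled double
      by (simp add: s_def rstar_power_square_word square_word_power_central)
    show "0 \<le> s (2 * m)"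
      using stateD(2)[OF assms, of "shift (?K ^ m) xs"] unfolding qf_shift double s_def .
  qed
  then have "s 1 \<le> R ^ wlen w * s 0"
  proof (rule doubling_growth)
    show "0 \<le> s 0" using stateD(2)[OF assms] by (simp add: s_def)
    show "0 < R ^ wlen w" using R_pos by simp
  qed (use c in auto)
  then show ?thesis by (simp add: s_def)
qed

text \<open>Positivity: B times the multiplier is the square of \<open>B + \<sigma> w\<close> plus
  the difference of \<open>B\<^sup>2\<close> and \<open>w + wstar w\<close> as a monomial,
  nonnegative by \<open>square_word_bound\<close>. The moment relations survive because the
  multiplier is symmetric and hence commutes; the prefactor normalizes the value at the empty
  word.\<close>

lemma state_trace_shift:
  assumes y: "state g h y" and \<sigma>: "\<sigma>\<^sup>2 = 1" and B: "R ^ wlen w \<le> B\<^sup>2" "0 < B" "0 < B + \<sigma> * qRe (y w)"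
  shows "state g h (\<lambda>v. (1 / (2 * (B + \<sigma> * qRe (y w)))) *\<^sub>R
    L_y y (wmono v * ((2 * B) *\<^sub>R 1 + \<sigma> *\<^sub>R (wmono w + wmono (wstar w)))))" (is "state g h ?y")
proof -
  let ?c = "1 / (2 * (B + \<sigma> * qRe (y w)))"
  let ?P = "(2 * B) *\<^sub>R 1 + \<sigma> *\<^sub>R (wmono w + wmono (wstar w))"
  note rel = state_moment_rel[OF y]
  have P: "rstar ?P = ?P" by (simp add: add.commute)
  have q_sym: "rstar q = q" if "q = 1 \<or> q \<in> set g" for q
    using that sym by auto
  have c: "0 < ?c" using B by simp
  have L: "L_y ?y p = ?c *\<^sub>R L_y y (p * ?P)" for p
    by (simp only: L_y_fun_simps L_y_act)
  have comm: "L_y y (p * ?P * b) = L_y y (p * b * ?P)" for p b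
    using L_y_commute_symmetric[OF rel P, of p b 1] by (simp only: mult_1_right)
  show ?thesis
  proof (rule stateI)
    show "moment_rel ?y"
      unfolding moment_rel_def
    proof (intro conjI allI)
      fix v
      have "L_y y (wmono (wstar v) * ?P) = L_y y (rstar (?P * wmono v))"
        by (simp only: rstar_mult P rstar_wmono)
      also have "\<dots> = qconj (L_y y (?P * wmono v))"
        by (rule L_y_rstar[OF rel])
      also have "L_y y (?P * wmono v) = L_y y (wmono v * ?P)"
        using comm[of 1 "wmono v"] by (simp only: mult_1_left)
      finally show "?y (wstar v) = qconj (?y v)" by (simp only: qconj_scaleR)
    next
      show "cyclic ?y"
        unfolding cyclic_def
      proof (intro allI)
        fix u v
        have "qRe (L_y y (wmono (u + v) * ?P)) = qRe (L_y y (wmono v * ?P * wmono u))"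
          using L_y_cyclic[OF moment_relD(2)[OF rel], of "wmono u" "wmono v * ?P"]
          by (simp only: wmono_add mult.assoc)
        also have "\<dots> = qRe (L_y y (wmono (v + u) * ?P))"
          by (simp only: comm wmono_add)
        finally show "qRe (?y (u + v)) = qRe (?y (v + u))" by (simp only: quat_sel_simps)
      qed
    next
      fix u x v i
      have "L_y y (wmono u * (wmono x + rstar (wmono x)) * wmono (letter (Q i)) * (wmono v * ?P)) =
          L_y y (wmono u * wmono (letter (Q i)) * (wmono x + rstar (wmono x)) * (wmono v * ?P))"
        by (rule L_y_commute_trace[OF rel])
      then have "L_y y ((wmono (u + x + letter (Q i) + v) + wmono (u + wstar x + letter (Q i) + v)) * ?P) =
          L_y y ((wmono (u + letter (Q i) + x + v) + wmono (u + letter (Q i) + wstar x + v)) * ?P)"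
        by (simp only: wmono_add rstar_wmono semiring_class.distrib_left semiring_class.distrib_right mult.assoc)
      then show "?y (u + x + letter (Q i) + v) + ?y (u + wstar x + letter (Q i) + v) =
        ?y (u + letter (Q i) + x + v) + ?y (u + letter (Q i) + wstar x + v)"
        by (simp only: semiring_class.distrib_right[of _ _ ?P] L_y_add flip: scaleR_add_right)
    qed
  next
    have "qRe (L_y y (wmono 0 * ?P)) = 2 * (B + \<sigma> * qRe (y w))"
      using moment_relD(1)[OF rel, of w] stateD(1)[OF y] by (simp add: algebra_simps)
    then show "qRe (?y 0) = 1"
      using B(3) by (simp only: quat_sel_simps) simp
  next
    fix q xs assume q: "q = 1 \<or> q \<in> set g"
    let ?S = "B *\<^sub>R 1 + \<sigma> *\<^sub>R wmono w"
    have "qf q xs ?y = ?c * qf (q * ?P) xs y"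
    proof -
      have "qf q xs ?y = ?c * qf q xs (\<lambda>v. L_y y (wmono v * ?P))"
        by (rule qf_seq_simps)
      also have "qf q xs (\<lambda>v. L_y y (wmono v * ?P)) = qf (q * ?P) xs y"
      proof (rule qf_cong)
        fix U V
        show "L_y (\<lambda>v. L_y y (wmono v * ?P)) (rstar U * q * V) = L_y y (rstar U * (q * ?P) * V)"
          using comm[of "rstar U * q" V] by (simp only: L_y_act mult.assoc)
      qed
      finally show ?thesis .
    qed
    moreover have "B * qf (q * ?P) xs y = qf (q * (?S * rstar ?S)) xs y + (B\<^sup>2 * qf q xs y - qf (q * wmono (w + wstar w)) xs y)"
    proof -
      have "\<sigma> * \<sigma> = 1" using \<sigma> by (simp add: power2_eq_square)
      then have "B *\<^sub>R ?P = ?S * rstar ?S + (B\<^sup>2 *\<^sub>R 1 - wmono (w + wstar w))"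
        by (simp add: algebra_simps power2_eq_square wmono_add) (simp flip: scaleR_add_left)
      then have "q * (B *\<^sub>R ?P) = q * (?S * rstar ?S) + (B\<^sup>2 *\<^sub>R q - q * wmono (w + wstar w))"
        by (simp only: semiring_class.distrib_left right_diff_distrib mult_scaleR_right mult_1_right)
      then have "B *\<^sub>R (q * ?P) = q * (?S * rstar ?S) + (B\<^sup>2 *\<^sub>R q - q * wmono (w + wstar w))"
        by (simp only: mult_scaleR_right)
      from arg_cong[OF this, of "\<lambda>p. qf p xs y"] show ?thesis
        by (simp only: qf_poly_simps qf_poly_diff)
    qed
    \<comment> \<open>Being symmetric, \<open>q\<close> commutes past \<open>?S\<close> under the
      functional, so the product becomes a square localized at \<open>q\<close>.\<close>
    moreover have "qf (q * (?S * rstar ?S)) xs y = qf q (shift (rstar ?S) xs) y"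
      unfolding qf_shift
    proof (rule qf_cong)
      fix U V
      show "L_y y (rstar U * (q * (?S * rstar ?S)) * V) = L_y y (rstar U * (rstar (rstar ?S) * q * rstar ?S) * V)"
        using L_y_commute_symmetric[OF rel q_sym[OF q], of "rstar U" ?S "rstar ?S * V"]
        by (simp only: mult.assoc rstar_rstar)
    qed
    moreover have "0 \<le> qf q (shift (rstar ?S) xs) y"
      by (rule stateD(2)[OF y q])
    moreover have "qf (q * wmono (w + wstar w)) xs y \<le> B\<^sup>2 * qf q xs y"
      using square_word_bound[OF y q, of w xs] B(1) stateD(2)[OF y q, of xs]
      by (meson mult_right_mono order_trans)
    ultimately have "0 \<le> B * qf (q * ?P) xs y" "qf q xs ?y = ?c * qf (q * ?P) xs y" by linarith+
    then show "0 \<le> qf q xs ?y"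
      using B(2) c by (simp only: zero_le_mult_iff) auto
  next
    fix k u v assume k: "k \<in> set h"
    show "L_y ?y (wmono u * k * wmono v) = 0"
      using stateD(3)[OF y k, of "wmono u" "wmono v * ?P"] unfolding L by (simp only: mult.assoc scaleR_zero_right)
  qed
qed

text \<open>The shifted states for the signs 1 and -1 average to \<open>y\<close> with suitable
  weights. By extremality the first one equals \<open>y\<close>, and comparing its two expressions
  gives the claim.\<close>

lemma extremal_state_trace_word:
  assumes "extremal_state g h y"
  shows "y (v + w) + y (v + wstar w) = (2 * qRe (y w)) *\<^sub>R y v"
proof -
  have y: "state g h y" using assms by (simp add: extremal_state_def)
  \<comment> \<open>The summand 1 makes \<open>B\<^sup>2\<close> exceed \<open>R ^ wlen w\<close>
    strictly, so that both normalizing denominators are positive.\<close>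
  define B where "B = R ^ wlen w + 1"
  define r where "r = qRe (y w)"
  define Y where "Y \<sigma> = (\<lambda>v. (1 / (2 * (B + \<sigma> * r))) *\<^sub>R
    L_y y (wmono v * ((2 * B) *\<^sub>R 1 + \<sigma> *\<^sub>R (wmono w + wmono (wstar w)))))" for \<sigma>
  have R: "0 < R ^ wlen w" using R_pos by simp
  have B: "0 < B" "R ^ wlen w \<le> B\<^sup>2"
    using R by (auto simp: B_def power2_eq_square algebra_simps)
  have "r\<^sup>2 \<le> R ^ wlen w"
    using qRe_square_le_qnorm2[of "y w"] state_entry_bound(2)[OF y, of w] by (simp add: r_def)
  also have "\<dots> < B\<^sup>2"
    using R by (simp add: B_def power2_eq_square algebra_simps add_pos_pos)
  finally have r: "\<bar>r\<bar> < B"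
    using power2_less_imp_less[of "\<bar>r\<bar>" B] B by simp
  have st: "state g h (Y 1)" "state g h (Y (-1))"
    unfolding Y_def r_def
    by (rule state_trace_shift[OF y]; use B r in \<open>auto simp: r_def\<close>)+
  have Y: "Y \<sigma> v = (1 / (2 * (B + \<sigma> * r))) *\<^sub>R ((2 * B) *\<^sub>R y v + \<sigma> *\<^sub>R (y (v + w) + y (v + wstar w)))" for \<sigma> v
    by (simp add: Y_def semiring_class.distrib_left flip: wmono_add)
  have "Y 1 = y"
  proof -
    \<comment> \<open>The weights are proportional to the normalizing factors, so that these cancel
      and the terms with \<open>w\<close> drop out of the average.\<close>
    let ?\<alpha> = "(B + r) / (2 * B)"
    have \<alpha>: "0 < ?\<alpha>" "?\<alpha> < 1" using r B by (auto simp: field_simps)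
    have w: "s / (2 * B) * (1 / (2 * s)) = 1 / (4 * B)" if "s \<noteq> 0" for s
      using that B by (simp add: field_simps)
    have w1: "?\<alpha> * (1 / (2 * (B + 1 * r))) = 1 / (4 * B)"
      using w[of "B + r"] r by simp
    have "1 - ?\<alpha> = (B - r) / (2 * B)" using B by (simp add: field_simps)
    then have w2: "(1 - ?\<alpha>) * (1 / (2 * (B + (-1) * r))) = 1 / (4 * B)"
      using w[of "B - r"] r by simp
    have "y v = ?\<alpha> *\<^sub>R Y 1 v + (1 - ?\<alpha>) *\<^sub>R Y (-1) v" for v
    proof -
      have "?\<alpha> *\<^sub>R Y 1 v + (1 - ?\<alpha>) *\<^sub>R Y (-1) v =
          (1 / (4 * B)) *\<^sub>R ((4 * B) *\<^sub>R y v)"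
        unfolding Y scaleR_scaleR w1 w2 scaleR_add_right[symmetric] by (simp add: algebra_simps flip: scaleR_add_left)
      then show ?thesis using B by simp
    qed
    then show ?thesis
      using assms st \<alpha> unfolding extremal_state_def by blast
  qed
  then have "(2 * (B + r)) *\<^sub>R Y 1 v = (2 * (B + r)) *\<^sub>R y v" by simp
  moreover have "(2 * (B + r)) *\<^sub>R Y 1 v = (2 * B) *\<^sub>R y v + (y (v + w) + y (v + wstar w))"
  proof -
    have "2 * (B + r) * (1 / (2 * (B + 1 * r))) = 1" using r by simp
    then show ?thesis unfolding Y scaleR_scaleR by simp
  qed
  ultimately show ?thesis
    by (simp add: r_def algebra_simps)
qed

lemma extremal_state_trace:
  assumes "extremal_state g h y"
  shows "L_y y (p * (b + rstar b) * q) = (2 * qRe (L_y y b)) *\<^sub>R L_y y (p * q)"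
proof -
  have y: "state g h y" using assms by (simp add: extremal_state_def)
  have 1: "L_y y (p * (wmono w + wmono (wstar w))) = (2 * qRe (y w)) *\<^sub>R L_y y p" for w p
  proof -
    have "L_y y (wmono v * (wmono w + wmono (wstar w))) = (2 * qRe (y w)) *\<^sub>R y v" for v
      using extremal_state_trace_word[OF assms, of v w]
      by (simp add: semiring_class.distrib_left flip: wmono_add)
    then show ?thesis
      using L_y_act(2)[of y "wmono w + wmono (wstar w)" p] by (simp only: L_y_fun_simps)
  qed
  have "L_y y (a * b) + L_y y (a * rstar b) = (2 * qRe (L_y y b)) *\<^sub>R L_y y a" for a
  proof (induction b rule: rpoly_induct)
    case (mono w)
    then show ?case using 1[of a w] by (simp add: semiring_class.distrib_left)
  next
    case (add b c)
    have "L_y y (a * (b + c)) + L_y y (a * rstar (b + c)) =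
        (L_y y (a * b) + L_y y (a * rstar b)) + (L_y y (a * c) + L_y y (a * rstar c))"
      by (simp add: algebra_simps)
    then show ?case by (simp only: add) (simp add: algebra_simps)
  next
    case (scale r b)
    have "L_y y (a * (r *\<^sub>R b)) + L_y y (a * rstar (r *\<^sub>R b)) = r *\<^sub>R (L_y y (a * b) + L_y y (a * rstar b))"
      by (simp add: algebra_simps)
    then show ?case by (simp only: scale) simp
  qed simp
  then have 2: "L_y y (a * (b + rstar b)) = (2 * qRe (L_y y b)) *\<^sub>R L_y y a" for a
    by (simp only: semiring_class.distrib_left L_y_add)
  have "L_y y (p * (b + rstar b) * q) = L_y y (p * q * (b + rstar b))"
    using L_y_commute_trace[OF state_moment_rel[OF y], of p b q 1] by (simp only: mult_1_right)
  then show ?thesis by (simp only: 2)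
qed

end


section \<open>Extremal states are point evaluations\<close>

locale extremal_moments = archimedean_module +
  fixes y :: "'a::finite word \<Rightarrow> quat"
  assumes ext: "extremal_state g h y"
begin

lemma st: "state g h y"
  using ext by (simp add: extremal_state_def)

definition tr :: "'a rpoly \<Rightarrow> real" where
  "tr b = qRe (L_y y b)"

text \<open>
  The sequences that are bounded with respect to the inner product given by the moments form the
  dual of the space of the GNS construction. Quaternions act on them from the left and the
  word algebra acts from the right, by \<open>(z \<cdot> b)(v) = L\<^sub>z(b v)\<close>, through a quotient in which
  every \<open>b + b\<^sup>*\<close> is a real scalar.
\<close>

definition vec :: "('a word \<Rightarrow> quat) \<Rightarrow> bool" where
  "vec z \<longleftrightarrow> (\<forall>p b q. L_y z (p * (b + rstar b) * q) = (2 * tr b) *\<^sub>R L_y z (p * q)) \<and>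
     (\<exists>M. \<forall>xs. qnorm2 (\<Sum>(b, V)\<leftarrow>xs. L_y z V * b) \<le> M * qf 1 xs y) \<and>
     (\<forall>k\<in>set h. \<forall>U V. L_y z (U * k * V) = 0)"

definition act :: "('a word \<Rightarrow> quat) \<Rightarrow> 'a rpoly \<Rightarrow> 'a word \<Rightarrow> quat" where
  "act z b = (\<lambda>v. L_y z (b * wmono v))"

lemma L_y_act_eq: "L_y (act z b) p = L_y z (b * p)"
  by (simp add: act_def L_y_act)

lemma tr_simps [simp]:
  "tr (b + c) = tr b + tr c" "tr (b - c) = tr b - tr c" "tr (r *\<^sub>R b) = r * tr b" "tr (- b) = - tr b"
  by (simp_all add: tr_def)

lemma tr_commute: "tr (b * c) = tr (c * b)"
  unfolding tr_def by (rule L_y_cyclic[OF moment_relD(2)[OF state_moment_rel[OF st]]])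

lemma vec_symmetric:
  assumes "vec z" "rstar s = s"
  shows "L_y z (p * s * q) = tr s *\<^sub>R L_y z (p * q)"
proof -
  have "2 *\<^sub>R L_y z (p * s * q) = L_y z (p * (s + rstar s) * q)"
    by (simp add: assms(2) semiring_class.distrib_left semiring_class.distrib_right scaleR_2)
  also have "\<dots> = 2 *\<^sub>R (tr s *\<^sub>R L_y z (p * q))"
    using assms(1) by (simp add: vec_def)
  finally have "2 *\<^sub>R L_y z (p * s * q) = 2 *\<^sub>R (tr s *\<^sub>R L_y z (p * q))" .
  then show ?thesis by (rule scaleR_left_imp_eq[rotated]) simp
qed

lemma vec_bound: "vec z \<Longrightarrow> \<exists>M. \<forall>xs. qnorm2 (\<Sum>(b, V)\<leftarrow>xs. L_y z V * b) \<le> M * qf 1 xs y"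
  by (simp add: vec_def)

lemma vec_trace: "vec z \<Longrightarrow> L_y z (p * (b + rstar b) * q) = (2 * tr b) *\<^sub>R L_y z (p * q)"
  by (simp add: vec_def)

lemma vec_moments: "vec y"
  unfolding vec_def
proof (intro conjI allI ballI exI[of _ 1])
  fix p b q
  show "L_y y (p * (b + rstar b) * q) = (2 * tr b) *\<^sub>R L_y y (p * q)"
    unfolding tr_def by (rule extremal_state_trace[OF ext])
next
  fix xs
  define s where "s = (\<Sum>(b, V)\<leftarrow>xs. L_y y V * b)"
  have "(\<Sum>(a, U)\<leftarrow>xs. qconj a * L_y y (rstar U)) = qconj s"
    by (simp add: s_def qconj_sum_list split_def L_y_rstar[OF state_moment_rel[OF st]])
  then have s': "(\<Sum>(a, U)\<leftarrow>xs. qconj a * L_y y (rstar U) * s) = qconj s * s"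
    by (simp add: split_def sum_list_mult_const)
  have s'': "(\<Sum>(b, V)\<leftarrow>xs. qconj s * L_y y V * b) = qconj s * s"
    unfolding s_def by (simp add: split_def sum_list_const_mult mult.assoc)
  \<comment> \<open>Bessel's inequality: removing the component along the unit polynomial leaves the
    form minus the norm of \<open>s\<close>.\<close>
  have "0 \<le> qf 1 ((- s, 1) # xs) y"
    by (rule stateD(2)[OF st]) simp
  also have "\<dots> = qf 1 xs y - qnorm2 s"
  proof -
    have "qf 1 ((- s, 1) # xs) y = qRe (qconj s * s) - qRe (\<Sum>(b, V)\<leftarrow>xs. qconj s * L_y y V * b) -
       qRe (\<Sum>(a, U)\<leftarrow>xs. qconj a * L_y y (rstar U) * s) + qf 1 xs y"
      by (simp add: qf_eq_Re stateD(1)[OF st] split_def sum_list_addf qRe_sum_list sum_list_subtractf)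
        (simp add: uminus_sum_list_map comp_def)
    then show ?thesis unfolding s' s'' by (simp add: qconj_mult_self)
  qed
  finally show "qnorm2 (\<Sum>(b, V)\<leftarrow>xs. L_y y V * b) \<le> 1 * qf 1 xs y"
    by (simp add: s_def)
next
  fix k U V assume "k \<in> set h"
  then show "L_y y (U * k * V) = 0" by (rule stateD(3)[OF st])
qed

lemma vec_add:
  assumes "vec z" "vec z'"
  shows "vec (\<lambda>v. z v + z' v)"
proof -
  obtain M where M: "\<And>xs. qnorm2 (\<Sum>(b, V)\<leftarrow>xs. L_y z V * b) \<le> M * qf 1 xs y"
    using vec_bound[OF assms(1)] by blast
  obtain M' where M': "\<And>xs. qnorm2 (\<Sum>(b, V)\<leftarrow>xs. L_y z' V * b) \<le> M' * qf 1 xs y"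
    using vec_bound[OF assms(2)] by blast
  have "qnorm2 (\<Sum>(b, V)\<leftarrow>xs. L_y (\<lambda>v. z v + z' v) V * b) \<le> (2 * M + 2 * M') * qf 1 xs y" for xs
  proof -
    have "(\<Sum>(b, V)\<leftarrow>xs. L_y (\<lambda>v. z v + z' v) V * b) =
        (\<Sum>(b, V)\<leftarrow>xs. L_y z V * b) + (\<Sum>(b, V)\<leftarrow>xs. L_y z' V * b)"
      by (simp add: L_y_fun_simps split_def sum_list_addf semiring_class.distrib_right)
    then show ?thesis
      using qnorm2_add_le[of "\<Sum>(b, V)\<leftarrow>xs. L_y z V * b" "\<Sum>(b, V)\<leftarrow>xs. L_y z' V * b"] M[of xs] M'[of xs]
      by (simp add: semiring_class.distrib_right)
  qed
  then show ?thesis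
    using assms unfolding vec_def by (auto simp: L_y_fun_simps scaleR_add_right)
qed

lemma vec_left_mult:
  assumes "vec z"
  shows "vec (\<lambda>v. c * z v)"
proof -
  obtain M where M: "\<And>xs. qnorm2 (\<Sum>(b, V)\<leftarrow>xs. L_y z V * b) \<le> M * qf 1 xs y"
    using vec_bound[OF assms(1)] by blast
  have "qnorm2 (\<Sum>(b, V)\<leftarrow>xs. L_y (\<lambda>v. c * z v) V * b) \<le> (qnorm2 c * M) * qf 1 xs y" for xs
  proof -
    have "(\<Sum>(b, V)\<leftarrow>xs. L_y (\<lambda>v. c * z v) V * b) = c * (\<Sum>(b, V)\<leftarrow>xs. L_y z V * b)"
      by (simp add: L_y_fun_simps split_def sum_list_const_mult mult.assoc)
    then show ?thesis
      using mult_left_mono[OF M[of xs], of "qnorm2 c"] by (simp add: qnorm2_mult mult.assoc)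
  qed
  then show ?thesis
    using assms unfolding vec_def by (auto simp: L_y_fun_simps)
qed

text \<open>Since \<open>rstar b * b\<close> is symmetric, it acts by a scalar; boundedness of the
  action on vectors thus comes for free.\<close>

lemma qf_square: "qf (rstar b * b) xs y = tr (rstar b * b) * qf 1 xs y"
proof -
  have "L_y y (rstar U * (rstar b * b) * V) = tr (rstar b * b) *\<^sub>R L_y y (rstar U * 1 * V)" for U V
    using vec_symmetric[OF vec_moments, of "rstar b * b" "rstar U" V] by simp
  then have "L_y y (rstar U * (rstar b * b) * V) = L_y y (rstar U * (tr (rstar b * b) *\<^sub>R 1) * V)" for U V
    by simp
  then show ?thesis
    using qf_cong[of xs y "rstar b * b" y "tr (rstar b * b) *\<^sub>R 1"] by (simp only: qf_poly_simps)
qed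

lemma vec_act:
  assumes "vec z"
  shows "vec (act z e)"
proof -
  obtain M where M: "\<And>xs. qnorm2 (\<Sum>(b, V)\<leftarrow>xs. L_y z V * b) \<le> M * qf 1 xs y"
    using vec_bound[OF assms(1)] by blast
  have "qnorm2 (\<Sum>(b, V)\<leftarrow>xs. L_y (act z e) V * b) \<le> (M * tr (rstar e * e)) * qf 1 xs y" for xs
  proof -
    have "(\<Sum>(b, V)\<leftarrow>xs. L_y (act z e) V * b) = (\<Sum>(b, V)\<leftarrow>shift e xs. L_y z V * b)"
      by (simp add: L_y_act_eq shift_def split_def comp_def)
    then show ?thesis
      using M[of "shift e xs"] by (simp add: qf_shift qf_square)
  qed
  moreover have "L_y (act z e) (p * (b + rstar b) * q) = (2 * tr b) *\<^sub>R L_y (act z e) (p * q)" for p b q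
    using vec_trace[OF assms, of "e * p" b q] by (simp only: L_y_act_eq mult.assoc)
  moreover have "L_y (act z e) (U * k * V) = 0" if "k \<in> set h" for k U V
  proof -
    have "L_y z ((e * U) * k * V) = 0" using assms that unfolding vec_def by blast
    then show ?thesis by (simp only: L_y_act_eq mult.assoc)
  qed
  ultimately show ?thesis unfolding vec_def by blast
qed

section \<open>Skew elements: null elements, Clifford relations and eigenvectors\<close>

lemma tr_square_nonneg: "0 \<le> tr (rstar b * b)"
  using stateD(2)[OF st, of 1 "[(1, b)]"] by (simp add: qf_def tr_def)

text \<open>The form vanishes on multiples of \<open>b\<close> by \<open>qf_square\<close>, and a
  vector is bounded by the form; so \<open>b\<close> acts as zero.\<close>

lemma vec_null:
  assumes "vec z" "tr (rstar b * b) = 0"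
  shows "L_y z (b * p) = 0"
proof -
  obtain M where M: "\<And>xs. qnorm2 (\<Sum>(b, V)\<leftarrow>xs. L_y z V * b) \<le> M * qf 1 xs y"
    using vec_bound[OF assms(1)] by blast
  have "qf 1 (shift b [(1, p)]) y = 0"
    unfolding qf_shift using qf_square[of b] assms(2) by simp
  then have "qnorm2 (L_y z (b * p)) \<le> 0"
    using M[of "shift b [(1, p)]"] by (simp add: shift_def)
  then have "qnorm2 (L_y z (b * p)) = 0"
    using qnorm2_nonneg[of "L_y z (b * p)"] by linarith
  then show ?thesis by simp
qed

text \<open>For skew \<open>b\<close> and \<open>c\<close> the anticommutator is symmetric, so it
  acts by its trace, which is zero. With \<open>vec_unit_square\<close> these are the relations of a
  Clifford algebra.\<close>

lemma vec_anticommute: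
  assumes "vec z" "rstar b = - b" "rstar c = - c" "tr (b * c) = 0"
  shows "L_y z (p * c * b * q) = - L_y z (p * b * c * q)"
proof -
  have "L_y z (p * (b * c + c * b) * q) = tr (b * c + c * b) *\<^sub>R L_y z (p * q)"
    by (rule vec_symmetric[OF assms(1)]) (simp add: assms)
  then have "L_y z (p * b * c * q) + L_y z (p * c * b * q) = 0"
    using assms(4) tr_commute[of c b]
    by (simp add: semiring_class.distrib_left semiring_class.distrib_right mult.assoc)
  then show ?thesis by (simp add: eq_neg_iff_add_eq_0 add.commute)
qed

lemma vec_unit_square:
  assumes "vec z" "rstar b = - b" "tr (rstar b * b) = 1"
  shows "L_y z (b * (b * q)) = - L_y z q"
proof -
  have "L_y z (1 * (b * b) * q) = tr (b * b) *\<^sub>R L_y z (1 * q)"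
    by (rule vec_symmetric[OF assms(1)]) (simp add: assms)
  moreover have "tr (b * b) = -1" using assms by simp
  ultimately show ?thesis by (simp add: mult.assoc)
qed

text \<open>Only the skew parts of the letters need eigenvectors, because the symmetric parts
  already act by scalars.\<close>

definition im :: "'a \<Rightarrow> 'a rpoly" where
  "im i = (1/2) *\<^sub>R (wmono (letter (Q i)) - wmono (letter (Qbar i)))"

lemma rstar_im: "rstar (im i) = - im i"
  by (simp add: im_def algebra_simps)

definition eigen :: "('a word \<Rightarrow> quat) \<Rightarrow> 'a rpoly \<Rightarrow> quat \<Rightarrow> bool" where
  "eigen z b c \<longleftrightarrow> (\<forall>p. L_y z (b * p) = c * L_y z p)"

lemma eigen_simps:
  "eigen z b c \<Longrightarrow> eigen z b' c' \<Longrightarrow> eigen z (b + b') (c + c')"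
  "eigen z b c \<Longrightarrow> eigen z (r *\<^sub>R b) (r *\<^sub>R c)"
  by (simp_all add: eigen_def semiring_class.distrib_left semiring_class.distrib_right)

lemma eigen_null: "vec z \<Longrightarrow> tr (rstar b * b) = 0 \<Longrightarrow> eigen z b 0"
  by (simp add: eigen_def vec_null)

lemma normalize:
  assumes "rstar b = - b" "tr (rstar b * b) \<noteq> 0"
  obtains r where "r \<noteq> 0" "rstar (r *\<^sub>R b) = - (r *\<^sub>R b)" "tr (rstar (r *\<^sub>R b) * (r *\<^sub>R b)) = 1"
proof -
  have n: "0 < tr (rstar b * b)"
    using assms(2) tr_square_nonneg[of b] by linarith
  show thesis
  proof (rule that[of "1 / sqrt (tr (rstar b * b))"])
    show "tr (rstar ((1 / sqrt (tr (rstar b * b))) *\<^sub>R b) * ((1 / sqrt (tr (rstar b * b))) *\<^sub>R b)) = 1"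
      using n by (simp add: real_sqrt_mult_self field_simps flip: real_sqrt_mult)
  qed (use n assms(1) in auto)
qed

text \<open>A Gram-Schmidt step; the sign is a plus because a skew unit \<open>e\<close> has
  \<open>tr (e * e) = - 1\<close>.\<close>

lemma orthogonal_part:
  assumes "rstar e = - e" "tr (rstar e * e) = 1"
  shows "tr ((b + tr (b * e) *\<^sub>R e) * e) = 0"
  using assms by (simp add: semiring_class.distrib_right)

text \<open>With \<open>k = t *\<^sub>R c\<close> both \<open>e\<close> and \<open>k\<close> square
  to -1, so adding \<open>k\<close> times the image of \<open>z\<close> under \<open>e\<close>
  projects onto the eigenvalue \<open>- k\<close>. The projections for the two signs add up to twice
  \<open>z\<close>, so one of them is nonzero.\<close>

lemma eigenvector_step:
  assumes z: "vec z" "\<exists>v. z v \<noteq> 0" and e: "rstar e = - e" "tr (rstar e * e) = 1" and c: "c * c = - 1"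
  obtains t where "t = 1 \<or> t = - 1" "vec (\<lambda>v. z v + t *\<^sub>R c * L_y z (e * wmono v))"
    "\<exists>v. z v + t *\<^sub>R c * L_y z (e * wmono v) \<noteq> 0"
    "eigen (\<lambda>v. z v + t *\<^sub>R c * L_y z (e * wmono v)) e (- (t *\<^sub>R c))"
proof -
  let ?z = "\<lambda>t v. z v + t *\<^sub>R c * L_y z (e * wmono v)"
  obtain v where v: "z v \<noteq> 0" using z(2) by blast
  have L: "L_y (?z t) p = L_y z p + t *\<^sub>R c * L_y z (e * p)" for t p
    by (simp only: L_y_fun_simps L_y_act)
  have "?z 1 v + ?z (-1) v = 2 *\<^sub>R z v"
    by (simp add: scaleR_2)
  then have "?z 1 v \<noteq> 0 \<or> ?z (-1) v \<noteq> 0"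
    using v by (metis add_0 scaleR_eq_0_iff zero_neq_numeral)
  then obtain t where t: "t = 1 \<or> t = - 1" "?z t v \<noteq> 0" by metis
  show thesis
  proof (rule that[OF t(1)])
    show "vec (?z t)"
      using vec_add[OF z(1) vec_left_mult[OF vec_act[OF z(1), of e], of "t *\<^sub>R c"]] by (simp add: act_def)
    show "\<exists>v. ?z t v \<noteq> 0" using t by blast
    have "(t *\<^sub>R c) * (t *\<^sub>R c) = - 1" using t(1) c by auto
    moreover have "x + k * - w = - k * (w + k * x)" if "k * k = - 1" for k w x :: quat
      using that by (simp add: semiring_class.distrib_left flip: mult.assoc)
    ultimately have "L_y z (e * p) + t *\<^sub>R c * L_y z (e * (e * p)) =
        - (t *\<^sub>R c) * (L_y z p + t *\<^sub>R c * L_y z (e * p))" for p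
      unfolding vec_unit_square[OF z(1) e] by blast
    then show "eigen (?z t) e (- (t *\<^sub>R c))"
      unfolding eigen_def L by blast
  qed
qed

text \<open>
  Three cases, according to whether the imaginary parts of the letters generate \<open>\<real>\<close>, \<open>\<complex>\<close> or
  \<open>\<H>\<close>. In the last one a third direction orthogonal to \<open>e\<^sub>1, e\<^sub>2\<close> is a multiple of
  \<open>e\<^sub>1 e\<^sub>2\<close>, so that it acts by a scalar on every common eigenvector of \<open>e\<^sub>1\<close> and \<open>e\<^sub>2\<close>.
\<close>

lemma eigenvector_exists: "\<exists>z. vec z \<and> (\<exists>v. z v \<noteq> 0) \<and> (\<forall>i. \<exists>c. eigen z (im i) c)"
proof (cases "\<forall>i. tr (rstar (im i) * im i) = 0")
  case True
  then show ?thesis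
    using vec_moments eigen_null stateD(1)[OF st] by (metis zero_neq_one)
next
  case False
  then obtain i0 where "tr (rstar (im i0) * im i0) \<noteq> 0" by blast
  then obtain r1 where r1: "rstar (r1 *\<^sub>R im i0) = - (r1 *\<^sub>R im i0)"
      "tr (rstar (r1 *\<^sub>R im i0) * (r1 *\<^sub>R im i0)) = 1"
    using normalize[OF rstar_im] by metis
  define e1 where "e1 = r1 *\<^sub>R im i0"
  note e1 = r1[folded e1_def]
  \<comment> \<open>Anticommuting skew elements are matched with anticommuting quaternion units, so
    that the second projection does not destroy the first eigenvector.\<close>
  define qi qj where "qi = Quat 0 1 0 0" and "qj = Quat 0 0 1 0"
  have units: "qi * qi = - 1" "qj * qj = - 1" "qi * qj = - (qj * qi)"
    by (simp_all add: qi_def qj_def quat_eq_iff quat_sel_mult)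
  have y_nonzero: "\<exists>v. y v \<noteq> 0"
    using stateD(1)[OF st] by (intro exI[of _ 0]) simp
  obtain t where "t = 1 \<or> t = - 1" "vec (\<lambda>v. y v + t *\<^sub>R qi * L_y y (e1 * wmono v))"
    "\<exists>v. y v + t *\<^sub>R qi * L_y y (e1 * wmono v) \<noteq> 0"
    "eigen (\<lambda>v. y v + t *\<^sub>R qi * L_y y (e1 * wmono v)) e1 (- (t *\<^sub>R qi))"
    by (rule eigenvector_step[OF vec_moments y_nonzero e1 units(1)])
  then obtain z1 s where t: "t = 1 \<or> t = - 1" and z1: "vec z1" "\<exists>v. z1 v \<noteq> 0" "eigen z1 e1 s" and s: "s = - (t *\<^sub>R qi)"
    by blast
  define b where "b i = im i + tr (im i * e1) *\<^sub>R e1" for i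
  have b: "rstar (b i) = - b i" "tr (b i * e1) = 0" for i
    using e1 orthogonal_part[OF e1] by (simp_all add: b_def rstar_im)
  have im_b: "im i = b i + (- tr (im i * e1)) *\<^sub>R e1" for i
    by (simp add: b_def)
  show ?thesis
  proof (cases "\<forall>i. tr (rstar (b i) * b i) = 0")
    case True
    have "\<exists>c. eigen z1 (im i) c" for i
    proof -
      have "eigen z1 (b i + (- tr (im i * e1)) *\<^sub>R e1) (0 + (- tr (im i * e1)) *\<^sub>R s)"
        by (intro eigen_simps eigen_null z1) (use True in blast)
      then show ?thesis unfolding im_b[of i, symmetric] by blast
    qed
    then show ?thesis using z1 by blast
  next
    case False
    then obtain i1 where "tr (rstar (b i1) * b i1) \<noteq> 0" by blast
    then obtain r2 where r2: "rstar (r2 *\<^sub>R b i1) = - (r2 *\<^sub>R b i1)"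
        "tr (rstar (r2 *\<^sub>R b i1) * (r2 *\<^sub>R b i1)) = 1"
      using normalize[OF b(1)] by metis
    define e2 where "e2 = r2 *\<^sub>R b i1"
    note e2 = r2[folded e2_def]
    have e21: "tr (e2 * e1) = 0" "tr (e1 * e2) = 0"
      using b(2)[of i1] tr_commute[of e1 e2] by (simp_all add: e2_def)
    obtain t2 where t2: "t2 = 1 \<or> t2 = - 1" "vec (\<lambda>v. z1 v + t2 *\<^sub>R qj * L_y z1 (e2 * wmono v))"
      "\<exists>v. z1 v + t2 *\<^sub>R qj * L_y z1 (e2 * wmono v) \<noteq> 0"
      "eigen (\<lambda>v. z1 v + t2 *\<^sub>R qj * L_y z1 (e2 * wmono v)) e2 (- (t2 *\<^sub>R qj))"
      using eigenvector_step[OF z1(1,2) e2 units(2)] .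
    define z2 where "z2 = (\<lambda>v. z1 v + t2 *\<^sub>R qj * L_y z1 (e2 * wmono v))"
    note z2 = t2(2-4)[folded z2_def]
    have L2: "L_y z2 p = L_y z1 p + t2 *\<^sub>R qj * L_y z1 (e2 * p)" for p
      unfolding z2_def by (simp only: L_y_fun_simps L_y_act)
    \<comment> \<open>Moving \<open>e1\<close> past \<open>e2\<close> costs one sign and moving
      \<open>s\<close> past \<open>qj\<close> another; they cancel.\<close>
    have z2e1: "eigen z2 e1 s"
      unfolding eigen_def
    proof
      fix p
      have "L_y z1 (e2 * (e1 * p)) = - L_y z1 (e1 * (e2 * p))"
        using vec_anticommute[OF z1(1) e1(1) e2(1) e21(2), of 1 p] by (simp add: mult.assoc)
      also have "\<dots> = - (s * L_y z1 (e2 * p))"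
        using z1(3) by (simp add: eigen_def)
      finally have 1: "L_y z1 (e2 * (e1 * p)) = - (s * L_y z1 (e2 * p))" .
      have "t2 *\<^sub>R qj * - s = s * (t2 *\<^sub>R qj)"
        using units(3) by (simp add: s)
      then have 2: "t2 *\<^sub>R qj * - (s * x) = s * (t2 *\<^sub>R qj * x)" for x
      proof -
        have "t2 *\<^sub>R qj * - (s * x) = (t2 *\<^sub>R qj * - s) * x"
          by (simp only: mult_minus_right mult_minus_left mult.assoc)
        then show ?thesis using \<open>t2 *\<^sub>R qj * - s = s * (t2 *\<^sub>R qj)\<close> by (simp only: mult.assoc)
      qed
      have "L_y z2 (e1 * p) = s * L_y z1 p + t2 *\<^sub>R qj * - (s * L_y z1 (e2 * p))"
        using z1(3) by (simp only: L2 1 eigen_def)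
      then show "L_y z2 (e1 * p) = s * L_y z2 p"
        by (simp only: 2 L2 semiring_class.distrib_left)
    qed
    define w where "w = - (t2 *\<^sub>R qj)"
    have sw: "s \<noteq> 0" "w \<noteq> 0"
      using t t2(1) by (auto simp: s w_def qi_def qj_def quat_eq_iff)
    have "\<exists>c. eigen z2 (im k) c" for k
    proof -
      define b' where "b' = b k + tr (b k * e2) *\<^sub>R e2"
      have b': "rstar b' = - b'" "tr (b' * e2) = 0" "tr (b' * e1) = 0"
        using e2 b orthogonal_part[OF e2] e21(1) by (simp_all add: b'_def semiring_class.distrib_right)
      \<comment> \<open>The star of \<open>e1 * e2 * b'\<close> is minus the reversed product, and
        undoing the reversal takes three anticommutations, again a minus. So the triple product acts
        like a symmetric element, by its trace.\<close>
      have "L_y z2 (e1 * e2 * b' * p) = tr (e1 * e2 * b') *\<^sub>R L_y z2 p" for p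
      proof -
        have "L_y z2 (b' * e2 * e1 * p) = - L_y z2 (e2 * b' * e1 * p)"
          using vec_anticommute[OF z2(1) e2(1) b'(1), of 1 "e1 * p"] b'(2) tr_commute[of b' e2]
          by (simp add: mult.assoc)
        also have "L_y z2 (e2 * b' * e1 * p) = - L_y z2 (e2 * e1 * b' * p)"
          using vec_anticommute[OF z2(1) e1(1) b'(1), of e2 p] b'(3) tr_commute[of b' e1] by simp
        also have "L_y z2 (e2 * e1 * b' * p) = - L_y z2 (e1 * e2 * b' * p)"
          using vec_anticommute[OF z2(1) e1(1) e2(1) e21(2), of 1 "b' * p"] by (simp add: mult.assoc)
        finally have "L_y z2 (rstar (e1 * e2 * b') * p) = L_y z2 (e1 * e2 * b' * p)"
          by (simp add: e1 e2 b' mult.assoc)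
        moreover have "L_y z2 (e1 * e2 * b' * p) + L_y z2 (rstar (e1 * e2 * b') * p) = (2 * tr (e1 * e2 * b')) *\<^sub>R L_y z2 p"
          using vec_trace[OF z2(1), of 1 "e1 * e2 * b'" p]
          by (simp only: mult_1_left semiring_class.distrib_right L_y_add)
        ultimately have "2 *\<^sub>R L_y z2 (e1 * e2 * b' * p) = 2 *\<^sub>R (tr (e1 * e2 * b') *\<^sub>R L_y z2 p)"
          by (simp add: scaleR_2)
        then show ?thesis by (rule scaleR_left_imp_eq[rotated]) simp
      qed
      moreover have "L_y z2 (e1 * e2 * b' * p) = s * w * L_y z2 (b' * p)" for p
        using z2e1 z2(3) by (simp add: eigen_def w_def mult.assoc)
      ultimately have "s * w * L_y z2 (b' * p) = tr (e1 * e2 * b') *\<^sub>R L_y z2 p" for p by simp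
      then have "inverse (s * w) * (s * w * L_y z2 (b' * p)) = inverse (s * w) * (tr (e1 * e2 * b') *\<^sub>R L_y z2 p)" for p
        by (simp only:)
      moreover have "inverse k * (k * x) = x" if "k \<noteq> 0" for k x :: quat
        using that by (simp flip: mult.assoc)
      ultimately have "L_y z2 (b' * p) = (tr (e1 * e2 * b') *\<^sub>R inverse (s * w)) * L_y z2 p" for p
        using sw by simp
      then have 1: "eigen z2 b' (tr (e1 * e2 * b') *\<^sub>R inverse (s * w))"
        unfolding eigen_def by blast
      have im_k: "b' + (- tr (b k * e2)) *\<^sub>R e2 + (- tr (im k * e1)) *\<^sub>R e1 = im k"
        by (simp add: b'_def b_def)
      have "\<exists>c. eigen z2 (b' + (- tr (b k * e2)) *\<^sub>R e2 + (- tr (im k * e1)) *\<^sub>R e1) c"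
        using eigen_simps(1)[OF eigen_simps(1)[OF 1 eigen_simps(2)[OF z2(3)]] eigen_simps(2)[OF z2e1]]
        by blast
      then show ?thesis unfolding im_k .
    qed
    moreover have "\<exists>v. z2 v \<noteq> 0"
      using t2(3) unfolding z2_def .
    ultimately show ?thesis using z2(1) by blast
  qed
qed

lemma qconj_eq: "qconj x = of_real (2 * qRe x) - x"
  by (simp add: quat_eq_iff del: of_real_mult)

text \<open>On a common eigenvector each letter acts by a left quaternion factor, so the vector is
  determined by its value at the empty word; dividing by that value on the left conjugates the
  factors into the coordinates of a point.\<close>

lemma vec_point: "\<exists>a. vec (weval a)"
proof -
  obtain z where z: "vec z" "\<exists>v. z v \<noteq> 0" "\<forall>i. \<exists>c. eigen z (im i) c"
    using eigenvector_exists by blast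
  then obtain c where c: "\<And>i. eigen z (im i) (c i)" by metis
  obtain v0 where v0: "z v0 \<noteq> 0" using z(2) by blast
  have imaginary: "qRe (c i) = 0" for i
  proof -
    have "L_y z (1 * (im i * im i) * wmono v0) = tr (im i * im i) *\<^sub>R L_y z (1 * wmono v0)"
      by (rule vec_symmetric[OF z(1)]) (simp add: rstar_im)
    then have "c i * (c i * z v0) = of_real (tr (im i * im i)) * z v0"
      using c[of i] by (simp add: eigen_def mult.assoc scaleR_conv_of_real)
    then have "(c i * c i) * z v0 = of_real (tr (im i * im i)) * z v0"
      by (simp add: mult.assoc)
    then have sq: "c i * c i = of_real (tr (im i * im i))"
      using v0 by simp
    have "tr (im i * im i) \<le> 0"
      using tr_square_nonneg[of "im i"] by (simp add: rstar_im)
    then have le: "qRe (c i * c i) \<le> 0" by (simp add: sq)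
    have "qI (c i * c i) = 0" "qJ (c i * c i) = 0" "qK (c i * c i) = 0" by (simp_all add: sq)
    then have "qRe (c i) = 0 \<or> qI (c i) = 0 \<and> qJ (c i) = 0 \<and> qK (c i) = 0"
      by (auto simp: quat_sel_mult)
    \<comment> \<open>If the imaginary components vanish, the square of \<open>qRe (c i)\<close> is
      itself at most zero.\<close>
    then show ?thesis using le by (auto simp: quat_sel_mult mult_le_0_iff)
  qed
  define \<rho> where "\<rho> i = tr (wmono (letter (Q i)))" for i
  define d where "d x = (case x of Q i \<Rightarrow> of_real (\<rho> i) + c i | Qbar i \<Rightarrow> of_real (\<rho> i) - c i)" for x
  have letters: "z (letter x + v) = d x * z v" for x v
  proof -
    have *: "z (letter (Q i) + v) + z (letter (Qbar i) + v) = 2 *\<^sub>R (\<rho> i *\<^sub>R z v)" for i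
      using vec_trace[OF z(1), of 1 "wmono (letter (Q i))" "wmono v"]
      by (simp add: \<rho>_def semiring_class.distrib_right flip: wmono_add)
    have **: "z (letter (Q i) + v) - z (letter (Qbar i) + v) = 2 *\<^sub>R (c i * z v)" for i
    proof -
      have "L_y z (im i * wmono v) = c i * z v"
        using c[of i] by (simp add: eigen_def)
      then have "2 *\<^sub>R L_y z (im i * wmono v) = 2 *\<^sub>R (c i * z v)" by simp
      then show ?thesis by (simp add: im_def left_diff_distrib flip: wmono_add)
    qed
    have "2 *\<^sub>R z (letter (Q i) + v) = 2 *\<^sub>R (\<rho> i *\<^sub>R z v + c i * z v)"
      "2 *\<^sub>R z (letter (Qbar i) + v) = 2 *\<^sub>R (\<rho> i *\<^sub>R z v - c i * z v)" for i
      using arg_cong2[OF *[of i] **[of i], of "(+)"] arg_cong2[OF *[of i] **[of i], of "(-)"]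
      by (simp_all add: scaleR_2 algebra_simps)
    then have "z (letter (Q i) + v) = \<rho> i *\<^sub>R z v + c i * z v"
      "z (letter (Qbar i) + v) = \<rho> i *\<^sub>R z v - c i * z v" for i
      by simp_all
    then show ?thesis
      by (cases x) (simp_all add: d_def scaleR_conv_of_real semiring_class.distrib_right left_diff_distrib)
  qed
  have z0: "z 0 \<noteq> 0"
  proof
    assume "z 0 = 0"
    then have "z w = 0" for w
      by (induction w rule: word_cons_induct) (simp_all add: letters)
    then show False using v0 by simp
  qed
  define a where "a i = inverse (z 0) * d (Q i) * z 0" for i
  have Re_a: "qRe (a i) = \<rho> i" for i
    using qRe_mult_commute[of "inverse (z 0) * d (Q i)" "z 0"] z0
    by (simp add: a_def d_def imaginary flip: mult.assoc)
  have letter_a: "letter_eval a x = inverse (z 0) * d x * z 0" for x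
  proof (cases x)
    case (Qbar i)
    \<comment> \<open>A barred letter must yield the conjugate coordinate: both are twice the real
      part \<open>\<rho> i\<close> minus the unbarred one, and real numbers are unaffected by
      conjugation with \<open>z 0\<close>.\<close>
    have "inverse (z 0) * d (Qbar i) * z 0 = inverse (z 0) * (of_real (2 * \<rho> i) - d (Q i)) * z 0"
    proof -
      have "d (Qbar i) = of_real (2 * \<rho> i) - d (Q i)"
        by (simp add: d_def quat_eq_iff del: of_real_mult)
      then show ?thesis by (simp only:)
    qed
    also have "\<dots> = inverse (z 0) * (of_real (2 * \<rho> i) * z 0) - a i"
      by (simp only: left_diff_distrib right_diff_distrib a_def mult.assoc)
    also have "inverse (z 0) * (of_real (2 * \<rho> i) * z 0) = of_real (2 * \<rho> i)"
      using z0 by (simp only: of_real_quat_comm[of _ "z 0"]) (simp flip: mult.assoc)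
    finally show ?thesis by (simp only: Qbar letter_eval.simps qconj_eq Re_a)
  qed (simp add: a_def)
  have "inverse (z 0) * z w = weval a w" for w
  proof (induction w rule: word_cons_induct)
    case empty
    then show ?case using z0 by simp
  next
    case (cons w x)
    have "inverse (z 0) * z (letter x + w) = (inverse (z 0) * d x * z 0) * (inverse (z 0) * z w)"
    proof -
      have "z 0 * (inverse (z 0) * z w) = z w" using z0 by (simp flip: mult.assoc)
      then show ?thesis by (simp add: letters mult.assoc)
    qed
    then show ?case by (simp add: cons letter_a)
  qed
  then have "weval a = (\<lambda>w. inverse (z 0) * z w)" by auto
  then show ?thesis using vec_left_mult[OF z(1)] by metis
qed

lemma symmetric_generator: "q = 1 \<or> q \<in> set g \<Longrightarrow> rstar q = q"
  using sym by auto

lemma tr_generator_nonneg: "q = 1 \<or> q \<in> set g \<Longrightarrow> 0 \<le> tr q"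
  using stateD(2)[OF st, of q "[(1, 1)]"] by (simp add: qf_def tr_def)

lemma qf_generator: "q = 1 \<or> q \<in> set g \<Longrightarrow> qf q xs y = tr q * qf 1 xs y"
proof -
  assume q: "q = 1 \<or> q \<in> set g"
  have "L_y y (rstar U * q * V) = L_y y (rstar U * (tr q *\<^sub>R 1) * V)" for U V
    using vec_symmetric[OF vec_moments symmetric_generator[OF q], of "rstar U" V] by simp
  then show ?thesis
    using qf_cong[of xs y q y "tr q *\<^sub>R 1"] by (simp only: qf_poly_simps)
qed

text \<open>A bounded evaluation is dominated by the state itself, so extremality forces equality.\<close>

lemma moments_point: "\<exists>a. y = weval a"
proof -
  obtain a where a: "vec (weval a)" using vec_point by blast
  obtain M where M: "\<And>xs. qnorm2 (\<Sum>(b, V)\<leftarrow>xs. L_y (weval a) V * b) \<le> M * qf 1 xs y"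
    using vec_bound[OF a] by blast
  \<comment> \<open>Small enough that \<open>t * M \<le> 1\<close>, while the maximum with 1 and the
    factor 2 keep it strictly between 0 and 1.\<close>
  define t where "t = 1 / (2 * max 1 M)"
  have t: "0 < t" "t < 1" "t * M \<le> 1"
    by (auto simp: t_def field_simps max_def)
  have qf_pos: "0 \<le> qf 1 xs y" for xs
    by (rule stateD(2)[OF st]) simp
  have dominated: "t * qnorm2 (\<Sum>(b, V)\<leftarrow>xs. L_y (weval a) V * b) \<le> qf 1 xs y" for xs
  proof -
    have "t * qnorm2 (\<Sum>(b, V)\<leftarrow>xs. L_y (weval a) V * b) \<le> t * (M * qf 1 xs y)"
      using M t by (intro mult_left_mono) auto
    also have "\<dots> \<le> 1 * qf 1 xs y"
      unfolding mult.assoc[symmetric] using t qf_pos by (intro mult_right_mono) auto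
    finally show ?thesis by simp
  qed
  have tr_a: "L_y (weval a) q = of_real (tr q)" if "q = 1 \<or> q \<in> set g" for q
    using vec_symmetric[OF a symmetric_generator[OF that], of 1 1] by (simp add: of_real_def)
  have qf_a: "qf q xs (weval a) = tr q * qnorm2 (\<Sum>(b, V)\<leftarrow>xs. L_y (weval a) V * b)"
    if "q = 1 \<or> q \<in> set g" for q xs
    by (simp add: qf_weval tr_a[OF that])
  have eq_a: "L_y (weval a) (U * k * V) = 0" if "k \<in> set h" for U k V
    using a that unfolding vec_def by blast
  have st_a: "state g h (weval a)"
    by (rule stateI) (auto simp: moment_rel_weval qf_a tr_generator_nonneg eq_a)
  define y' where "y' = (\<lambda>w. (1 / (1 - t)) *\<^sub>R (y w + (- t) *\<^sub>R weval a w))"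
  have L': "L_y y' p = (1 / (1 - t)) *\<^sub>R (L_y y p + (- t) *\<^sub>R L_y (weval a) p)" for p
    unfolding y'_def L_y_fun_simps ..
  have "state g h y'"
  proof (rule stateI)
    note rel = state_moment_rel[OF st] moment_rel_weval[of a]
    show "moment_rel y'"
      unfolding moment_rel_def
    proof (intro conjI allI)
      fix w
      show "y' (wstar w) = qconj (y' w)"
        by (simp add: y'_def moment_relD(1)[OF rel(1)] moment_relD(1)[OF rel(2)])
    next
      show "cyclic y'"
        using moment_relD(2)[OF rel(1)] moment_relD(2)[OF rel(2)]
        unfolding cyclic_def y'_def by (simp del: weval_simps)
    next
      fix u w v i
      have "y' x + y' x' = (1 / (1 - t)) *\<^sub>R ((y x + y x') + (- t) *\<^sub>R (weval a x + weval a x'))" for x x'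
        by (simp add: y'_def algebra_simps)
      then show "y' (u + w + letter (Q i) + v) + y' (u + wstar w + letter (Q i) + v) =
        y' (u + letter (Q i) + w + v) + y' (u + letter (Q i) + wstar w + v)"
        by (simp only: moment_relD(3)[OF rel(1)] moment_relD(3)[OF rel(2)])
    qed
    show "qRe (y' 0) = 1"
      using t by (simp add: y'_def stateD(1)[OF st])
    fix k u v assume "k \<in> set h"
    then show "L_y y' (wmono u * k * wmono v) = 0"
      unfolding L' by (simp add: eq_a stateD(3)[OF st])
  next
    fix q xs assume q: "q = 1 \<or> q \<in> set g"
    have "qf q xs y' = (1 / (1 - t)) * (qf q xs y + (- t) * qf q xs (weval a))"
      unfolding y'_def qf_seq_simps ..
    \<comment> \<open>Domination is established for the form without localization; this suffices,
      since both localized forms are \<open>tr q\<close> times that form.\<close>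
    also have "\<dots> = (1 / (1 - t)) * (tr q * (qf 1 xs y - t * qnorm2 (\<Sum>(b, V)\<leftarrow>xs. L_y (weval a) V * b)))"
      by (simp add: qf_a[OF q] qf_generator[OF q] algebra_simps)
    finally show "0 \<le> qf q xs y'"
      using t tr_generator_nonneg[OF q] dominated[of xs] by simp
  qed
  moreover have "y w = t *\<^sub>R weval a w + (1 - t) *\<^sub>R y' w" for w
    using t by (simp add: y'_def)
  ultimately show ?thesis
    using ext st_a t unfolding extremal_state_def by metis
qed

end

context archimedean_module
begin

lemma extremal_state_point:
  assumes "extremal_state g h y"
  shows "\<exists>a\<in>K_set g h. y = weval a"
proof -
  interpret extremal_moments g h R y
    by unfold_locales (rule assms)
  obtain a where a: "y = weval a" using moments_point by blast
  have "qnonneg (heval a (of_rpoly (g ! i)))" if "i < length g" for i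
  proof -
    have q: "g ! i = 1 \<or> g ! i \<in> set g" using that by simp
    have "L_y y (g ! i) = of_real (tr (g ! i))"
      using vec_symmetric[OF vec_moments symmetric_generator[OF q], of 1 1] stateD(1)[OF st]
      by (simp add: of_real_def)
    then show ?thesis
      using tr_generator_nonneg[OF q] by (auto simp: qnonneg_def heval_of_rpoly a)
  qed
  moreover have "heval a (of_rpoly (h ! j)) = 0" if "j < length h" for j
    using stateD(3)[OF st, of "h ! j" 1 1] that by (simp add: heval_of_rpoly a)
  ultimately show ?thesis using a by (auto simp: K_set_def)
qed

lemma lin_pair_eval: "lin (pair_eval p)"
  unfolding pair_eval_def[abs_def] qRe_sum split_def by (intro lin_sum lin_entry)

lemma pair_eval_weval: "pair_eval p (weval a) = qRe (heval a (mpoly p))"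
proof -
  have "qRe (c * (x * z)) = qRe (z * c * x)" for c x z
    using qRe_mult_commute[of "c * x" z] by (simp add: mult.assoc)
  then show ?thesis
    by (simp add: pair_eval_def mpoly_def heval_sum qRe_sum split_def)
qed

text \<open>Strict inequality is what contradicts the extremal state, which only provides a feasible
  point with value at most \<open>l\<close>. For empty \<open>K_set g h\<close> the infimum is
  infinite and every \<open>l\<close> is certified.\<close>

theorem positive_certificate:
  assumes "ereal l < f_min (mpoly p) g h"
  shows "(\<lambda>y. pair_eval p y - l * qRe (y 0)) \<in> cone g h"
proof (rule ccontr)
  assume "(\<lambda>y. pair_eval p y - l * qRe (y 0)) \<notin> cone g h"
  then obtain y where y: "extremal_state g h y" "pair_eval p y \<le> l"
    using extremal_state_exists[OF cone_order_unit lin_pair_eval] by blast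
  then obtain a where a: "a \<in> K_set g h" "y = weval a"
    using extremal_state_point by blast
  have "f_min (mpoly p) g h \<le> ereal (qRe (heval a (mpoly p)))"
    unfolding f_min_def using a(1) by (rule INF_lower)
  also have "\<dots> \<le> ereal l" using y(2) a(2) by (simp add: pair_eval_weval)
  finally show False using assms by simp
qed

end


section \<open>Convergence of the hierarchies\<close>

lemma qm_expr_nonneg:
  assumes a: "a \<in> K_set g h" and "x \<in> QM_le g h d"
  shows "0 \<le> qRe (heval a x)"
proof -
  obtain \<sigma>0 \<sigma> T where x: "x = qm_expr g h \<sigma>0 \<sigma> T" "\<sigma>0 \<in> SOS" "\<And>i. i < length g \<Longrightarrow> \<sigma> i \<in> SOS"
    using assms(2) by (auto simp: QM_le_def SOS_le_def)
  have SOS: "\<exists>r\<ge>0. heval a s = of_real r" if s: "s \<in> SOS" for s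
  proof -
    obtain ps where ps: "s = (\<Sum>p\<leftarrow>ps. hstar (lpoly p) * lpoly p)"
      using s by (auto simp: SOS_def)
    have "heval a s = of_real (\<Sum>p\<leftarrow>ps. qnorm2 (heval a (lpoly p)))"
      unfolding ps by (induction ps) (simp_all add: heval_hstar qconj_mult_self)
    then show ?thesis
      by (intro exI[of _ "\<Sum>p\<leftarrow>ps. qnorm2 (heval a (lpoly p))"]) (auto intro!: sum_list_nonneg)
  qed
  have "0 \<le> qRe (heval a (\<sigma> i * of_rpoly (g ! i) + of_rpoly (g ! i) * \<sigma> i))" if i: "i < length g" for i
  proof -
    obtain r where "r \<ge> 0" "heval a (\<sigma> i) = of_real r" using SOS x(3)[OF i] by blast
    moreover obtain r' where "r' \<ge> 0" "heval a (of_rpoly (g ! i)) = of_real r'"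
      using a i by (auto simp: K_set_def qnonneg_def)
    ultimately show ?thesis by (simp flip: of_real_mult of_real_add)
  qed
  then have "0 \<le> (\<Sum>i<length g. qRe (heval a (\<sigma> i * of_rpoly (g ! i) + of_rpoly (g ! i) * \<sigma> i)))"
    by (intro sum_nonneg) auto
  moreover have "heval a (\<Sum>(\<tau>, \<nu>)\<leftarrow>T j. lpoly \<tau> * of_rpoly (h ! j) * hstar (lpoly \<nu>)
          + lpoly \<nu> * hstar (of_rpoly (h ! j)) * hstar (lpoly \<tau>)) = 0" if "j < length h" for j
    using a that by (simp add: heval_sum_list split_def heval_hstar K_set_def)
  moreover have "0 \<le> qRe (heval a \<sigma>0)" using SOS[OF x(2)] by auto
  ultimately show ?thesis
    by (simp add: x(1) qm_expr_def heval_sum qRe_sum)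
qed

lemma f_qsos_le_f_min: "f_qsos f g h d \<le> f_min f g h"
  unfolding f_qsos_def f_min_def
proof (intro Sup_least INF_greatest)
  fix v a
  assume "v \<in> {ereal l | l. \<exists>x\<in>QM_le g h d. \<exists>y\<in>vanishing_ideal \<inter> Sym (P_le (2 * d)). f - of_real l = x + y}"
    and a: "a \<in> K_set g h"
  then obtain l x y where v: "v = ereal l" "x \<in> QM_le g h d" "y \<in> vanishing_ideal" "f - of_real l = x + y"
    by blast
  have "heval a f - of_real l = heval a x"
    using arg_cong[OF v(4), of "heval a"] v(3) by (simp add: vanishing_ideal_def)
  then have "qRe (heval a f) - l = qRe (heval a x)"
    by (metis quat_sel_simps(5) quat_sel_simps(25))
  then show "v \<le> ereal (qRe (heval a f))"
    using qm_expr_nonneg[OF a v(2)] by (simp add: v(1))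
qed

lemma f_qsos_mono: "d \<le> d' \<Longrightarrow> f_qsos f g h d \<le> f_qsos f g h d'"
  unfolding f_qsos_def
  using QM_le_mono[of d d' g h] P_le_mono[of "2 * d" "2 * d'"]
  by (intro Sup_subset_mono) (fastforce simp: Sym_def)

section \<open>Monotonicity in the order and feasibility of points\<close>

lemma psd_subset:
  assumes "psd S M" "T \<subseteq> S" "finite S"
  shows "psd T M"
  unfolding psd_def
proof (intro conjI allI)
  show "\<forall>u\<in>T. \<forall>v\<in>T. M u v = qconj (M v u)"
    using assms unfolding psd_def by blast
  fix x :: "'a \<Rightarrow> quat"
  let ?x = "\<lambda>u. if u \<in> T then x u else 0"
  have "(\<Sum>u\<in>S. \<Sum>v\<in>S. qconj (?x u) * M u v * ?x v) = (\<Sum>u\<in>T. \<Sum>v\<in>T. qconj (x u) * M u v * x v)"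
    using assms by (intro sum.mono_neutral_cong_right sum.neutral) auto
  moreover have "qnonneg (\<Sum>u\<in>S. \<Sum>v\<in>S. qconj (?x u) * M u v * ?x v)"
    by (rule assms(1)[unfolded psd_def, THEN conjunct2, THEN spec])
  ultimately show "qnonneg (\<Sum>u\<in>T. \<Sum>v\<in>T. qconj (x u) * M u v * x v)" by simp
qed

lemma moment_feasible_mono:
  fixes g h :: "('n::finite) rpoly list"
  assumes "moment_feasible g h d' y" "d \<le> d'"
  shows "moment_feasible g h d y"
proof -
  note D = moment_feasibleD[OF assms(1)]
  have le: "words_le s \<subseteq> words_le t" if "s \<le> t" for s t :: nat
    using that by (auto simp: words_le_def)
  have "y w = qconj (y (wstar w))" if "w \<in> words_le (2 * d)" for w
  proof -
    have "wlen (wstar w) \<le> 2 * d'" using that assms(2) by (auto simp: words_le_def)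
    from D(2)[OF this] show ?thesis by simp
  qed
  moreover have "\<forall>u\<in>words_le (2 * d). \<forall>v\<in>words_le (2 * d). cyc_equiv u v \<longrightarrow> qRe (y u) = qRe (y v)"
    using D(3) le[of "2 * d" "2 * d'"] assms(2) by (auto dest: subsetD)
  moreover have "psd (words_le d) (moment_matrix y)"
    using psd_subset[OF D(4) le finite_words_le] assms(2) .
  moreover have "psd (words_le (d - half_deg (g ! i))) (localizing_matrix (g ! i) y)" if "i < length g" for i
    using psd_subset[OF D(5)[OF that] le finite_words_le] assms(2) by simp
  moreover have "L_y y (wmono u * (h ! j) * wmono v) = 0"
    if "j < length h" "wlen u + wlen v + wdeg (h ! j) \<le> 2 * d" for j u v
    using D(6)[of j u v] that assms(2) by simp
  moreover have "L_y y (wmono u * ((wmono w + wmono (wstar w)) * wmono (letter (Q i)) -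
        wmono (letter (Q i)) * (wmono w + wmono (wstar w))) * wmono v) = 0"
    if "wlen u + wlen v + wlen w + 1 \<le> 2 * d" for i u v w
    using D(7)[of u v w i] that assms(2) by simp
  ultimately show ?thesis
    unfolding moment_feasible_def Let_def using D(1) by blast
qed

lemma psd_weval:
  assumes "L_y (weval a) q = of_real r" "0 \<le> r"
  shows "psd S (localizing_matrix q (weval a))"
proof -
  have M: "localizing_matrix q (weval a) u v = qconj (weval a u) * of_real r * weval a v" for u v
    by (simp add: localizing_matrix_def L_y_weval_mult weval_wstar assms(1))
  show ?thesis
    unfolding psd_def
  proof (intro conjI ballI allI)
    fix u v
    show "localizing_matrix q (weval a) u v = qconj (localizing_matrix q (weval a) v u)"
      by (simp add: M mult.assoc)
  next
    fix x
    define s where "s = (\<Sum>v\<in>S. weval a v * x v)"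
    have "(\<Sum>u\<in>S. \<Sum>v\<in>S. qconj (x u) * localizing_matrix q (weval a) u v * x v) = qconj s * (of_real r * s)"
      unfolding s_def qconj_sum sum_distrib_right by (simp add: M sum_distrib_left mult.assoc)
    also have "\<dots> = of_real (r * qnorm2 s)"
      by (simp add: of_real_quat_comm[of r s] flip: mult.assoc) (simp add: qconj_mult_self of_real_quat_comm[of r])
    finally show "qnonneg (\<Sum>u\<in>S. \<Sum>v\<in>S. qconj (x u) * localizing_matrix q (weval a) u v * x v)"
      unfolding qnonneg_def using assms(2) by (intro exI[of _ "r * qnorm2 s"]) simp
  qed
qed

lemma moment_feasible_weval:
  assumes "a \<in> K_set g h"
  shows "moment_feasible g h d (weval a)"
proof -
  note rel = moment_relD[OF moment_rel_weval[of a]]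
  have "weval a w = qconj (weval a (wstar w))" for w
    by (simp add: weval_wstar)
  moreover have "qRe (weval a u) = qRe (weval a v)" if "cyc_equiv u v" for u v
    using that rel(2) by (auto simp: cyc_equiv_def cyclic_def)
  moreover have "psd (words_le d) (moment_matrix (weval a))"
  proof -
    have "moment_matrix (weval a) = localizing_matrix 1 (weval a)"
      by (simp add: fun_eq_iff localizing_matrix_def moment_matrix_def flip: wmono_add)
    then show ?thesis using psd_weval[of a 1 1] by simp
  qed
  moreover have "psd (words_le (d - half_deg (g ! i))) (localizing_matrix (g ! i) (weval a))" if "i < length g" for i
  proof -
    obtain r where "0 \<le> r" "L_y (weval a) (g ! i) = of_real r"
      using assms \<open>i < length g\<close> by (auto simp: K_set_def qnonneg_def heval_of_rpoly)
    then show ?thesis by (intro psd_weval)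
  qed
  moreover have "L_y (weval a) (wmono u * (h ! j) * wmono v) = 0" if "j < length h" for j u v
    using assms that by (simp add: K_set_def heval_of_rpoly L_y_weval_mult)
  moreover have "L_y (weval a) (wmono u * ((wmono w + wmono (wstar w)) * wmono (letter (Q i)) -
        wmono (letter (Q i)) * (wmono w + wmono (wstar w))) * wmono v) = 0" for i u v w
    using L_y_commute_trace[OF moment_rel_weval[of a], of "wmono u" "wmono w" "wmono (letter (Q i))" "wmono v"]
    by (simp add: semiring_class.distrib_left semiring_class.distrib_right left_diff_distrib right_diff_distrib
        mult.assoc del: L_y_wmono)
  moreover have "weval a 0 = 1" by simp
  ultimately show ?thesis
    unfolding moment_feasible_def Let_def by blast
qed

text \<open>The upper bound is assumed only eventually, because \<open>f_mom\<close> is compared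
  with \<open>f_min\<close> only at orders with \<open>hdeg f \<le> 2 * d\<close>.\<close>

lemma tendsto_of_lower_bounds:
  fixes F :: "nat \<Rightarrow> ereal"
  assumes "\<forall>\<^sub>F d in sequentially. F d \<le> L"
    and "\<And>l. ereal l < L \<Longrightarrow> \<forall>\<^sub>F d in sequentially. ereal l \<le> F d"
  shows "F \<longlonglongrightarrow> L"
proof (rule order_tendstoI)
  fix a assume "a < L"
  then obtain l where l: "a < ereal l" "ereal l < L" using ereal_dense2 by blast
  then show "\<forall>\<^sub>F d in sequentially. a < F d"
    using assms(2)[OF l(2)] by (auto elim!: eventually_mono intro: less_le_trans)
next
  fix a assume "L < a"
  then show "\<forall>\<^sub>F d in sequentially. F d < a"
    using assms(1) by (auto elim!: eventually_mono intro: le_less_trans)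
qed

theorem theorem6p5:
  fixes f :: "('n::finite) hpoly" and g h :: "'n rpoly list"
  assumes "f \<in> Sym P_space"
    and "\<forall>i<length g. rstar (g ! i) = g ! i"
    and "archimedean g h"
  shows "mono_on {d. admissible_order f g h d} (f_qsos f g h) \<and>
         f_qsos f g h \<longlonglongrightarrow> f_min f g h \<and>
         mono_on {d. admissible_order f g h d} (f_mom f g h) \<and>
         f_mom f g h \<longlonglongrightarrow> f_min f g h"
proof -
  obtain R where "0 < R" "of_real R - (\<Sum>i\<in>UNIV. hword (letter (Q i) + letter (Qbar i))) \<in> QM g h"
    using assms(3) by (auto simp: archimedean_def)
  then interpret archimedean_module g h R
    using assms(2) by unfold_locales (auto simp: in_set_conv_nth)
  obtain t where "f \<in> P_le t"
    using assms(1) by (auto simp: Sym_def P_space_eq)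
  then have "f \<in> P_le (hdeg f)"
    unfolding hdeg_def by (rule LeastI)
  \<comment> \<open>A representation of least degree is usable at every such order, so the single
    functional \<open>pair_eval p\<close> describes the objective of all relaxations.\<close>
  then obtain p where p: "f = mpoly p" "mdeg p \<le> hdeg f"
    by (auto simp: P_le_def)
  have f: "f \<in> P_space" "hstar f = f"
    using assms(1) by (auto simp: Sym_def)
  have LR: "LR_y d y f = pair_eval p y" if "moment_feasible g h d y" "hdeg f \<le> 2 * d" for d y
    unfolding p(1) using moment_feasibleD(3)[OF that(1)] p(2) that(2) by (intro LR_y_mpoly) auto
  have cert: "(\<lambda>y. pair_eval p y - l * qRe (y 0)) \<in> cone g h" if "ereal l < f_min f g h" for l
    using positive_certificate that unfolding p(1) .
  have mom_le: "f_mom f g h d \<le> f_min f g h" if "hdeg f \<le> 2 * d" for d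
    unfolding f_mom_def f_min_def
  proof (rule INF_mono)
    fix a assume "a \<in> K_set g h"
    then have "moment_feasible g h d (weval a)" by (rule moment_feasible_weval)
    moreover from LR[OF this that] have "LR_y d (weval a) f = qRe (heval a f)"
      by (simp add: pair_eval_weval p(1))
    ultimately show "\<exists>y\<in>{y. moment_feasible g h d y}. ereal (LR_y d y f) \<le> ereal (qRe (heval a f))"
      by auto
  qed
  have "mono_on {d. admissible_order f g h d} (f_qsos f g h)"
    by (intro mono_onI f_qsos_mono)
  moreover have "f_qsos f g h \<longlonglongrightarrow> f_min f g h"
  proof (rule tendsto_of_lower_bounds)
    show "\<forall>\<^sub>F d in sequentially. f_qsos f g h d \<le> f_min f g h"
      by (simp add: f_qsos_le_f_min)
    fix l assume "ereal l < f_min f g h"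
    from cone_QM[OF cert[OF this] assms(2)] obtain d0 x where
      x: "x \<in> QM_le g h d0" "x \<in> P_space" "hstar x = x"
         "\<And>a. pair_eval p (weval a) - l = qRe (heval a x)"
      by auto
    define r where "r = f - of_real l - x"
    have r_eq: "r = f + (-1) *\<^sub>R (of_real l + x)" by (simp add: r_def)
    have "(of_real l :: 'n hpoly) \<in> P_space"
      using P_space_monomial[of 0 "of_real l" 0] by (simp add: const_of_real)
    then have r: "r \<in> P_space"
      unfolding r_eq by (intro P_space_add P_space_scaleR f x)
    have r_star: "hstar r = r"
      using f x by (simp add: r_def)
    have "heval a r = 0" for a
    proof -
      \<comment> \<open>Values of a symmetric element are real, so it is enough that the real part
        vanishes.\<close>
      have "heval a r = of_real (qRe (heval a r))"
        using heval_hstar[of a r] r_star by (simp flip: qconj_eq_iff_real)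
      moreover have "qRe (heval a r) = 0"
        using x(4)[of a] by (simp add: r_def pair_eval_weval p(1))
      ultimately show ?thesis by simp
    qed
    then have "r \<in> vanishing_ideal" by (simp add: vanishing_ideal_def)
    obtain s where s: "r \<in> P_le s" using r by (auto simp: P_space_eq)
    \<comment> \<open>The order accommodates both the certificate, found at \<open>d0\<close>, and
      the remainder, of degree at most \<open>s\<close>.\<close>
    have "ereal l \<le> f_qsos f g h d" if d: "d \<ge> d0 + s" for d
    proof -
      have "x \<in> QM_le g h d" using x(1) QM_le_mono[of d0 d g h] d by auto
      moreover have "r \<in> vanishing_ideal \<inter> Sym (P_le (2 * d))"
        using \<open>r \<in> vanishing_ideal\<close> r_star s P_le_mono[of s "2 * d"] d by (auto simp: Sym_def)
      moreover have "f - of_real l = x + r" by (simp add: r_def)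
      ultimately show ?thesis
        unfolding f_qsos_def by (intro Sup_upper) blast
    qed
    then show "\<forall>\<^sub>F d in sequentially. ereal l \<le> f_qsos f g h d"
      unfolding eventually_sequentially by blast
  qed
  moreover have "mono_on {d. admissible_order f g h d} (f_mom f g h)"
  proof (rule mono_onI)
    fix d d' assume d: "d \<in> {d. admissible_order f g h d}" "d' \<in> {d. admissible_order f g h d}" "d \<le> d'"
    then have "hdeg f \<le> 2 * d" "hdeg f \<le> 2 * d'" by (auto simp: admissible_order_def)
    then show "f_mom f g h d \<le> f_mom f g h d'"
      unfolding f_mom_def
    proof (intro INF_mono)
      fix y assume "y \<in> {y. moment_feasible g h d' y}"
      then have y: "moment_feasible g h d' y" "moment_feasible g h d y"
        using moment_feasible_mono[OF _ d(3)] by auto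
      then have "LR_y d y f = LR_y d' y f"
        using LR \<open>hdeg f \<le> 2 * d\<close> \<open>hdeg f \<le> 2 * d'\<close> by simp
      then show "\<exists>y'\<in>{y. moment_feasible g h d y}. ereal (LR_y d y' f) \<le> ereal (LR_y d' y f)"
        using y by auto
    qed
  qed
  moreover have "f_mom f g h \<longlonglongrightarrow> f_min f g h"
  proof (rule tendsto_of_lower_bounds)
    show "\<forall>\<^sub>F d in sequentially. f_mom f g h d \<le> f_min f g h"
      unfolding eventually_sequentially by (intro exI[of _ "hdeg f"] allI impI mom_le) simp
    fix l assume "ereal l < f_min f g h"
    from cone_moment_nonneg[OF cert[OF this]] obtain d0 where
      d0: "\<forall>d\<ge>d0. \<forall>y. moment_feasible g h d y \<longrightarrow> 0 \<le> pair_eval p y - l * qRe (y 0)" by blast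
    have "ereal l \<le> f_mom f g h d" if d: "d \<ge> d0 + hdeg f" for d
      unfolding f_mom_def
    proof (rule INF_greatest)
      fix y assume "y \<in> {y. moment_feasible g h d y}"
      then have y: "moment_feasible g h d y" by simp
      have "0 \<le> pair_eval p y - l * qRe (y 0)"
        using d0[rule_format, OF _ y] d by simp
      then have "0 \<le> pair_eval p y - l"
        by (simp add: moment_feasibleD(1)[OF y])
      then show "ereal l \<le> ereal (LR_y d y f)" using LR[OF y] d by simp
    qed
    then show "\<forall>\<^sub>F d in sequentially. ereal l \<le> f_mom f g h d"
      unfolding eventually_sequentially by blast
  qed
  ultimately show ?thesis by blast
qed

end
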